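(* Let $X, Y$ be positive operators and let $\nu \in (0,1]$. If $I \leq Y \leq X$, then $$D_{\nu}(X\vert Y) \geq \mathrm{Tr}\left[X^{1-\nu}\ln_{\nu}\left(Y^{-1/2}XY^{-1/2}\right)\right].$$
   Context: Operators act on a Hilbert space, and the traces that appear are assumed to be finite (in particular this covers matrices); $I$ is the identity and $\leq$ is the usual (Loewner) order on self-adjoint operators. For $\nu\in(0,1]$ and $x\ge 0$, the generalized logarithm is $\ln_{\nu} x = \frac{x^{\nu}-1}{\nu}$, applied to positive operators by functional calculus. For positive operators $X, Y$ (traces not required to equal $1$), the Tsallis relative entropy is $$D_{\nu}(X\vert Y) = \frac{\mathrm{Tr}[X - X^{1-\nu}Y^{\nu}]}{\nu} = \mathrm{Tr}[X^{1-\nu}(\ln_{\nu}X - \ln_{\nu}Y)].$$ *)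

theory Defs
  imports "HOL-Analysis.Analysis" "HOL-Library.Complex_Order"
begin

section \<open>Complex Hilbert spaces\<close>

text \<open>The inner product is conjugate-linear in its first argument. Definiteness and
  nonnegativity of \<open>cinner x x\<close> follow from \<open>norm_eq_sqrt_cinner\<close> and the norm axioms.\<close>

class complex_hilbert = banach +
  fixes scaleC :: "complex \<Rightarrow> 'a \<Rightarrow> 'a"  (infixr "*\<^sub>C" 75)
    and cinner :: "'a \<Rightarrow> 'a \<Rightarrow> complex"
  assumes scaleC_add_right: "c *\<^sub>C (x + y) = c *\<^sub>C x + c *\<^sub>C y"
    and scaleC_add_left: "(c + d) *\<^sub>C x = c *\<^sub>C x + d *\<^sub>C x"
    and scaleC_scaleC: "c *\<^sub>C (d *\<^sub>C x) = (c * d) *\<^sub>C x"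
    and scaleC_complex_of_real: "complex_of_real r *\<^sub>C x = r *\<^sub>R x"
    and cinner_commute: "cinner x y = cnj (cinner y x)"
    and cinner_add_right: "cinner x (y + z) = cinner x y + cinner x z"
    and cinner_scaleC_right: "cinner x (c *\<^sub>C y) = c * cinner x y"
    and norm_eq_sqrt_cinner: "norm x = sqrt (Re (cinner x x))"

instantiation complex :: complex_hilbert
begin

definition scaleC_complex :: "complex \<Rightarrow> complex \<Rightarrow> complex" where
  "scaleC_complex c x = c * x"

definition cinner_complex :: "complex \<Rightarrow> complex \<Rightarrow> complex" where
  "cinner_complex x y = cnj x * y"

instance
  by standard
    (auto simp: scaleC_complex_def cinner_complex_def algebra_simps scaleR_conv_of_real
      cmod_def power2_eq_square)

end

text \<open>In particular, \<open>complex ^ 'n\<close> carries its standard Hilbert space structure.\<close>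

instantiation vec :: (complex_hilbert, finite) complex_hilbert
begin

definition scaleC_vec :: "complex \<Rightarrow> 'a ^ 'b \<Rightarrow> 'a ^ 'b" where
  "scaleC_vec c x = (\<chi> i. c *\<^sub>C (x $ i))"

definition cinner_vec :: "'a ^ 'b \<Rightarrow> 'a ^ 'b \<Rightarrow> complex" where
  "cinner_vec x y = (\<Sum>i\<in>UNIV. cinner (x $ i) (y $ i))"

instance
proof
  fix x :: "'a ^ 'b"
  have "Re (cinner v v) = (norm v)\<^sup>2" for v :: 'a
    by (metis norm_eq_sqrt_cinner norm_ge_zero real_sqrt_ge_0_iff real_sqrt_pow2)
  then show "norm x = sqrt (Re (cinner x x))"
    by (simp add: cinner_vec_def norm_vec_def L2_set_def)
next
  fix x y :: "'a ^ 'b"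
  show "cinner x y = cnj (cinner y x)"
    unfolding cinner_vec_def cnj_sum by (intro sum.cong refl cinner_commute)
qed (auto simp: scaleC_vec_def cinner_vec_def vec_eq_iff scaleC_add_right scaleC_add_left
    scaleC_scaleC scaleC_complex_of_real cinner_add_right cinner_scaleC_right
    sum.distrib sum_distrib_left)

end

section \<open>Bounded operators\<close>

text \<open>The type \<open>'a \<Rightarrow>\<^sub>L 'a\<close> consists of the bounded real-linear maps, so complex linearity
  is a separate requirement.\<close>

definition complex_linear :: "('a::complex_hilbert \<Rightarrow>\<^sub>L 'a) \<Rightarrow> bool" where
  "complex_linear T \<longleftrightarrow> (\<forall>c x. T (c *\<^sub>C x) = c *\<^sub>C T x)"

text \<open>Here \<open>\<le>\<close> is the order on complex numbers from \<open>Complex_Order\<close>, so that the inner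
  product is also required to be real; on a complex Hilbert space this already forces
  \<open>T\<close> to be self-adjoint.\<close>

definition positive_op :: "('a::complex_hilbert \<Rightarrow>\<^sub>L 'a) \<Rightarrow> bool" where
  "positive_op T \<longleftrightarrow> complex_linear T \<and> (\<forall>x. 0 \<le> cinner x (T x))"

definition loewner_le ::
    "('a::complex_hilbert \<Rightarrow>\<^sub>L 'a) \<Rightarrow> ('a \<Rightarrow>\<^sub>L 'a) \<Rightarrow> bool"  (infix "\<le>\<^sub>L" 50) where
  "S \<le>\<^sub>L T \<longleftrightarrow> positive_op (T - S)"

definition op_adjoint :: "('a::complex_hilbert \<Rightarrow>\<^sub>L 'a) \<Rightarrow> ('a \<Rightarrow>\<^sub>L 'a)" where
  "op_adjoint T = (THE S :: 'a \<Rightarrow>\<^sub>L 'a. \<forall>x y. cinner (S x) y = cinner x (T y))"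

definition op_spectrum :: "('a::complex_hilbert \<Rightarrow>\<^sub>L 'a) \<Rightarrow> complex set" where
  "op_spectrum T = {z. \<not> (\<exists>S :: 'a \<Rightarrow>\<^sub>L 'a.
     \<forall>x. S (T x - z *\<^sub>C x) = x \<and> T (S x) - z *\<^sub>C S x = x)}"

section \<open>Continuous functional calculus\<close>

definition op_poly :: "real poly \<Rightarrow> ('a::complex_hilbert \<Rightarrow>\<^sub>L 'a) \<Rightarrow> ('a \<Rightarrow>\<^sub>L 'a)" where
  "op_poly p T = (\<Sum>i\<le>degree p. coeff p i *\<^sub>R (((o\<^sub>L) T ^^ i) id_blinfun))"

text \<open>For self-adjoint \<open>T\<close> (whose spectrum is real) and \<open>f\<close> continuous on the spectrum of \<open>T\<close>,
  \<open>op_fun f T\<close> is the limit in operator norm of \<open>p\<^sub>n(T)\<close> for any real polynomials \<open>p\<^sub>n\<close>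
  converging to \<open>f\<close> uniformly on the spectrum.\<close>

definition op_fun :: "(real \<Rightarrow> real) \<Rightarrow> ('a::complex_hilbert \<Rightarrow>\<^sub>L 'a) \<Rightarrow> ('a \<Rightarrow>\<^sub>L 'a)" where
  "op_fun f T = (THE S. \<exists>p :: nat \<Rightarrow> real poly.
     uniform_limit {r. complex_of_real r \<in> op_spectrum T} (\<lambda>n. poly (p n)) f sequentially \<and>
     (\<lambda>n. op_poly (p n) T) \<longlonglongrightarrow> S)"

text \<open>The case distinction makes \<open>op_powr T 0\<close> the identity even if \<open>T\<close> is not invertible,
  since \<open>0 powr 0 = 0\<close>. Negative exponents are meaningful for invertible \<open>T\<close> only.\<close>

definition op_powr :: "('a::complex_hilbert \<Rightarrow>\<^sub>L 'a) \<Rightarrow> real \<Rightarrow> ('a \<Rightarrow>\<^sub>L 'a)" where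
  "op_powr T a = op_fun (\<lambda>x. if a = 0 then 1 else x powr a) T"

definition gen_ln :: "real \<Rightarrow> real \<Rightarrow> real" where
  "gen_ln \<nu> x = (x powr \<nu> - 1) / \<nu>"

section \<open>Trace\<close>

definition is_onb :: "'a::complex_hilbert set \<Rightarrow> bool" where
  "is_onb B \<longleftrightarrow> (\<forall>e\<in>B. \<forall>e'\<in>B. cinner e e' = (if e = e' then 1 else 0)) \<and>
     (\<forall>x. (\<forall>e\<in>B. cinner e x = 0) \<longrightarrow> x = 0)"

definition op_abs :: "('a::complex_hilbert \<Rightarrow>\<^sub>L 'a) \<Rightarrow> ('a \<Rightarrow>\<^sub>L 'a)" where
  "op_abs T = op_fun sqrt (op_adjoint T o\<^sub>L T)"

definition trace_class :: "('a::complex_hilbert \<Rightarrow>\<^sub>L 'a) \<Rightarrow> bool" where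
  "trace_class T \<longleftrightarrow> complex_linear T \<and>
     (\<exists>B. is_onb B \<and> (\<lambda>e. cinner e (op_abs T e)) summable_on B)"

text \<open>The value does not depend on the chosen orthonormal basis when \<open>T\<close> is of trace class.\<close>

definition op_trace :: "('a::complex_hilbert \<Rightarrow>\<^sub>L 'a) \<Rightarrow> complex" where
  "op_trace T = (\<Sum>\<^sub>\<infinity>e\<in>(SOME B. is_onb B). cinner e (T e))"

definition tsallis_rel_entropy ::
    "real \<Rightarrow> ('a::complex_hilbert \<Rightarrow>\<^sub>L 'a) \<Rightarrow> ('a \<Rightarrow>\<^sub>L 'a) \<Rightarrow> complex" where
  "tsallis_rel_entropy \<nu> X Y =
     op_trace (X - (op_powr X (1 - \<nu>) o\<^sub>L op_powr Y \<nu>)) / complex_of_real \<nu>"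

end

theory Submission
  imports Defs "HOL-Computational_Algebra.Fundamental_Theorem_Algebra"
begin

text \<open>
  Put \<open>Z = Y\<^sup>-\<^sup>1\<^sup>/\<^sup>2 X Y\<^sup>-\<^sup>1\<^sup>/\<^sup>2\<close>, so that \<open>I \<le> Z\<close>. In finite dimension everything follows from
  \<open>Tr X\<^sup>1\<^sup>-\<^sup>\<nu> k(Y) Z\<^sup>\<nu> k(Y) \<le> Tr X k(Y)\<^sup>2 Y\<^sup>-\<^sup>\<nu>\<close>: the cases \<open>k = 1\<close> and \<open>k\<^sup>2 = Y\<^sup>\<nu> - I\<close>, the latter combined
  with \<open>Z\<^sup>\<nu> \<ge> I\<close>, add up to \<open>Tr X\<^sup>1\<^sup>-\<^sup>\<nu> (Z\<^sup>\<nu> + Y\<^sup>\<nu> - I) \<le> Tr X\<close>. The inequality with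
  \<open>k\<close> is an equality for \<open>\<nu> = 1\<close> and for \<open>\<nu> = 0\<close>; in between it is an interpolation of weighted \<open>\<ell>\<^sup>2\<close> norms, because the
  weights \<open>x\<^sup>1\<^sup>-\<^sup>\<nu> z\<^sup>\<nu>\<close> are integrals of parallel sums of \<open>x\<close> and \<open>t z\<close>.

  In infinite dimension \<open>X\<close> and \<open>Y\<close> have no trace, but \<open>Z - I\<close> and hence \<open>X - Y\<close> do. The
  inequality is rewritten as
  \<open>Tr Y\<^sup>\<nu>\<^sup>/\<^sup>2 (X\<^sup>1\<^sup>-\<^sup>\<nu> - Y\<^sup>1\<^sup>-\<^sup>\<nu>) Y\<^sup>\<nu>\<^sup>/\<^sup>2 + Tr (Z\<^sup>\<nu> - I)\<^sup>1\<^sup>/\<^sup>2 X\<^sup>1\<^sup>-\<^sup>\<nu> (Z\<^sup>\<nu> - I)\<^sup>1\<^sup>/\<^sup>2 \<le> Tr (X - Y)\<close>,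
  where both operators on the left are positive (the first by the Loewner-Heinz inequality).
  Hence it survives, in the manner of Fatou's lemma, the strong limit of the finite-rank
  compressions of \<open>Y\<close> and \<open>Z\<close>, once the right-hand sides are known to converge.
\<close>

section \<open>Operators on a complex Hilbert space\<close>

text \<open>Why these two k: with k = 1 the right-hand side is Tr X Y^(-\<nu>), with k^2 = Y^\<nu> -
  I it is Tr X - Tr X Y^(-\<nu>), so the terms in Y^(-\<nu>) cancel. The obstacle is that X, Y and Z
  have three unrelated eigenbases. Interpolation copes with this since at each endpoint one of the
  three bases is summed out by Parseval, and since in an eigenbasis of Y the diagonals of X and Z
  are proportional. In infinite dimension the trace-class hypothesis on X^(1-\<nu>) ln_\<nu> Z gives
  summability in some basis, whereas \<open>op_trace\<close> sums over a basis picked by choice.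
  Traces are therefore written as squared Hilbert-Schmidt norms, which depend neither on the basis
  nor on passing to the adjoint. The functional calculus is a limit along polynomials; what makes it
  well defined is that the norm of p(T) is at most the supremum of |p| on the spectrum. This is
  derived from the factorisation of real polynomials.\<close>

lemma cmod_sq_eq: "(complex_of_real (cmod z))\<^sup>2 = z * cnj z"
  by (simp flip: complex_norm_square)

lemma cinner_add_left: "cinner (x + y) z = cinner x z + cinner (y::'a::complex_hilbert) z"
  by (metis cinner_add_right cinner_commute complex_cnj_add)

lemma cinner_scaleC_left: "cinner (c *\<^sub>C x) y = cnj c * cinner (x::'a::complex_hilbert) y"
  by (metis cinner_commute cinner_scaleC_right complex_cnj_mult)

lemma cinner_scaleR_right: "cinner x (r *\<^sub>R y) = r *\<^sub>R cinner (x::'a::complex_hilbert) y"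
  by (simp add: cinner_scaleC_right scaleR_conv_of_real flip: scaleC_complex_of_real)

lemma cinner_scaleR_left: "cinner (r *\<^sub>R x) y = r *\<^sub>R cinner (x::'a::complex_hilbert) y"
  by (simp add: cinner_scaleC_left scaleR_conv_of_real flip: scaleC_complex_of_real)

lemma cinner_self: "cinner x x = complex_of_real ((norm (x::'a::complex_hilbert))\<^sup>2)"
proof -
  have "Im (cinner x x) = 0"
    using arg_cong[OF cinner_commute[of x x], of Im] by simp
  moreover have "Re (cinner x x) = (norm x)\<^sup>2"
    by (metis norm_eq_sqrt_cinner norm_ge_zero real_sqrt_ge_0_iff real_sqrt_pow2)
  ultimately show ?thesis
    by (simp add: complex_eq_iff)
qed

lemma cauchy_schwarz: "cmod (cinner x y) \<le> norm x * norm (y::'a::complex_hilbert)"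
proof (cases "x = 0")
  case True
  have "cinner (0::'a) y = 0"
    using cinner_add_left[of 0 0 y] by simp
  with True show ?thesis by simp
next
  case False
  define n where "n = norm x"
  have n: "n > 0" using False by (simp add: n_def)
  define t where "t = - cinner x y / complex_of_real (n\<^sup>2)"
  have "0 \<le> Re (cinner (y + t *\<^sub>C x) (y + t *\<^sub>C x))"
    by (simp add: cinner_self)
  also have "cinner (y + t *\<^sub>C x) (y + t *\<^sub>C x) =
      cinner y y + t * cnj (cinner x y) + cnj t * cinner x y + cnj t * t * cinner x x"
    by (simp add: cinner_add_left cinner_add_right cinner_scaleC_left cinner_scaleC_right
        algebra_simps) (metis cinner_commute)
  also have "Re \<dots> = (norm y)\<^sup>2 - (cmod (cinner x y))\<^sup>2 / n\<^sup>2"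
  proof -
    have a: "t * cnj (cinner x y) = complex_of_real (- (cmod (cinner x y))\<^sup>2 / n\<^sup>2)"
      unfolding t_def by (simp add: cmod_sq_eq)
    have b: "cnj t * cinner x y = complex_of_real (- (cmod (cinner x y))\<^sup>2 / n\<^sup>2)"
      unfolding t_def by (simp add: cmod_sq_eq mult.commute)
    have c: "cnj t * t * cinner x x = complex_of_real ((cmod (cinner x y))\<^sup>2 / n\<^sup>2)"
      unfolding t_def cinner_self n_def[symmetric] using n
      by (simp add: field_simps) (metis cmod_sq_eq)
    show ?thesis
      unfolding a b c by (simp add: cinner_self)
  qed
  finally have "(cmod (cinner x y))\<^sup>2 \<le> (n * norm y)\<^sup>2"
    using n by (simp add: field_simps power_mult_distrib)
  then show ?thesis
    using n n_def by (meson mult_nonneg_nonneg norm_ge_zero power2_le_imp_le)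
qed

interpretation cinner: bounded_bilinear "cinner :: 'a::complex_hilbert \<Rightarrow> 'a \<Rightarrow> complex"
  by unfold_locales
    (auto simp: cinner_add_left cinner_add_right cinner_scaleR_left cinner_scaleR_right
      intro!: exI[of _ 1] cauchy_schwarz)

lemma norm_scaleC: "norm (c *\<^sub>C x) = cmod c * norm (x::'a::complex_hilbert)"
proof -
  have "complex_of_real ((norm (c *\<^sub>C x))\<^sup>2) = (c * cnj c) * cinner x x"
    unfolding cinner_self[symmetric] by (simp add: cinner_scaleC_left cinner_scaleC_right mult_ac)
  also have "\<dots> = complex_of_real ((cmod c * norm x)\<^sup>2)"
    by (simp add: cinner_self power_mult_distrib cmod_sq_eq[symmetric])
  finally have "complex_of_real ((norm (c *\<^sub>C x))\<^sup>2) = complex_of_real ((cmod c * norm x)\<^sup>2)" .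
  then show ?thesis
    using of_real_eq_iff power2_eq_iff_nonneg by (metis mult_nonneg_nonneg norm_ge_zero)
qed

interpretation scaleC: bounded_bilinear "scaleC :: complex \<Rightarrow> 'a::complex_hilbert \<Rightarrow> 'a"
proof
  fix a a' :: complex and b b' :: 'a and r :: real
  show "(a + a') *\<^sub>C b = a *\<^sub>C b + a' *\<^sub>C b" "a *\<^sub>C (b + b') = a *\<^sub>C b + a *\<^sub>C b'"
    by (simp_all add: scaleC_add_left scaleC_add_right)
  show "(r *\<^sub>R a) *\<^sub>C b = r *\<^sub>R a *\<^sub>C b"
    by (simp add: scaleR_conv_of_real scaleC_scaleC flip: scaleC_complex_of_real)
  show "a *\<^sub>C r *\<^sub>R b = r *\<^sub>R a *\<^sub>C b"
    by (simp add: scaleC_scaleC mult.commute flip: scaleC_complex_of_real)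
  show "\<exists>K. \<forall>a (b::'a). norm (a *\<^sub>C b) \<le> norm a * norm b * K"
    by (auto intro!: exI[of _ 1] simp: norm_scaleC)
qed

lemma scaleC_one [simp]: "1 *\<^sub>C (x::'a::complex_hilbert) = x"
  using scaleC_complex_of_real[of 1 x] by simp

lemma cinner_ext: "(\<And>z. cinner z x = cinner z y) \<Longrightarrow> x = (y::'a::complex_hilbert)"
proof -
  assume "\<And>z. cinner z x = cinner z y"
  then have "cinner (x - y) (x - y) = 0"
    by (simp add: cinner.diff_right)
  then show ?thesis
    by (simp add: cinner_self)
qed

lemma norm_plus_sq: "(norm (x + y))\<^sup>2 = (norm x)\<^sup>2 + 2 * Re (cinner x y) + (norm (y::'a::complex_hilbert))\<^sup>2"
proof -
  have "complex_of_real ((norm (x + y))\<^sup>2) = cinner x x + (cinner x y + cnj (cinner x y)) + cinner y y"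
    unfolding cinner_self[symmetric]
    by (simp add: cinner_add_left cinner_add_right) (metis cinner_commute)
  then have "Re (complex_of_real ((norm (x + y))\<^sup>2)) = Re (cinner x x + (cinner x y + cnj (cinner x y)) + cinner y y)"
    by simp
  then show ?thesis
    by (simp add: cinner_self)
qed

lemma norm_minus_sq: "(norm (x - y))\<^sup>2 = (norm x)\<^sup>2 - 2 * Re (cinner x y) + (norm (y::'a::complex_hilbert))\<^sup>2"
  using norm_plus_sq[of x "- y"] by (simp add: cinner.minus_right)

lemma polarization:
  "4 * cinner x y = complex_of_real ((norm (x + y))\<^sup>2 - (norm (x - y))\<^sup>2)
     + \<i> * complex_of_real ((norm (\<i> *\<^sub>C x + y))\<^sup>2 - (norm (\<i> *\<^sub>C x - (y::'a::complex_hilbert)))\<^sup>2)"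
  unfolding norm_plus_sq norm_minus_sq
  by (simp add: complex_eq_iff cinner_scaleC_left norm_scaleC)

lemma norm_sq_eq_Re_cinner: "(norm (x::'a::complex_hilbert))\<^sup>2 = Re (cinner x x)"
  by (simp add: cinner_self)

section \<open>Self-adjoint operators, bounds on the quadratic form, and the norm\<close>

definition herm :: "('a::complex_hilbert \<Rightarrow>\<^sub>L 'a) \<Rightarrow> bool" where
  "herm T \<longleftrightarrow> (\<forall>x y. cinner (T x) y = cinner x (T y))"

lemma hermD: "herm T \<Longrightarrow> cinner (blinfun_apply T x) y = cinner x (blinfun_apply T y)"
  by (simp add: herm_def)

lemma herm_complex_linear:
  assumes "herm T" shows "complex_linear T"
  unfolding complex_linear_def
proof (intro allI, rule cinner_ext)
  fix c x z
  show "cinner z (blinfun_apply T (c *\<^sub>C x)) = cinner z (c *\<^sub>C blinfun_apply T x)"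
    by (simp only: hermD[OF assms, symmetric] cinner_scaleC_right)
qed

lemma herm_scaleC: "herm T \<Longrightarrow> blinfun_apply T (c *\<^sub>C x) = c *\<^sub>C blinfun_apply T x"
  using herm_complex_linear unfolding complex_linear_def by blast

lemma herm_cinner_real: "herm T \<Longrightarrow> cinner x (blinfun_apply T x) = complex_of_real (Re (cinner x (blinfun_apply T x)))"
  by (metis Reals_cnj_iff cinner_commute herm_def of_real_Re)

text \<open>Polarisation of the reality of the quadratic form: the vectors x + y and x + i y yield
  the imaginary and the real part of the symmetry relation.\<close>

lemma positive_op_herm:
  assumes "positive_op T" shows "herm T"
  unfolding herm_def
proof (intro allI)
  fix x y
  have lin: "blinfun_apply T (c *\<^sub>C u) = c *\<^sub>C blinfun_apply T u" for c u
    using assms by (simp add: positive_op_def complex_linear_def)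
  have im: "Im (cinner u (blinfun_apply T u)) = 0" for u
    using assms by (simp add: positive_op_def less_eq_complex_def)
  have "Im (cinner x (blinfun_apply T y)) + Im (cinner y (blinfun_apply T x)) = 0"
    using im[of "x + y"] im[of x] im[of y]
    by (simp add: blinfun.add_right cinner_add_left cinner_add_right)
  moreover have "Re (cinner x (blinfun_apply T y)) - Re (cinner y (blinfun_apply T x)) = 0"
    using im[of "x + \<i> *\<^sub>C y"] im[of x] im[of y]
    by (simp add: blinfun.add_right cinner_add_left cinner_add_right lin cinner_scaleC_left
        cinner_scaleC_right)
  ultimately have "cinner x (blinfun_apply T y) = cnj (cinner y (blinfun_apply T x))"
    by (simp add: complex_eq_iff)
  then show "cinner (blinfun_apply T x) y = cinner x (blinfun_apply T y)"
    by (metis cinner_commute)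
qed

text \<open>The interval takes over the role of the spectrum: it can be the same for all operators
  of a net, and membership is checked on the quadratic form alone.\<close>

definition op_between :: "real \<Rightarrow> real \<Rightarrow> ('a::complex_hilbert \<Rightarrow>\<^sub>L 'a) \<Rightarrow> bool" where
  "op_between m M T \<longleftrightarrow> herm T \<and> (\<forall>x. m * (norm x)\<^sup>2 \<le> Re (cinner x (T x)) \<and>
     Re (cinner x (T x)) \<le> M * (norm x)\<^sup>2)"

lemma op_betweenD:
  assumes "op_between m M T"
  shows "herm T" "m * (norm x)\<^sup>2 \<le> Re (cinner x (blinfun_apply T x))"
    "Re (cinner x (blinfun_apply T x)) \<le> M * (norm x)\<^sup>2"
  using assms by (auto simp: op_between_def)

lemma Re_cinner_le: "Re (cinner x (blinfun_apply T x)) \<le> norm T * (norm (x::'a::complex_hilbert))\<^sup>2"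
proof -
  have "Re (cinner x (blinfun_apply T x)) \<le> norm x * norm (blinfun_apply T x)"
    using cauchy_schwarz complex_Re_le_cmod order_trans by blast
  also have "\<dots> \<le> norm x * (norm T * norm x)"
    by (intro mult_left_mono norm_blinfun) auto
  finally show ?thesis by (simp add: power2_eq_square mult_ac)
qed

lemma op_between_norm: "herm T \<Longrightarrow> op_between (- norm T) (norm T) T"
  using Re_cinner_le[of _ T] Re_cinner_le[of _ "- T"]
  by (auto simp: op_between_def blinfun.minus_left cinner.minus_right) (metis minus_le_iff)

text \<open>Evaluate the quadratic form at x + y and x - y, where y is T x rescaled to the length of
  x, and apply the parallelogram law.\<close>

lemma herm_norm_le:
  fixes T :: "'a::complex_hilbert \<Rightarrow>\<^sub>L 'a"
  assumes T: "herm T" and c: "\<And>x. \<bar>Re (cinner x (T x))\<bar> \<le> c * (norm x)\<^sup>2" and "0 \<le> c"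
  shows "norm T \<le> c"
proof (rule norm_blinfun_bound[OF \<open>0 \<le> c\<close>])
  fix x
  show "norm (T x) \<le> c * norm x"
  proof (cases "x = 0 \<or> T x = 0")
    case True
    with \<open>0 \<le> c\<close> show ?thesis by (auto simp: blinfun.zero_right)
  next
    case False
    define y where "y = (norm x / norm (T x)) *\<^sub>R T x"
    have ny: "norm y = norm x" using False by (simp add: y_def)
    have "Re (cinner y (T x)) = norm x * norm (T x)"
    proof -
      have "Re (cinner y (T x)) = norm x / norm (T x) * (norm (T x))\<^sup>2"
        unfolding y_def cinner_scaleR_left norm_sq_eq_Re_cinner[of "T x"] by simp
      also have "\<dots> = norm x * norm (T x)"
        using False by (simp add: power2_eq_square)
      finally show ?thesis .
    qed
    moreover have "4 * Re (cinner y (T x)) =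
        Re (cinner (x + y) (T (x + y))) - Re (cinner (x - y) (T (x - y)))"
    proof -
      have "Re (cinner x (T y)) = Re (cinner y (T x))"
        using arg_cong[OF cinner_commute[of x "T y"], of Re] hermD[OF T, of y x] by simp
      then show ?thesis
        by (simp add: blinfun.add_right blinfun.diff_right cinner.add_left cinner.add_right
            cinner.diff_left cinner.diff_right)
    qed
    moreover have "\<dots> \<le> c * (norm (x + y))\<^sup>2 + c * (norm (x - y))\<^sup>2"
      using c[of "x + y"] c[of "x - y"] by linarith
    moreover have "\<dots> = 4 * (c * (norm x)\<^sup>2)"
      by (simp add: norm_plus_sq norm_minus_sq ny algebra_simps)
    ultimately have "norm x * norm (T x) \<le> c * (norm x)\<^sup>2"
      by linarith
    then show ?thesis
      using False by (simp add: power2_eq_square)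
  qed
qed

lemma herm_id [simp]: "herm id_blinfun"
  by (simp add: herm_def)
lemma herm_zero [simp]: "herm 0"
  by (simp add: herm_def cinner.zero_left cinner.zero_right)
lemma herm_add: "herm S \<Longrightarrow> herm T \<Longrightarrow> herm (S + T)"
  by (simp add: herm_def blinfun.add_left cinner.add_left cinner.add_right)
lemma herm_diff: "herm S \<Longrightarrow> herm T \<Longrightarrow> herm (S - T)"
  by (simp add: herm_def blinfun.diff_left cinner.diff_left cinner.diff_right)
lemma herm_scaleR: "herm T \<Longrightarrow> herm (r *\<^sub>R T)"
  by (simp add: herm_def blinfun.scaleR_left cinner_scaleR_left cinner_scaleR_right)
lemma herm_sandwich: "herm S \<Longrightarrow> herm T \<Longrightarrow> herm (S o\<^sub>L T o\<^sub>L S)"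
  by (simp add: herm_def)
lemma herm_limit:
  assumes "\<And>n. herm (T n)" "T \<longlonglongrightarrow> S" shows "herm S"
  unfolding herm_def
proof (intro allI)
  fix x y
  have l: "(\<lambda>n. cinner (T n x) y) \<longlonglongrightarrow> cinner (S x) y"
    by (intro cinner.tendsto blinfun.tendsto tendsto_const assms)
  have r: "(\<lambda>n. cinner x (T n y)) \<longlonglongrightarrow> cinner x (S y)"
    by (intro cinner.tendsto blinfun.tendsto tendsto_const assms)
  have "(\<lambda>n. cinner (T n x) y) = (\<lambda>n. cinner x (T n y))"
    using assms(1) by (simp add: herm_def)
  with l r show "cinner (S x) y = cinner x (S y)"
    using LIMSEQ_unique by metis
qed

section \<open>Polynomials of a self-adjoint operator\<close>

lemma blinfun_eq_iff: "S = T \<longleftrightarrow> (\<forall>x. blinfun_apply S x = blinfun_apply T x)"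
  using blinfun_eqI by blast

lemma op_poly_eq_sum:
  assumes "degree p \<le> n"
  shows "op_poly p T = (\<Sum>i\<le>n. coeff p i *\<^sub>R (((o\<^sub>L) T ^^ i) id_blinfun))"
  unfolding op_poly_def
  by (rule sum.mono_neutral_left) (use assms in \<open>auto simp: coeff_eq_0\<close>)

lemma op_poly_pCons: "op_poly (pCons a p) T = a *\<^sub>R id_blinfun + (T o\<^sub>L op_poly p T)"
proof -
  have "op_poly (pCons a p) T =
      (\<Sum>i\<le>Suc (degree p). coeff (pCons a p) i *\<^sub>R (((o\<^sub>L) T ^^ i) id_blinfun))"
    by (rule op_poly_eq_sum) (simp add: degree_pCons_le)
  also have "\<dots> = a *\<^sub>R id_blinfun + (\<Sum>i\<le>degree p. coeff p i *\<^sub>R (T o\<^sub>L ((o\<^sub>L) T ^^ i) id_blinfun))"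
    unfolding sum.atMost_Suc_shift by simp
  also have "(\<Sum>i\<le>degree p. coeff p i *\<^sub>R (T o\<^sub>L ((o\<^sub>L) T ^^ i) id_blinfun)) = T o\<^sub>L op_poly p T"
    unfolding op_poly_def
    by (simp add: bounded_bilinear.sum_right[OF bounded_bilinear_blinfun_compose]
        bounded_bilinear.scaleR_right[OF bounded_bilinear_blinfun_compose])
  finally show ?thesis .
qed

lemma op_poly_0 [simp]: "op_poly 0 T = 0"
  by (simp add: op_poly_def)

lemma op_poly_const: "op_poly [:a:] T = a *\<^sub>R id_blinfun"
  by (simp add: op_poly_pCons blinfun_eq_iff)

lemma op_poly_add: "op_poly (p + q) T = op_poly p T + op_poly q T"
  by (induction p q rule: poly_induct2)
    (auto simp: op_poly_pCons blinfun_eq_iff blinfun.add_left blinfun.add_right blinfun.scaleR_left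
      scaleR_left_distrib)

lemma op_poly_smult: "op_poly (smult c p) T = c *\<^sub>R op_poly p T"
  by (induction p)
    (auto simp: op_poly_pCons blinfun_eq_iff blinfun.add_left blinfun.scaleR_left
      blinfun.scaleR_right scaleR_right_distrib)

lemma op_poly_diff: "op_poly (p - q) T = op_poly p T - op_poly q T"
  using op_poly_add[of p "- q" T] op_poly_smult[of "-1" q T] by simp

lemma op_poly_mult: "op_poly (p * q) T = op_poly p T o\<^sub>L op_poly q T"
proof (induction p)
  case (pCons a p)
  then show ?case
    by (intro blinfun_eqI)
      (simp add: mult_pCons_left op_poly_pCons[of a] op_poly_pCons[of 0] op_poly_add op_poly_smult blinfun.add_left blinfun.scaleR_left pCons(2))
qed simp

lemma op_poly_commute:
  assumes "S o\<^sub>L T = T o\<^sub>L S"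
  shows "S (op_poly p T x) = op_poly p T (S x)"
proof (induction p arbitrary: x)
  case (pCons a p)
  have "S (T y) = T (S y)" for y
    using assms by (metis blinfun_apply_blinfun_compose)
  with pCons show ?case
    by (simp add: op_poly_pCons blinfun.add_left blinfun.scaleR_left blinfun.add_right blinfun.scaleR_right)
qed simp

lemma herm_op_poly:
  assumes "herm T" shows "herm (op_poly p T)"
proof (induction p)
  case (pCons a p)
  show ?case
    unfolding herm_def
    by (simp add: op_poly_pCons blinfun.add_left blinfun.scaleR_left cinner.add_left cinner.add_right
        cinner_scaleR_left cinner_scaleR_right hermD[OF assms] hermD[OF pCons(2)] op_poly_commute)
qed simp

section \<open>Invertibility, real spectrum, and the norm of a polynomial in an operator\<close>

definition op_invertible :: "('a::complex_hilbert \<Rightarrow>\<^sub>L 'a) \<Rightarrow> bool" where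
  "op_invertible S \<longleftrightarrow> (\<exists>R. R o\<^sub>L S = id_blinfun \<and> S o\<^sub>L R = id_blinfun)"

definition real_spectrum :: "('a::complex_hilbert \<Rightarrow>\<^sub>L 'a) \<Rightarrow> real set" where
  "real_spectrum T = {r. complex_of_real r \<in> op_spectrum T}"

lemma real_spectrum_iff: "r \<in> real_spectrum T \<longleftrightarrow> \<not> op_invertible (T - r *\<^sub>R id_blinfun)"
  unfolding real_spectrum_def op_spectrum_def op_invertible_def
  by (simp add: blinfun_eq_iff blinfun.diff_left blinfun.scaleR_left blinfun.diff_right
      scaleC_complex_of_real) blast

lemma op_invertible_compose:
  assumes "op_invertible S" "op_invertible T" shows "op_invertible (S o\<^sub>L T)"
proof -
  from assms obtain S' T' where
    "S' o\<^sub>L S = id_blinfun" "S o\<^sub>L S' = id_blinfun" "T' o\<^sub>L T = id_blinfun" "T o\<^sub>L T' = id_blinfun"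
    unfolding op_invertible_def by metis
  then show ?thesis
    unfolding op_invertible_def
    by (intro exI[of _ "T' o\<^sub>L S'"]) (simp add: blinfun_eq_iff)
qed

lemma op_invertible_scaleR:
  assumes "op_invertible S" "c \<noteq> 0" shows "op_invertible (c *\<^sub>R S)"
proof -
  from assms obtain S' where "S' o\<^sub>L S = id_blinfun" "S o\<^sub>L S' = id_blinfun"
    unfolding op_invertible_def by metis
  with \<open>c \<noteq> 0\<close> show ?thesis
    unfolding op_invertible_def
    by (intro exI[of _ "(1/c) *\<^sub>R S'"])
      (simp add: blinfun_eq_iff blinfun.scaleR_left blinfun.scaleR_right)
qed

lemma neumann_invertible:
  fixes D :: "'a::complex_hilbert \<Rightarrow>\<^sub>L 'a"
  assumes "norm D < 1" shows "op_invertible (id_blinfun - D)"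
proof -
  define P where "P n = ((o\<^sub>L) D ^^ n) id_blinfun" for n
  have P: "P 0 = id_blinfun" "P (Suc n) = D o\<^sub>L P n" for n
    by (simp_all add: P_def)
  have P': "P (Suc n) = P n o\<^sub>L D" for n
    by (induction n) (simp_all add: P blinfun_eq_iff)
  \<comment> \<open>The factor \<open>norm id_blinfun\<close> is kept because it is 0, not 1, on the
    trivial space.\<close>
  have nP: "norm (P n) \<le> norm (id_blinfun :: 'a \<Rightarrow>\<^sub>L 'a) * norm D ^ n" for n
  proof (induction n)
    case (Suc n)
    have "norm (P (Suc n)) \<le> norm D * norm (P n)"
      unfolding P by (rule norm_blinfun_compose)
    also have "\<dots> \<le> norm D * (norm (id_blinfun :: 'a \<Rightarrow>\<^sub>L 'a) * norm D ^ n)"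
      by (intro mult_left_mono Suc) simp
    finally show ?case by (simp add: mult_ac)
  qed (simp add: P)
  have sm: "summable P"
    by (rule summable_comparison_test'[OF summable_mult[OF summable_geometric[of "norm D"]]])
      (use assms nP in auto)
  define R where "R = suminf P"
  have shift: "suminf (\<lambda>n. P (Suc n)) = R - id_blinfun"
    using suminf_split_head[OF sm] by (simp add: R_def P)
  have 1: "D o\<^sub>L R = R - id_blinfun"
    unfolding R_def shift[unfolded R_def, symmetric] P
    by (rule bounded_linear.suminf[OF bounded_bilinear.bounded_linear_right[OF bounded_bilinear_blinfun_compose] sm])
  have 2: "R o\<^sub>L D = R - id_blinfun"
    unfolding R_def shift[unfolded R_def, symmetric] P'
    by (rule bounded_linear.suminf[OF bounded_bilinear.bounded_linear_left[OF bounded_bilinear_blinfun_compose] sm])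
  have "R (x - D x) = x" "R x - D (R x) = x" for x
    using arg_cong[OF 1, of "\<lambda>S. blinfun_apply S x"] arg_cong[OF 2, of "\<lambda>S. blinfun_apply S x"]
    by (simp_all add: blinfun.diff_left blinfun.diff_right)
  then show ?thesis
    unfolding op_invertible_def
    by (intro exI[of _ R]) (simp add: blinfun_eq_iff blinfun.diff_left)
qed

text \<open>For c = norm T + m the quadratic form of I - T / c lies between 0 and 1 - m / c, so T is
  c times a Neumann-invertible operator.\<close>

lemma bounded_below_invertible:
  fixes T :: "'a::complex_hilbert \<Rightarrow>\<^sub>L 'a"
  assumes T: "herm T" and "m > 0" and m: "\<And>x. m * (norm x)\<^sup>2 \<le> Re (cinner x (T x))"
  shows "op_invertible T"
proof -
  define c where "c = norm T + m"
  have c: "c > 0" "c \<ge> m" using \<open>m > 0\<close> by (auto simp: c_def add_nonneg_pos)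
  define D where "D = id_blinfun - (1 / c) *\<^sub>R T"
  have "norm D \<le> 1 - m / c"
  proof (rule herm_norm_le)
    show "herm D"
      unfolding D_def by (intro herm_diff herm_scaleR T herm_id)
    show "0 \<le> 1 - m / c" using c by simp
    fix x
    have e: "Re (cinner x (D x)) = (norm x)\<^sup>2 - Re (cinner x (T x)) / c"
      unfolding D_def norm_sq_eq_Re_cinner
      by (simp add: blinfun.diff_left blinfun.scaleR_left cinner.diff_right cinner_scaleR_right)
    have "Re (cinner x (T x)) \<le> c * (norm x)\<^sup>2"
      using Re_cinner_le[of x T] \<open>m > 0\<close> by (simp add: c_def distrib_right add_increasing2)
    then have "Re (cinner x (T x)) / c \<le> (norm x)\<^sup>2"
      using c by (simp add: field_simps)
    moreover have "m / c * (norm x)\<^sup>2 \<le> Re (cinner x (T x)) / c"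
      using m[of x] c by (simp add: field_simps)
    ultimately show "\<bar>Re (cinner x (D x))\<bar> \<le> (1 - m / c) * (norm x)\<^sup>2"
      unfolding e by (simp add: left_diff_distrib)
  qed
  also have "\<dots> < 1" using c \<open>m > 0\<close> by simp
  finally have "op_invertible (c *\<^sub>R (id_blinfun - D))"
    using c by (intro op_invertible_scaleR neumann_invertible) auto
  also have "c *\<^sub>R (id_blinfun - D) = T"
    using c by (simp add: D_def)
  finally show ?thesis .
qed

text \<open>\<open>op_poly\<close> takes real coefficients only, so inductions on the degree split
  off either a real root or a conjugate pair a \<plusminus> i b.\<close>

lemma real_poly_factor:
  fixes p :: "real poly"
  assumes "degree p > 0"
  obtains (linear) t q where "p = [:-t, 1:] * q"
  | (quadratic) a b q where "b \<noteq> 0" "p = [:a\<^sup>2 + b\<^sup>2, - 2 * a, 1:] * q"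
proof -
  have "\<not> constant (poly (map_poly complex_of_real p))"
    using assms by (simp add: constant_degree degree_map_poly)
  then obtain z where z: "poly (map_poly complex_of_real p) z = 0"
    using fundamental_theorem_of_algebra by blast
  show thesis
  proof (cases "Im z = 0")
    case True
    then have "z = of_real (Re z)" by (simp add: complex_eq_iff)
    moreover have "poly (map_poly complex_of_real q) (of_real t) = of_real (poly q t)" for q t
      by (induction q) (simp_all add: map_poly_pCons)
    ultimately have "poly p (Re z) = 0"
      using z by (metis of_real_eq_0_iff)
    then show thesis
      using linear by (metis dvdE poly_eq_0_iff_dvd)
  next
    case False
    define m where "m = [:(Re z)\<^sup>2 + (Im z)\<^sup>2, - 2 * Re z, 1:]"
    define r where "r = p mod m"
    have pm: "p = m * (p div m) + r"
      by (simp add: r_def)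
    define ev where "ev q = poly (map_poly complex_of_real q) z" for q
    have ev [simp]: "ev 0 = 0" "ev (pCons c q) = of_real c + z * ev q" for c q
      by (simp_all add: ev_def map_poly_pCons)
    have ev_add: "ev (q + q') = ev q + ev q'" for q q'
      by (induction q q' rule: poly_induct2) (simp_all add: algebra_simps)
    have ev_smult: "ev (smult c q) = of_real c * ev q" for c q
      by (induction q) (simp_all add: algebra_simps)
    have ev_mult: "ev (q * q') = ev q * ev q'" for q q'
      by (induction q) (simp_all add: ev_add ev_smult algebra_simps)
    have "ev m = 0"
      by (simp add: m_def complex_eq_iff power2_eq_square algebra_simps)
    moreover have "ev p = ev m * ev (p div m) + ev r"
      by (subst pm) (simp only: ev_add ev_mult)
    ultimately have rz: "ev r = 0"
      using z by (simp add: ev_def)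
    have "degree m = 2" "m \<noteq> 0" by (simp_all add: m_def)
    then have "degree r \<le> 1"
      using degree_mod_less[of m p] by (auto simp: r_def)
    then have r: "r = [:coeff r 0, coeff r 1:]"
      by (intro poly_eqI) (auto simp: coeff_pCons coeff_eq_0 split: nat.split)
    \<comment> \<open>A real polynomial of degree at most 1 with a nonreal root is zero.\<close>
    have "ev r = of_real (coeff r 0) + z * of_real (coeff r 1)"
      by (subst r) simp
    then have c: "coeff r 1 = 0 \<and> coeff r 0 = 0"
      using rz False by (auto simp: complex_eq_iff)
    have "r = 0"
      by (subst r) (simp only: c pCons_0_0)
    with pm have "p = m * (p div m)" by simp
    then show thesis
      using quadratic[OF False] unfolding m_def by blast
  qed
qed

text \<open>Completing the square: the polynomial is (t - a)^2 + b^2. For b \<noteq> 0 its value at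
  T is thus bounded below, whatever the spectrum of T.\<close>

lemma Re_cinner_op_quadratic:
  fixes T :: "'a::complex_hilbert \<Rightarrow>\<^sub>L 'a"
  assumes T: "herm T"
  shows "Re (cinner x (op_poly [:a\<^sup>2 + b\<^sup>2, - 2 * a, 1:] T x)) = b\<^sup>2 * (norm x)\<^sup>2 + (norm (T x - a *\<^sub>R x))\<^sup>2"
proof -
  have "op_poly [:a\<^sup>2 + b\<^sup>2, - 2 * a, 1:] T x = (a\<^sup>2 + b\<^sup>2) *\<^sub>R x + (T (T x) - (2 * a) *\<^sub>R T x)"
    by (simp add: op_poly_pCons blinfun.add_left blinfun.scaleR_left blinfun.diff_left
        blinfun.minus_left blinfun.add_right blinfun.diff_right blinfun.scaleR_right)
  then have "Re (cinner x (op_poly [:a\<^sup>2 + b\<^sup>2, - 2 * a, 1:] T x)) =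
      (a\<^sup>2 + b\<^sup>2) * (norm x)\<^sup>2 + ((norm (T x))\<^sup>2 - 2 * a * Re (cinner x (T x)))"
    by (simp add: cinner.add_right cinner.diff_right cinner_scaleR_right norm_sq_eq_Re_cinner hermD[OF T])
  also have "\<dots> = b\<^sup>2 * (norm x)\<^sup>2 + (norm (T x - a *\<^sub>R x))\<^sup>2"
    unfolding norm_minus_sq
    by (simp add: cinner_scaleR_right hermD[OF T] power_mult_distrib algebra_simps)
  finally show ?thesis .
qed

text \<open>One half of the spectral mapping theorem. Quadratic factors are always invertible by the
  completed square; a linear factor is, unless its root lies in the spectrum.\<close>

lemma op_poly_invertible:
  fixes T :: "'a::complex_hilbert \<Rightarrow>\<^sub>L 'a"
  assumes T: "herm T" and "p \<noteq> 0" "\<And>t. t \<in> real_spectrum T \<Longrightarrow> poly p t \<noteq> 0"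
  shows "op_invertible (op_poly p T)"
  using assms(2,3)
proof (induction "degree p" arbitrary: p rule: less_induct)
  case less
  show ?case
  proof (cases "degree p = 0")
    case True
    then obtain c where "p = [:c:]" using degree_eq_zeroE by blast
    with less.prems(1) have "op_poly p T = c *\<^sub>R id_blinfun" "c \<noteq> 0"
      by (auto simp: op_poly_const)
    moreover have "op_invertible (id_blinfun :: 'a \<Rightarrow>\<^sub>L 'a)"
      unfolding op_invertible_def by (intro exI[of _ id_blinfun]) (simp add: blinfun_eq_iff)
    ultimately show ?thesis
      by (simp add: op_invertible_scaleR)
  next
    case False
    then have "degree p > 0" by simp
    then show ?thesis
    proof (cases rule: real_poly_factor)
      case (linear t q)
      have "q \<noteq> 0" using linear less.prems by auto
      then have "degree q < degree p"
        unfolding linear by (subst degree_mult_eq) auto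
      moreover have "poly q s \<noteq> 0" if "s \<in> real_spectrum T" for s
        using less.prems(2)[OF that] unfolding linear by auto
      ultimately have q: "op_invertible (op_poly q T)"
        using less.hyps \<open>q \<noteq> 0\<close> by blast
      have "t \<notin> real_spectrum T"
        using less.prems(2)[of t] unfolding linear by auto
      then have "op_invertible (op_poly [:-t, 1:] T)"
        by (simp add: real_spectrum_iff op_poly_pCons blinfun_eq_iff blinfun.diff_left
            op_invertible_def blinfun.add_left blinfun.scaleR_left blinfun.minus_left
            blinfun.diff_right blinfun.add_right blinfun.minus_right)
      with q show ?thesis
        unfolding linear op_poly_mult by (rule op_invertible_compose[rotated])
    next
      case (quadratic a b q)
      have "q \<noteq> 0" using quadratic less.prems by auto
      then have "degree q < degree p"
        unfolding quadratic by (subst degree_mult_eq) auto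
      moreover have "poly q s \<noteq> 0" if "s \<in> real_spectrum T" for s
        using less.prems(2)[OF that] unfolding quadratic by auto
      ultimately have q: "op_invertible (op_poly q T)"
        using less.hyps \<open>q \<noteq> 0\<close> by blast
      have "op_invertible (op_poly [:a\<^sup>2 + b\<^sup>2, - 2 * a, 1:] T)"
      proof (rule bounded_below_invertible[OF herm_op_poly[OF T]])
        show "b\<^sup>2 > 0" using quadratic by simp
        fix x
        show "b\<^sup>2 * (norm x)\<^sup>2 \<le> Re (cinner x (op_poly [:a\<^sup>2 + b\<^sup>2, - 2 * a, 1:] T x))"
          unfolding Re_cinner_op_quadratic[OF T] by simp
      qed
      with q show ?thesis
        unfolding quadratic op_poly_mult by (rule op_invertible_compose[rotated])
    qed
  qed
qed

text \<open>With r = norm S, a bounded inverse of S^2 - r^2 would force |S x|^2 \<le> (r^2 - 1/K)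
  |x|^2 for all x, contradicting r = norm S. The vector z excludes the trivial space, where every
  operator is invertible.\<close>

lemma norm_sq_not_invertible:
  fixes S :: "'a::complex_hilbert \<Rightarrow>\<^sub>L 'a"
  assumes S: "herm S" and "z \<noteq> (0::'a)"
  shows "\<not> op_invertible ((S o\<^sub>L S) - (norm S)\<^sup>2 *\<^sub>R id_blinfun)"
proof
  define r where "r = norm S"
  assume "op_invertible ((S o\<^sub>L S) - (norm S)\<^sup>2 *\<^sub>R id_blinfun)"
  then obtain R where R: "R o\<^sub>L ((S o\<^sub>L S) - r\<^sup>2 *\<^sub>R id_blinfun) = id_blinfun"
    unfolding op_invertible_def r_def by blast
  define K where "K = (norm R)\<^sup>2 * (2 * r\<^sup>2)"
  have *: "(norm x)\<^sup>2 \<le> K * (r\<^sup>2 * (norm x)\<^sup>2 - (norm (S x))\<^sup>2)" for x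
  proof -
    have Sx: "(norm (S y))\<^sup>2 \<le> r\<^sup>2 * (norm y)\<^sup>2" for y
      unfolding r_def power_mult_distrib[symmetric] by (intro power_mono norm_blinfun) simp
    have "x = R (S (S x) - r\<^sup>2 *\<^sub>R x)"
      using arg_cong[OF R, of "\<lambda>T. blinfun_apply T x"] by (simp add: blinfun.diff_left blinfun.scaleR_left)
    then have "norm x \<le> norm R * norm (S (S x) - r\<^sup>2 *\<^sub>R x)"
      using norm_blinfun by metis
    then have "(norm x)\<^sup>2 \<le> (norm R)\<^sup>2 * (norm (S (S x) - r\<^sup>2 *\<^sub>R x))\<^sup>2"
      unfolding power_mult_distrib[symmetric] by (intro power_mono) auto
    also have "\<dots> \<le> (norm R)\<^sup>2 * (2 * r\<^sup>2 * (r\<^sup>2 * (norm x)\<^sup>2 - (norm (S x))\<^sup>2))"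
    proof (rule mult_left_mono)
      have "(norm (S (S x) - r\<^sup>2 *\<^sub>R x))\<^sup>2 = (norm (S (S x)))\<^sup>2 - 2 * r\<^sup>2 * (norm (S x))\<^sup>2 + r\<^sup>2 * (r\<^sup>2 * (norm x)\<^sup>2)"
        unfolding norm_minus_sq cinner_scaleR_right hermD[OF S] norm_sq_eq_Re_cinner[of "S x"]
        by (simp add: power_mult_distrib power2_eq_square)
      moreover have "r\<^sup>2 * (norm (S x))\<^sup>2 \<le> r\<^sup>2 * (r\<^sup>2 * (norm x)\<^sup>2)"
        by (intro mult_left_mono Sx) simp
      ultimately show "(norm (S (S x) - r\<^sup>2 *\<^sub>R x))\<^sup>2 \<le> 2 * r\<^sup>2 * (r\<^sup>2 * (norm x)\<^sup>2 - (norm (S x))\<^sup>2)"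
        using Sx[of "S x"] right_diff_distrib[of "2 * r\<^sup>2" "r\<^sup>2 * (norm x)\<^sup>2" "(norm (S x))\<^sup>2"]
        by linarith
    qed simp
    finally show ?thesis
      by (simp add: K_def mult.assoc)
  qed
  have "K \<noteq> 0"
    using *[of z] \<open>z \<noteq> 0\<close> by auto
  then have K: "K > 0" by (simp add: K_def less_le)
  have **: "(norm (S x))\<^sup>2 \<le> (r\<^sup>2 - 1 / K) * (norm x)\<^sup>2" for x
    using *[of x] K by (simp add: field_simps)
  have nn: "r\<^sup>2 - 1 / K \<ge> 0"
    using **[of z] \<open>z \<noteq> 0\<close> by (meson order_trans zero_le_mult_iff zero_le_power2 zero_less_power2 norm_eq_zero not_le)
  have "norm S \<le> sqrt (r\<^sup>2 - 1 / K)"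
  proof (rule norm_blinfun_bound)
    fix x
    have "sqrt ((norm (S x))\<^sup>2) \<le> sqrt ((r\<^sup>2 - 1 / K) * (norm x)\<^sup>2)"
      using ** by (rule real_sqrt_le_mono)
    then show "norm (S x) \<le> sqrt (r\<^sup>2 - 1 / K) * norm x"
      by (simp add: real_sqrt_mult)
  qed (use nn in simp)
  also have "\<dots> < sqrt (r\<^sup>2)"
    using K by (intro real_sqrt_less_mono) simp
  finally show False
    by (simp add: r_def)
qed

text \<open>If r = norm (p(T)) exceeded c, then p^2 - r^2 would have no zero on the spectrum, so
  p(T)^2 - r^2 would be invertible, against \<open>norm_sq_not_invertible\<close>.\<close>

lemma norm_op_poly_le:
  fixes T :: "'a::complex_hilbert \<Rightarrow>\<^sub>L 'a"
  assumes T: "herm T" and "0 \<le> c" and c: "\<And>t. t \<in> real_spectrum T \<Longrightarrow> \<bar>poly p t\<bar> \<le> c"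
  shows "norm (op_poly p T) \<le> c"
proof (rule ccontr)
  assume "\<not> norm (op_poly p T) \<le> c"
  define r where "r = norm (op_poly p T)"
  have r: "r > c" using \<open>\<not> norm (op_poly p T) \<le> c\<close> by (simp add: r_def)
  then have "op_poly p T \<noteq> 0" using \<open>0 \<le> c\<close> by (auto simp: r_def)
  then obtain z where "op_poly p T z \<noteq> 0"
    by (metis blinfun_eqI zero_blinfun.rep_eq)
  then have z: "z \<noteq> 0" by (auto simp: blinfun.zero_right)
  have sq: "op_poly (q * q - [:s\<^sup>2:]) T = (op_poly q T o\<^sub>L op_poly q T) - s\<^sup>2 *\<^sub>R id_blinfun" for q s
    by (simp only: op_poly_diff op_poly_mult op_poly_const)
  define q where "q = p * p - [:r\<^sup>2:]"
  have q0: "poly q t \<noteq> 0" if "t \<in> real_spectrum T" for t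
  proof
    assume "poly q t = 0"
    then have "(poly p t)\<^sup>2 = r\<^sup>2"
      by (simp add: q_def power2_eq_square)
    with c[OF that] r \<open>0 \<le> c\<close> show False
      by (simp add: power2_eq_iff)  linarith
  qed
  have "op_invertible (op_poly q T)" if "q \<noteq> 0"
    using op_poly_invertible[OF T that q0] by blast
  then have "q = 0"
    using norm_sq_not_invertible[OF herm_op_poly[OF T, of p] z] unfolding q_def sq r_def[symmetric] by blast
  \<comment> \<open>What remains is that p^2 - r^2 is the zero polynomial. Then its having no zero
    on the spectrum means that the spectrum is empty, so every nonzero polynomial in T is
    invertible; T^2 - (norm T)^2 is not.\<close>
  with q0 have "real_spectrum T = {}" by auto
  then have "op_invertible (op_poly ([:0, 1:] * [:0, 1:] - [:(norm T)\<^sup>2:]) T)"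
    by (intro op_poly_invertible[OF T]) auto
  moreover have "op_poly [:0, 1:] T = T"
    by (simp add: op_poly_pCons blinfun_eq_iff)
  ultimately show False
    using norm_sq_not_invertible[OF T z] unfolding sq by simp
qed

lemma real_spectrum_between:
  assumes T: "op_between m M T" shows "real_spectrum T \<subseteq> {m..M}"
proof (rule ccontr)
  assume "\<not> real_spectrum T \<subseteq> {m..M}"
  then obtain t where t: "t \<in> real_spectrum T" "t < m \<or> M < t" by force
  have inner: "Re (cinner x ((T - t *\<^sub>R id_blinfun) x)) = Re (cinner x (T x)) - t * (norm x)\<^sup>2" for x
    by (simp add: norm_sq_eq_Re_cinner blinfun.diff_left blinfun.scaleR_left cinner.diff_right cinner_scaleR_right)
  have h: "herm (T - t *\<^sub>R id_blinfun)"
    using T by (intro herm_diff herm_scaleR herm_id) (auto simp: op_between_def)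
  have "op_invertible (T - t *\<^sub>R id_blinfun)"
    using t(2)
  proof
    assume "t < m"
    then show ?thesis
      using op_betweenD(2)[OF T]
      by (intro bounded_below_invertible[OF h, of "m - t"]) (auto simp: inner left_diff_distrib)
  next
    assume "M < t"
    have "op_invertible ((-1) *\<^sub>R (T - t *\<^sub>R id_blinfun))"
      using op_betweenD(3)[OF T] \<open>M < t\<close>
      by (intro bounded_below_invertible[of _ "t - M"])
        (simp_all only: inner left_diff_distrib blinfun.scaleR_left cinner_scaleR_right h herm_scaleR scaleR_complex.simps(1), auto)
    from op_invertible_scaleR[OF this, of "-1"] show ?thesis by simp
  qed
  with t show False by (simp add: real_spectrum_iff)
qed

section \<open>Continuous functional calculus\<close>

lemma norm_le_of_op_between:
  fixes T :: "'a::complex_hilbert \<Rightarrow>\<^sub>L 'a"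
  assumes "op_between m M T" shows "norm T \<le> max \<bar>m\<bar> \<bar>M\<bar>"
proof (rule herm_norm_le)
  fix x :: 'a
  have "\<bar>m\<bar> * (norm x)\<^sup>2 \<le> max \<bar>m\<bar> \<bar>M\<bar> * (norm x)\<^sup>2" "\<bar>M\<bar> * (norm x)\<^sup>2 \<le> max \<bar>m\<bar> \<bar>M\<bar> * (norm x)\<^sup>2"
    "- (\<bar>m\<bar> * (norm x)\<^sup>2) \<le> m * (norm x)\<^sup>2" "M * (norm x)\<^sup>2 \<le> \<bar>M\<bar> * (norm x)\<^sup>2"
    unfolding mult_minus_left[symmetric] by (intro mult_right_mono; simp)+
  with op_betweenD(2,3)[OF assms, of x]
  show "\<bar>Re (cinner x (T x))\<bar> \<le> max \<bar>m\<bar> \<bar>M\<bar> * (norm x)\<^sup>2"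
    by linarith
qed (use assms in \<open>auto simp: op_between_def\<close>)

lemma polynomial_approximation:
  assumes "continuous_on {m..M} (f :: real \<Rightarrow> real)"
  shows "\<exists>p. uniform_limit {m..M} (\<lambda>n. poly (p n)) f sequentially"
proof -
  have "\<exists>p. \<forall>x\<in>{m..M}. \<bar>f x - poly p x\<bar> < 1 / Suc n" for n
  proof -
    obtain g where g: "real_polynomial_function g" "\<And>x. x \<in> {m..M} \<Longrightarrow> \<bar>f x - g x\<bar> < 1 / Suc n"
      using Stone_Weierstrass_real_polynomial_function[OF compact_Icc assms, of "1 / Suc n"] by auto
    then obtain a k where ak: "g = (\<lambda>x. \<Sum>i\<le>k. a i * x ^ i)"
      using real_polynomial_function_iff_sum by metis
    have "poly (\<Sum>i\<le>k. monom (a i) i) x = g x" for x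
      by (simp add: ak poly_sum poly_monom)
    with g show ?thesis by metis
  qed
  then obtain p where p: "\<And>n x. x \<in> {m..M} \<Longrightarrow> \<bar>f x - poly (p n) x\<bar> < 1 / Suc n"
    by metis
  have "uniform_limit {m..M} (\<lambda>n. poly (p n)) f sequentially"
  proof (rule uniform_limitI)
    fix e :: real assume "e > 0"
    then have "\<forall>\<^sub>F n in sequentially. 1 / Suc n < e"
      using order_tendstoD(2)[OF LIMSEQ_inverse_real_of_nat] by (simp add: inverse_eq_divide)
    then show "\<forall>\<^sub>F n in sequentially. \<forall>x\<in>{m..M}. dist (poly (p n) x) (f x) < e"
      by eventually_elim (metis p dist_real_def abs_minus_commute order_less_trans)
  qed
  then show ?thesis by blast
qed

lemma op_poly_tendsto_zero:
  assumes T: "herm T"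
    and "uniform_limit (real_spectrum T) (\<lambda>n. poly (p n)) f sequentially"
    and "uniform_limit (real_spectrum T) (\<lambda>n. poly (q n)) f sequentially"
  shows "(\<lambda>n. op_poly (p n) T - op_poly (q n) T) \<longlonglongrightarrow> 0"
proof (rule LIMSEQ_I)
  fix e :: real assume "e > 0"
  have "uniform_limit (real_spectrum T) (\<lambda>n x. poly (p n) x - poly (q n) x) (\<lambda>x. f x - f x) sequentially"
    by (intro uniform_limit_minus assms)
  from uniform_limitD[OF this, of "e/2"] \<open>e > 0\<close>
  obtain N where N: "\<And>n t. n \<ge> N \<Longrightarrow> t \<in> real_spectrum T \<Longrightarrow> \<bar>poly (p n - q n) t\<bar> < e/2"
    unfolding eventually_sequentially by (auto simp: dist_real_def)
  have "norm (op_poly (p n) T - op_poly (q n) T) \<le> e/2" if "n \<ge> N" for n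
    unfolding op_poly_diff[symmetric]
    using N[OF that] \<open>e > 0\<close> by (intro norm_op_poly_le[OF T]) (auto intro: less_imp_le)
  with \<open>e > 0\<close> show "\<exists>no. \<forall>n\<ge>no. norm (op_poly (p n) T - op_poly (q n) T - 0) < e"
    by (intro exI[of _ N]) fastforce
qed

text \<open>Uniqueness for the \<open>THE\<close> in \<open>op_fun\<close>: two approximating
  sequences differ by polynomials that tend to 0 uniformly on the spectrum, hence in norm at
  T.\<close>

lemma op_fun_eqI:
  assumes T: "herm T"
    and p: "uniform_limit (real_spectrum T) (\<lambda>n. poly (p n)) f sequentially"
    and S: "(\<lambda>n. op_poly (p n) T) \<longlonglongrightarrow> S"
  shows "op_fun f T = S"
  unfolding op_fun_def real_spectrum_def[symmetric]
proof (rule the_equality)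
  show "\<exists>p. uniform_limit (real_spectrum T) (\<lambda>n. poly (p n)) f sequentially \<and> (\<lambda>n. op_poly (p n) T) \<longlonglongrightarrow> S"
    using p S by blast
  fix S' assume "\<exists>p. uniform_limit (real_spectrum T) (\<lambda>n. poly (p n)) f sequentially \<and> (\<lambda>n. op_poly (p n) T) \<longlonglongrightarrow> S'"
  then obtain q where q: "uniform_limit (real_spectrum T) (\<lambda>n. poly (q n)) f sequentially"
    and S': "(\<lambda>n. op_poly (q n) T) \<longlonglongrightarrow> S'" by blast
  have "S' - S = 0"
    using LIMSEQ_unique[OF tendsto_diff[OF S' S] op_poly_tendsto_zero[OF T q p]] .
  then show "S' = S" by simp
qed

text \<open>Existence for the \<open>THE\<close> in \<open>op_fun\<close>: the norm bound on the
  spectrum turns uniform convergence of the polynomials into a Cauchy sequence of operators.\<close>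

lemma op_fun_tendsto:
  fixes T :: "'a::complex_hilbert \<Rightarrow>\<^sub>L 'a"
  assumes T: "op_between m M T"
    and p: "uniform_limit {m..M} (\<lambda>n. poly (p n)) f sequentially"
  shows "(\<lambda>n. op_poly (p n) T) \<longlonglongrightarrow> op_fun f T"
proof -
  have h: "herm T" using T by (simp add: op_between_def)
  have p': "uniform_limit (real_spectrum T) (\<lambda>n. poly (p n)) f sequentially"
    using uniform_limit_on_subset[OF p real_spectrum_between[OF T]] .
  have "Cauchy (\<lambda>n. op_poly (p n) T)"
  proof (rule CauchyI)
    fix e :: real assume "e > 0"
    then obtain N where N: "\<And>n t. n \<ge> N \<Longrightarrow> t \<in> real_spectrum T \<Longrightarrow> \<bar>poly (p n) t - f t\<bar> < e/4"
      using uniform_limitD[OF p', of "e/4"] unfolding eventually_sequentially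
      by (auto simp: dist_real_def)
    have "norm (op_poly (p k) T - op_poly (p n) T) \<le> e/2" if "k \<ge> N" "n \<ge> N" for k n
      unfolding op_poly_diff[symmetric]
    proof (rule norm_op_poly_le[OF h])
      fix t assume "t \<in> real_spectrum T"
      from N[OF \<open>k \<ge> N\<close> this] N[OF \<open>n \<ge> N\<close> this]
      have "\<bar>poly (p k) t - poly (p n) t\<bar> \<le> e/2" by linarith
      then show "\<bar>poly (p k - p n) t\<bar> \<le> e/2" by simp
    qed (use \<open>e > 0\<close> in simp)
    with \<open>e > 0\<close> show "\<exists>N. \<forall>k\<ge>N. \<forall>n\<ge>N. norm (op_poly (p k) T - op_poly (p n) T) < e"
      by (intro exI[of _ N]) fastforce
  qed
  then obtain S where S: "(\<lambda>n. op_poly (p n) T) \<longlonglongrightarrow> S"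
    using convergentD Cauchy_convergent by blast
  with op_fun_eqI[OF h p' S] show ?thesis by simp
qed

lemma op_fun_obtain:
  assumes "op_between m M T" "continuous_on {m..M} f"
  obtains p where "uniform_limit {m..M} (\<lambda>n. poly (p n)) f sequentially"
    "(\<lambda>n. op_poly (p n) T) \<longlonglongrightarrow> op_fun f T"
  using polynomial_approximation[OF assms(2)] op_fun_tendsto[OF assms(1)] by blast

context
  fixes T :: "'a::complex_hilbert \<Rightarrow>\<^sub>L 'a" and m M :: real
  assumes T: "op_between m M T"
begin

lemma op_fun_poly: "op_fun (poly p) T = op_poly p T"
  using op_fun_tendsto[OF T, of "\<lambda>_. p" "poly p"] LIMSEQ_unique tendsto_const
  by (metis uniform_limit_const)

lemma op_fun_cong: "(\<And>t. t \<in> {m..M} \<Longrightarrow> f t = g t) \<Longrightarrow> op_fun f T = op_fun g T"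
  unfolding op_fun_def real_spectrum_def[symmetric]
  using real_spectrum_between[OF T]
  by (simp add: subset_iff cong: uniform_limit_cong')

lemma op_fun_const: "op_fun (\<lambda>_. c) T = c *\<^sub>R id_blinfun"
  using op_fun_poly[of "[:c:]"] by (simp add: op_poly_const fun_eq_iff cong: op_fun_cong)

lemma op_fun_ident: "op_fun (\<lambda>t. t) T = T"
proof -
  have "poly [:0, 1:] = (\<lambda>t. t :: real)" by auto
  then show ?thesis
    using op_fun_poly[of "[:0, 1:]"] by (simp add: op_poly_pCons blinfun_eq_iff)
qed

lemma herm_op_fun: "continuous_on {m..M} f \<Longrightarrow> herm (op_fun f T)"
  by (rule op_fun_obtain[OF T], assumption)
    (use T in \<open>auto intro: herm_limit herm_op_poly simp: op_between_def\<close>)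

lemma op_fun_add:
  assumes "continuous_on {m..M} f" "continuous_on {m..M} g"
  shows "op_fun (\<lambda>t. f t + g t) T = op_fun f T + op_fun g T"
proof -
  obtain p where p: "uniform_limit {m..M} (\<lambda>n. poly (p n)) f sequentially" "(\<lambda>n. op_poly (p n) T) \<longlonglongrightarrow> op_fun f T"
    using op_fun_obtain[OF T assms(1)] by blast
  obtain q where q: "uniform_limit {m..M} (\<lambda>n. poly (q n)) g sequentially" "(\<lambda>n. op_poly (q n) T) \<longlonglongrightarrow> op_fun g T"
    using op_fun_obtain[OF T assms(2)] by blast
  have "uniform_limit {m..M} (\<lambda>n. poly (p n + q n)) (\<lambda>t. f t + g t) sequentially"
    using uniform_limit_add[OF p(1) q(1)] by (simp add: poly_add[abs_def])
  from op_fun_tendsto[OF T this] show ?thesis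
    using LIMSEQ_unique tendsto_add[OF p(2) q(2)] by (simp only: op_poly_add) blast
qed

lemma op_fun_mult:
  assumes "continuous_on {m..M} f" "continuous_on {m..M} g"
  shows "op_fun (\<lambda>t. f t * g t) T = op_fun f T o\<^sub>L op_fun g T"
proof -
  obtain p where p: "uniform_limit {m..M} (\<lambda>n. poly (p n)) f sequentially" "(\<lambda>n. op_poly (p n) T) \<longlonglongrightarrow> op_fun f T"
    using op_fun_obtain[OF T assms(1)] by blast
  obtain q where q: "uniform_limit {m..M} (\<lambda>n. poly (q n)) g sequentially" "(\<lambda>n. op_poly (q n) T) \<longlonglongrightarrow> op_fun g T"
    using op_fun_obtain[OF T assms(2)] by blast
  have "bounded (f ` {m..M})" "bounded (g ` {m..M})"
    using assms by (auto intro!: compact_imp_bounded compact_continuous_image)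
  then have "uniform_limit {m..M} (\<lambda>n. poly (p n * q n)) (\<lambda>t. f t * g t) sequentially"
    using uniform_lim_mult[OF p(1) q(1)] by (simp add: poly_mult[abs_def])
  from op_fun_tendsto[OF T this] show ?thesis
    using LIMSEQ_unique bounded_bilinear.tendsto[OF bounded_bilinear_blinfun_compose p(2) q(2)]
    by (simp only: op_poly_mult) blast
qed

lemma op_fun_cmult: "continuous_on {m..M} f \<Longrightarrow> op_fun (\<lambda>t. c * f t) T = c *\<^sub>R op_fun f T"
  using op_fun_mult[of "\<lambda>_. c" f]
  by (simp add: op_fun_const blinfun_eq_iff blinfun.scaleR_left)

lemma op_fun_diff:
  assumes "continuous_on {m..M} f" "continuous_on {m..M} g"
  shows "op_fun (\<lambda>t. f t - g t) T = op_fun f T - op_fun g T"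
proof -
  have "continuous_on {m..M} (\<lambda>t. -1 * g t)"
    by (intro continuous_intros assms)
  from op_fun_add[OF assms(1) this] show ?thesis
    unfolding op_fun_cmult[OF assms(2)] by simp
qed

text \<open>On the interval f is the square of sqrt f, which makes the quadratic form a squared
  norm.\<close>

lemma op_fun_nonneg:
  assumes "continuous_on {m..M} f" "\<And>t. t \<in> {m..M} \<Longrightarrow> 0 \<le> f t"
  shows "0 \<le> Re (cinner x (op_fun f T x))"
proof -
  have c: "continuous_on {m..M} (\<lambda>t. sqrt (f t))"
    by (intro continuous_intros assms)
  have "op_fun f T = op_fun (\<lambda>t. sqrt (f t) * sqrt (f t)) T"
    by (rule op_fun_cong) (use assms(2) in auto)
  also have "\<dots> = op_fun (\<lambda>t. sqrt (f t)) T o\<^sub>L op_fun (\<lambda>t. sqrt (f t)) T"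
    by (rule op_fun_mult[OF c c])
  finally have "cinner x (op_fun f T x) = cinner (op_fun (\<lambda>t. sqrt (f t)) T x) (op_fun (\<lambda>t. sqrt (f t)) T x)"
    by (simp add: hermD[OF herm_op_fun[OF c]])
  then show ?thesis
    by (simp add: cinner_self)
qed

lemma op_fun_mono:
  assumes "continuous_on {m..M} f" "continuous_on {m..M} g" "\<And>t. t \<in> {m..M} \<Longrightarrow> f t \<le> g t"
  shows "Re (cinner x (op_fun f T x)) \<le> Re (cinner x (op_fun g T x))"
proof -
  have "0 \<le> Re (cinner x (op_fun (\<lambda>t. g t - f t) T x))"
    by (rule op_fun_nonneg) (use assms in \<open>auto intro: continuous_intros\<close>)
  then show ?thesis
    unfolding op_fun_diff[OF assms(2,1)] by (simp add: blinfun.diff_left cinner.diff_right)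
qed

lemma op_between_op_fun:
  assumes "continuous_on {m..M} f" "\<And>t. t \<in> {m..M} \<Longrightarrow> a \<le> f t" "\<And>t. t \<in> {m..M} \<Longrightarrow> f t \<le> b"
  shows "op_between a b (op_fun f T)"
  unfolding op_between_def
proof (intro conjI allI)
  have const: "Re (cinner x (op_fun (\<lambda>_. c) T x)) = c * (norm x)\<^sup>2" for c x
    by (simp add: op_fun_const blinfun.scaleR_left cinner_scaleR_right norm_sq_eq_Re_cinner)
  fix x
  show "a * (norm x)\<^sup>2 \<le> Re (cinner x (op_fun f T x))" "Re (cinner x (op_fun f T x)) \<le> b * (norm x)\<^sup>2"
    unfolding const[symmetric] using assms by (auto intro!: op_fun_mono)
qed (rule herm_op_fun[OF assms(1)])

lemma norm_op_fun_le:
  assumes "continuous_on {m..M} f" "\<And>t. t \<in> {m..M} \<Longrightarrow> \<bar>f t\<bar> \<le> c" "0 \<le> c"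
  shows "norm (op_fun f T) \<le> c"
proof -
  have "op_between (-c) c (op_fun f T)"
    using assms by (intro op_between_op_fun) (auto simp: abs_le_iff, fastforce)
  from norm_le_of_op_between[OF this] \<open>0 \<le> c\<close> show ?thesis by simp
qed

lemma op_fun_eigenvector:
  assumes "continuous_on {m..M} f" "T e = r *\<^sub>R e" "e \<noteq> 0"
  shows "op_fun f T e = f r *\<^sub>R e"
proof -
  have poly: "op_poly p T e = poly p r *\<^sub>R e" for p
    by (induction p) (simp_all add: op_poly_pCons blinfun.add_left blinfun.scaleR_left
        blinfun.scaleR_right assms scaleR_add_left mult.commute)
  have "Re (cinner e (T e)) = r * (norm e)\<^sup>2"
    by (simp add: assms cinner_scaleR_right norm_sq_eq_Re_cinner)
  with op_betweenD(2,3)[OF T, of e] \<open>e \<noteq> 0\<close> have r: "r \<in> {m..M}" by simp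
  obtain p where p: "uniform_limit {m..M} (\<lambda>n. poly (p n)) f sequentially" "(\<lambda>n. op_poly (p n) T) \<longlonglongrightarrow> op_fun f T"
    using op_fun_obtain[OF T assms(1)] by blast
  have "(\<lambda>n. op_poly (p n) T e) \<longlonglongrightarrow> op_fun f T e"
    by (intro blinfun.tendsto p tendsto_const)
  moreover have "(\<lambda>n. op_poly (p n) T e) \<longlonglongrightarrow> f r *\<^sub>R e"
    unfolding poly using tendsto_uniform_limitI[OF p(1) r] by (intro tendsto_intros)
  ultimately show ?thesis using LIMSEQ_unique by blast
qed

end

section \<open>Strong continuity of the functional calculus\<close>

lemma op_poly_strong_tendsto:
  fixes T :: "'a::complex_hilbert \<Rightarrow>\<^sub>L 'a" and S :: "'i \<Rightarrow> 'a \<Rightarrow>\<^sub>L 'a"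
  assumes B: "\<And>i. norm (S i) \<le> K" and lim: "\<And>x. ((\<lambda>i. S i x) \<longlongrightarrow> T x) F"
  shows "((\<lambda>i. op_poly p (S i) x) \<longlongrightarrow> op_poly p T x) F"
proof (induction p)
  case (pCons a p)
  have "((\<lambda>i. S i (op_poly p (S i) x - op_poly p T x)) \<longlongrightarrow> 0) F"
  proof (rule Lim_null_comparison)
    show "\<forall>\<^sub>F i in F. norm (S i (op_poly p (S i) x - op_poly p T x)) \<le> K * norm (op_poly p (S i) x - op_poly p T x)"
      using B by (intro always_eventually allI order_trans[OF norm_blinfun] mult_right_mono) auto
    show "((\<lambda>i. K * norm (op_poly p (S i) x - op_poly p T x)) \<longlongrightarrow> 0) F"
      using pCons(2) by (intro tendsto_mult_right_zero tendsto_norm_zero) (simp add: LIM_zero_iff)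
  qed
  from tendsto_add[OF this lim[of "op_poly p T x"]]
  have "((\<lambda>i. S i (op_poly p (S i) x)) \<longlongrightarrow> T (op_poly p T x)) F"
    by (simp add: blinfun.diff_right)
  then show ?case
    unfolding op_poly_pCons by (simp add: blinfun.add_left blinfun.scaleR_left tendsto_add)
qed simp

text \<open>Finite-rank compressions converge only strongly. A single polynomial close to f on the
  common interval serves all operators of the net at once, which reduces the claim to
  polynomials.\<close>

lemma op_fun_strong_tendsto:
  fixes T :: "'a::complex_hilbert \<Rightarrow>\<^sub>L 'a" and S :: "'i \<Rightarrow> 'a \<Rightarrow>\<^sub>L 'a"
  assumes S: "\<And>i. op_between m M (S i)" and T: "op_between m M T"
    and lim: "\<And>x. ((\<lambda>i. S i x) \<longlongrightarrow> T x) F" and f: "continuous_on {m..M} f"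
  shows "((\<lambda>i. op_fun f (S i) x) \<longlongrightarrow> op_fun f T x) F"
proof (rule tendstoI)
  fix e :: real assume "e > 0"
  define a where "a = norm x + 1"
  have a: "a > 0" "norm x < a" by (simp_all add: a_def add_nonneg_pos)
  define d where "d = e / (3 * a)"
  have d: "d > 0" using \<open>e > 0\<close> a by (simp add: d_def)
  obtain p where p: "\<And>t. t \<in> {m..M} \<Longrightarrow> \<bar>f t - poly p t\<bar> \<le> d"
  proof -
    obtain p where "uniform_limit {m..M} (\<lambda>n. poly (p n)) f sequentially"
      using polynomial_approximation[OF f] by blast
    from uniform_limitD[OF this d] obtain n where "\<forall>t\<in>{m..M}. dist (poly (p n) t) (f t) < d"
      by (auto simp: eventually_sequentially)
    then show thesis
      by (intro that[of "p n"]) (auto simp: dist_real_def abs_minus_commute less_imp_le)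
  qed
  have close: "norm (op_fun f R x - op_poly p R x) < e / 3" if R: "op_between m M R" for R
  proof -
    have c: "continuous_on {m..M} (poly p)" by (intro continuous_intros)
    have "norm (op_fun f R - op_poly p R) \<le> d"
      unfolding op_fun_poly[OF R, of p, symmetric] op_fun_diff[OF R f c, symmetric]
      by (rule norm_op_fun_le[OF R]) (use p d f in \<open>auto intro!: continuous_intros\<close>)
    then have "norm (op_fun f R x - op_poly p R x) \<le> d * norm x"
      unfolding blinfun.diff_left[symmetric]
      using norm_blinfun[of "op_fun f R - op_poly p R" x] by (meson mult_right_mono norm_ge_zero order_trans)
    also have "\<dots> < d * a" using d a by simp
    also have "\<dots> = e / 3" using a by (simp add: d_def)
    finally show ?thesis .
  qed
  have "((\<lambda>i. op_poly p (S i) x) \<longlongrightarrow> op_poly p T x) F"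
    using norm_le_of_op_between[OF S] lim by (rule op_poly_strong_tendsto)
  then have "\<forall>\<^sub>F i in F. dist (op_poly p (S i) x) (op_poly p T x) < e / 3"
    using \<open>e > 0\<close> by (intro tendstoD) auto
  then show "\<forall>\<^sub>F i in F. dist (op_fun f (S i) x) (op_fun f T x) < e"
  proof eventually_elim
    case (elim i)
    have "dist (op_fun f (S i) x) (op_fun f T x) \<le> dist (op_fun f (S i) x) (op_poly p (S i) x)
        + dist (op_poly p (S i) x) (op_poly p T x) + dist (op_poly p T x) (op_fun f T x)"
      using dist_triangle[of "op_fun f (S i) x" "op_fun f T x" "op_poly p (S i) x"]
        dist_triangle[of "op_poly p (S i) x" "op_fun f T x" "op_poly p T x"] by linarith
    also have "\<dots> < e / 3 + e / 3 + e / 3"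
      using close[OF S[of i]] close[OF T] elim by (intro add_strict_mono) (auto simp: dist_norm norm_minus_commute)
    finally show ?case by simp
  qed
qed

section \<open>Interpolation of weighted sums\<close>

text \<open>The value is pi / sin(pi \<nu>), but it matters only that it is neither 0 nor infinite,
  so that it can be cancelled. Upper bound: u^(-\<nu>) up to 1 and u^(-\<nu>-1) beyond; lower bound:
  the part over [1, 2].\<close>

lemma nn_integral_powr_kernel:
  fixes \<nu> :: real
  assumes "0 < \<nu>" "\<nu> < 1"
  shows "(\<integral>\<^sup>+u. ennreal (u powr - \<nu> / (1 + u) * indicator {0<..} u) \<partial>lborel) \<in> {0<..<\<infinity>}" (is "?C \<in> _")
proof -
  have fin: "(\<integral>\<^sup>+u. ennreal (if u \<in> A then u powr a else 0) \<partial>lborel) < \<infinity>"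
    if "((\<lambda>u. u powr a) has_integral I) A" "A \<in> sets borel" for a I A
  proof -
    have "(\<integral>\<^sup>+u. ennreal (if u \<in> A then u powr a else 0) \<partial>lborel) = ennreal I"
      by (rule nn_integral_has_integral_lborel)
        (use that in \<open>auto simp: has_integral_restrict_UNIV\<close>)
    then show ?thesis by simp
  qed
  have "?C \<le> (\<integral>\<^sup>+u. ennreal (if u \<in> {0..1} then u powr -\<nu> else 0) + ennreal (if u \<in> {1..} then u powr (- \<nu> - 1) else 0) \<partial>lborel)"
  proof (rule nn_integral_mono)
    fix u :: real
    consider "u \<le> 0" | "0 < u" "u \<le> 1" | "1 < u" by linarith
    then show "ennreal (u powr - \<nu> / (1 + u) * indicator {0<..} u)
        \<le> ennreal (if u \<in> {0..1} then u powr -\<nu> else 0) + ennreal (if u \<in> {1..} then u powr (- \<nu> - 1) else 0)"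
    proof cases
      case 2
      have "u powr - \<nu> / (1 + u) \<le> u powr - \<nu>"
        using 2 by (simp add: divide_le_eq mult_left_mono)
      then have "ennreal (u powr - \<nu> / (1 + u)) \<le> ennreal (u powr - \<nu>)"
        by (rule ennreal_leI)
      then have "ennreal (u powr - \<nu> / (1 + u) * indicator {0<..} u) \<le> ennreal (if u \<in> {0..1} then u powr -\<nu> else 0)"
        using 2 by simp
      then show ?thesis by (rule add_increasing2[rotated]) simp
    next
      case 3
      have "u powr - \<nu> / (1 + u) \<le> u powr (- \<nu> - 1)"
        using 3 by (simp add: powr_diff frac_le)
      then have "ennreal (u powr - \<nu> / (1 + u)) \<le> ennreal (u powr (- \<nu> - 1))"
        by (rule ennreal_leI)
      then have "ennreal (u powr - \<nu> / (1 + u) * indicator {0<..} u) \<le> ennreal (if u \<in> {1..} then u powr (- \<nu> - 1) else 0)"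
        using 3 by simp
      then show ?thesis by (rule add_increasing[rotated]) simp
    qed auto
  qed
  also have "\<dots> = (\<integral>\<^sup>+u. ennreal (if u \<in> {0..1} then u powr -\<nu> else 0) \<partial>lborel)
      + (\<integral>\<^sup>+u. ennreal (if u \<in> {1..} then u powr (- \<nu> - 1) else 0) \<partial>lborel)"
    by (rule nn_integral_add) auto
  also have "\<dots> < \<infinity>"
    using fin[OF has_integral_powr_from_0[of "-\<nu>" 1]] fin[OF has_integral_powr_to_inf[of "-\<nu> - 1" 1]] assms
    by auto
  finally have up: "?C < \<infinity>" .
  have "0 < ennreal (2 powr - \<nu> / 3)" by simp
  also have "\<dots> = (\<integral>\<^sup>+u. ennreal (2 powr - \<nu> / 3) * indicator {1..2::real} u \<partial>lborel)"
    by (subst nn_integral_cmult_indicator) auto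
  also have "\<dots> \<le> ?C"
  proof (rule nn_integral_mono)
    fix u :: real
    have "2 powr - \<nu> / 3 \<le> u powr - \<nu> / (1 + u)" if "1 \<le> u" "u \<le> 2"
      using that assms by (intro frac_le powr_mono2') auto
    then show "ennreal (2 powr - \<nu> / 3) * indicator {1..2::real} u \<le> ennreal (u powr - \<nu> / (1 + u) * indicator {0<..} u)"
      by (auto simp: indicator_def intro!: ennreal_leI)
  qed
  finally show ?thesis using up by simp
qed

text \<open>Substitution t = (x / z) u. It represents the geometric mean x^(1-\<nu>) z^\<nu> by
  parallel sums of x and t z, for which a variational formula is available.\<close>

lemma nn_integral_powr_scaled:
  fixes \<nu> x z :: real
  assumes "0 < \<nu>" "\<nu> < 1" "x > 0" "z > 0"
  shows "(\<integral>\<^sup>+t. ennreal (t powr (- \<nu> - 1) * (x * (t * z) / (x + t * z)) * indicator {0<..} t) \<partial>lborel)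
     = ennreal (x powr (1 - \<nu>) * z powr \<nu>) *
       (\<integral>\<^sup>+u. ennreal (u powr - \<nu> / (1 + u) * indicator {0<..} u) \<partial>lborel)"
proof -
  define c where "c = x / z"
  have c: "c > 0" using assms by (simp add: c_def)
  define f where "f t = ennreal (t powr (- \<nu> - 1) * (x * (t * z) / (x + t * z)) * indicator {0<..} t)" for t
  have "(\<integral>\<^sup>+t. f t \<partial>lborel) = ennreal \<bar>c\<bar> * (\<integral>\<^sup>+u. f (0 + c * u) \<partial>lborel)"
    by (rule nn_integral_real_affine) (use c in \<open>auto simp: f_def[abs_def]\<close>)
  also have "(\<integral>\<^sup>+u. f (0 + c * u) \<partial>lborel) =
     (\<integral>\<^sup>+u. ennreal (c powr (-\<nu>) * z) * ennreal (u powr - \<nu> / (1 + u) * indicator {0<..} u) \<partial>lborel)"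
  proof (rule nn_integral_cong)
    fix u :: real
    show "f (0 + c * u) = ennreal (c powr (-\<nu>) * z) * ennreal (u powr - \<nu> / (1 + u) * indicator {0<..} u)"
    proof (cases "u > 0")
      case True
      have xc: "x = c * z" using assms by (simp add: c_def)
      have e1: "x * (c * u * z) / (x + c * u * z) = c * z * (u / (1 + u))"
        unfolding xc using c True assms add_pos_pos[of "c * z" "c * (u * z)"]
        by (simp add: divide_simps) (simp add: algebra_simps)
      have e2: "(c * u) powr (- \<nu> - 1) = c powr (-\<nu>) / c * (u powr (-\<nu>) / u)"
        using c True by (simp add: powr_mult powr_diff)
      have "(c * u) powr (- \<nu> - 1) * (x * (c * u * z) / (x + c * u * z)) = c powr (-\<nu>) * z * (u powr - \<nu> / (1 + u))"
        unfolding e1 e2 using c True by simp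
      then show ?thesis
        using c True assms by (simp add: f_def ennreal_mult[symmetric])
    next
      case False
      then have "\<not> c * u > 0" using c by (simp add: zero_less_mult_iff)
      with False show ?thesis by (simp add: f_def)
    qed
  qed
  also have "\<dots> = ennreal (c powr (-\<nu>) * z) * (\<integral>\<^sup>+u. ennreal (u powr - \<nu> / (1 + u) * indicator {0<..} u) \<partial>lborel)"
    by (rule nn_integral_cmult) simp
  also have "ennreal \<bar>c\<bar> * \<dots> = ennreal (c * (c powr (-\<nu>) * z)) * (\<integral>\<^sup>+u. ennreal (u powr - \<nu> / (1 + u) * indicator {0<..} u) \<partial>lborel)"
    using c assms by (simp add: ennreal_mult mult.assoc)
  also have "c * (c powr (-\<nu>) * z) = x powr (1 - \<nu>) * z powr \<nu>"
    using assms by (simp add: c_def powr_divide powr_minus powr_diff field_simps)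
  finally show ?thesis by (simp add: f_def)
qed

lemma nn_integral_parallel_sums:
  fixes x z v :: "'i \<Rightarrow> real"
  defines "par \<equiv> \<lambda>x y :: real. x * y / (x + y)"
  assumes "0 < \<nu>" "\<nu> < 1"
    and I: "finite I" and xz: "\<And>i. i \<in> I \<Longrightarrow> x i > 0 \<and> z i > 0" and v: "\<And>i. v i \<ge> 0"
  shows "(\<integral>\<^sup>+t. ennreal (t powr (- \<nu> - 1) * indicator {0<..} t * (\<Sum>i\<in>I. par (x i) (t * z i) * v i)) \<partial>lborel)
    = ennreal (\<Sum>i\<in>I. x i powr (1 - \<nu>) * z i powr \<nu> * v i) *
      (\<integral>\<^sup>+u. ennreal (u powr - \<nu> / (1 + u) * indicator {0<..} u) \<partial>lborel)"
proof -
  define k where "k t = t powr (- \<nu> - 1) * indicator {0<..} t" for t :: real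
  define C where "C = (\<integral>\<^sup>+u. ennreal (u powr - \<nu> / (1 + u) * indicator {0<..} u) \<partial>lborel)"
  have "(\<integral>\<^sup>+t. ennreal (k t * (\<Sum>i\<in>I. par (x i) (t * z i) * v i)) \<partial>lborel)
      = (\<integral>\<^sup>+t. (\<Sum>i\<in>I. ennreal (k t * par (x i) (t * z i)) * ennreal (v i)) \<partial>lborel)"
  proof (rule nn_integral_cong)
    fix t :: real
    have nn: "0 \<le> k t * par (x i) (t * z i)" if "i \<in> I" for i
      using xz[OF that] by (cases "t > 0") (auto simp: k_def par_def)
    have "ennreal (k t * (\<Sum>i\<in>I. par (x i) (t * z i) * v i)) = ennreal (\<Sum>i\<in>I. k t * par (x i) (t * z i) * v i)"
      by (simp add: sum_distrib_left mult.assoc)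
    also have "\<dots> = (\<Sum>i\<in>I. ennreal (k t * par (x i) (t * z i) * v i))"
      by (rule sum_ennreal[symmetric]) (use nn v in auto)
    also have "\<dots> = (\<Sum>i\<in>I. ennreal (k t * par (x i) (t * z i)) * ennreal (v i))"
      by (intro sum.cong refl ennreal_mult nn v)
    finally show "ennreal (k t * (\<Sum>i\<in>I. par (x i) (t * z i) * v i)) = (\<Sum>i\<in>I. ennreal (k t * par (x i) (t * z i)) * ennreal (v i))" .
  qed
  also have "\<dots> = (\<Sum>i\<in>I. (\<integral>\<^sup>+t. ennreal (k t * par (x i) (t * z i)) \<partial>lborel) * ennreal (v i))"
    by (simp add: nn_integral_sum nn_integral_multc k_def par_def)
  also have "\<dots> = (\<Sum>i\<in>I. ennreal (x i powr (1 - \<nu>) * z i powr \<nu> * v i) * C)"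
  proof (rule sum.cong)
    fix i assume i: "i \<in> I"
    have "(\<integral>\<^sup>+t. ennreal (k t * par (x i) (t * z i)) \<partial>lborel) = ennreal (x i powr (1 - \<nu>) * z i powr \<nu>) * C"
      using nn_integral_powr_scaled[OF assms(2,3), of "x i" "z i"] xz[OF i]
      by (simp add: k_def par_def C_def mult_ac)
    then show "(\<integral>\<^sup>+t. ennreal (k t * par (x i) (t * z i)) \<partial>lborel) * ennreal (v i) = ennreal (x i powr (1 - \<nu>) * z i powr \<nu> * v i) * C"
      using v[of i] by (simp add: ennreal_mult mult_ac)
  qed simp
  also have "\<dots> = ennreal (\<Sum>i\<in>I. x i powr (1 - \<nu>) * z i powr \<nu> * v i) * C"
    using v by (simp add: sum_distrib_right[symmetric] sum_ennreal)
  finally show ?thesis by (simp add: k_def C_def)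
qed

text \<open>x z / (x + z) |c|^2 is the minimum of x |a|^2 + z |b|^2 over a + b = c. For |a| and |b|
  the defect, multiplied by x + z, is (x |a| - z |b|)^2.\<close>

lemma parallel_sum_le:
  fixes a b :: complex and x z :: real
  assumes "x > 0" "z > 0"
  shows "x * z / (x + z) * (cmod (a + b))\<^sup>2 \<le> x * (cmod a)\<^sup>2 + z * (cmod b)\<^sup>2"
proof -
  have "(x * z / (x + z)) * (cmod (a + b))\<^sup>2 \<le> (x * z / (x + z)) * (cmod a + cmod b)\<^sup>2"
    using assms by (intro mult_left_mono power_mono norm_triangle_ineq) auto
  also have "\<dots> \<le> x * (cmod a)\<^sup>2 + z * (cmod b)\<^sup>2"
  proof -
    have "(x + z) * (x * (cmod a)\<^sup>2 + z * (cmod b)\<^sup>2) - x * z * (cmod a + cmod b)\<^sup>2 = (x * cmod a - z * cmod b)\<^sup>2"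
      by (simp add: power2_eq_square algebra_simps)
    then have "x * z * (cmod a + cmod b)\<^sup>2 \<le> (x + z) * (x * (cmod a)\<^sup>2 + z * (cmod b)\<^sup>2)"
      by (smt (verit) zero_le_power2)
    then show ?thesis
      using assms by (simp add: field_simps)
  qed
  finally show ?thesis .
qed

text \<open>The parallel sum of \<open>x\<close> and \<open>t z\<close> is a minimum over decompositions \<open>c = c1 + c2\<close>, and the linear
  map \<open>W\<close> sends decompositions to decompositions.\<close>

lemma weighted_l2_interpolation:
  fixes W :: "'j \<Rightarrow> 'l \<Rightarrow> complex" and \<alpha> \<beta> :: "'j \<Rightarrow> real" and \<alpha>' \<beta>' :: "'l \<Rightarrow> real"
  assumes J: "finite J" and L: "finite L"
    and pos: "\<And>j. j \<in> J \<Longrightarrow> \<alpha> j > 0 \<and> \<beta> j > 0" "\<And>l. l \<in> L \<Longrightarrow> \<alpha>' l > 0 \<and> \<beta>' l > 0"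
    and A: "\<And>c. (\<Sum>j\<in>J. \<alpha> j * (cmod (\<Sum>l\<in>L. W j l * c l))\<^sup>2) \<le> (\<Sum>l\<in>L. \<alpha>' l * (cmod (c l))\<^sup>2)"
    and B: "\<And>c. (\<Sum>j\<in>J. \<beta> j * (cmod (\<Sum>l\<in>L. W j l * c l))\<^sup>2) \<le> (\<Sum>l\<in>L. \<beta>' l * (cmod (c l))\<^sup>2)"
    and \<nu>: "0 \<le> \<nu>" "\<nu> \<le> 1"
  shows "(\<Sum>j\<in>J. \<alpha> j powr (1 - \<nu>) * \<beta> j powr \<nu> * (cmod (\<Sum>l\<in>L. W j l * c l))\<^sup>2)
    \<le> (\<Sum>l\<in>L. \<alpha>' l powr (1 - \<nu>) * \<beta>' l powr \<nu> * (cmod (c l))\<^sup>2)"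
proof -
  \<comment> \<open>At the endpoints the kernel integral diverges; there the claim is
    \<open>A\<close> or \<open>B\<close> itself.\<close>
  consider "\<nu> = 0" | "\<nu> = 1" | "0 < \<nu>" "\<nu> < 1" using \<nu> by linarith
  then show ?thesis
  proof cases
    case 1
    have "(\<Sum>j\<in>J. \<alpha> j powr (1 - \<nu>) * \<beta> j powr \<nu> * (cmod (\<Sum>l\<in>L. W j l * c l))\<^sup>2) = (\<Sum>j\<in>J. \<alpha> j * (cmod (\<Sum>l\<in>L. W j l * c l))\<^sup>2)"
      using pos 1 by (intro sum.cong) (simp_all add: less_imp_le order.strict_implies_not_eq[symmetric])
    moreover have "(\<Sum>l\<in>L. \<alpha>' l powr (1 - \<nu>) * \<beta>' l powr \<nu> * (cmod (c l))\<^sup>2) = (\<Sum>l\<in>L. \<alpha>' l * (cmod (c l))\<^sup>2)"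
      using pos 1 by (intro sum.cong) (simp_all add: less_imp_le order.strict_implies_not_eq[symmetric])
    ultimately show ?thesis using A[of c] by simp
  next
    case 2
    have "(\<Sum>j\<in>J. \<alpha> j powr (1 - \<nu>) * \<beta> j powr \<nu> * (cmod (\<Sum>l\<in>L. W j l * c l))\<^sup>2) = (\<Sum>j\<in>J. \<beta> j * (cmod (\<Sum>l\<in>L. W j l * c l))\<^sup>2)"
      using pos 2 by (intro sum.cong) (simp_all add: less_imp_le order.strict_implies_not_eq[symmetric])
    moreover have "(\<Sum>l\<in>L. \<alpha>' l powr (1 - \<nu>) * \<beta>' l powr \<nu> * (cmod (c l))\<^sup>2) = (\<Sum>l\<in>L. \<beta>' l * (cmod (c l))\<^sup>2)"
      using pos 2 by (intro sum.cong) (simp_all add: less_imp_le order.strict_implies_not_eq[symmetric])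
    ultimately show ?thesis using B[of c] by simp
  next
    case 3
    define par where "par x y = x * y / (x + y)" for x y :: real
    define w where "w j = (cmod (\<Sum>l\<in>L. W j l * c l))\<^sup>2" for j
    define k where "k t = t powr (- \<nu> - 1) * indicator {0<..} t" for t :: real
    define C where "C = (\<integral>\<^sup>+u. ennreal (u powr - \<nu> / (1 + u) * indicator {0<..} u) \<partial>lborel)"
    have C: "0 < C" "C < \<infinity>"
      using nn_integral_powr_kernel[OF 3] by (auto simp: C_def)
    have ptw: "(\<Sum>j\<in>J. par (\<alpha> j) (t * \<beta> j) * w j) \<le> (\<Sum>l\<in>L. par (\<alpha>' l) (t * \<beta>' l) * (cmod (c l))\<^sup>2)"
      if t: "t > 0" for t
    proof -
      \<comment> \<open>The decomposition c = c1 + c2 is the minimising one for the weights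
        \<alpha>' and t \<beta>', so the last equality of this block is exact; on the other side its
        image need not be minimising, and \<open>parallel_sum_le\<close> suffices.\<close>
      define r where "r l = t * \<beta>' l / (\<alpha>' l + t * \<beta>' l)" for l
      define s where "s l = \<alpha>' l / (\<alpha>' l + t * \<beta>' l)" for l
      define c1 where "c1 l = of_real (r l) * c l" for l
      define c2 where "c2 l = of_real (s l) * c l" for l
      have rs: "r l + s l = 1" "\<alpha>' l * (r l)\<^sup>2 + t * \<beta>' l * (s l)\<^sup>2 = par (\<alpha>' l) (t * \<beta>' l)" if "l \<in> L" for l
      proof -
        define a b where "a = \<alpha>' l" and "b = t * \<beta>' l"
        have ab: "a > 0" "b > 0" using pos(2)[OF that] t by (auto simp: a_def b_def)
        show "r l + s l = 1"
          using ab unfolding r_def s_def a_def[symmetric] b_def[symmetric]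
          by (simp add: add_divide_distrib[symmetric] add.commute)
        have "a * (b / (a + b))\<^sup>2 + b * (a / (a + b))\<^sup>2 = (a * b\<^sup>2 + b * a\<^sup>2) / (a + b)\<^sup>2"
          by (simp add: power_divide add_divide_distrib)
        also have "a * b\<^sup>2 + b * a\<^sup>2 = a * b * (a + b)"
          by (simp add: power2_eq_square algebra_simps)
        also have "a * b * (a + b) / (a + b)\<^sup>2 = a * b / (a + b)"
          by (simp add: power2_eq_square)
        finally show "\<alpha>' l * (r l)\<^sup>2 + t * \<beta>' l * (s l)\<^sup>2 = par (\<alpha>' l) (t * \<beta>' l)"
          unfolding r_def s_def par_def a_def b_def .
      qed
      have dec: "(\<Sum>l\<in>L. W j l * c l) = (\<Sum>l\<in>L. W j l * c1 l) + (\<Sum>l\<in>L. W j l * c2 l)" for j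
        unfolding sum.distrib[symmetric]
      proof (rule sum.cong)
        fix l assume "l \<in> L"
        have "c1 l + c2 l = of_real (r l + s l) * c l"
          by (simp add: c1_def c2_def distrib_right)
        then have "c l = c1 l + c2 l" using rs(1)[OF \<open>l \<in> L\<close>] by simp
        then show "W j l * c l = W j l * c1 l + W j l * c2 l"
          by (metis distrib_left)
      qed simp
      have "(\<Sum>j\<in>J. par (\<alpha> j) (t * \<beta> j) * w j) \<le>
          (\<Sum>j\<in>J. \<alpha> j * (cmod (\<Sum>l\<in>L. W j l * c1 l))\<^sup>2 + t * \<beta> j * (cmod (\<Sum>l\<in>L. W j l * c2 l))\<^sup>2)"
        unfolding w_def dec par_def by (intro sum_mono parallel_sum_le) (use pos t in auto)
      also have "\<dots> = (\<Sum>j\<in>J. \<alpha> j * (cmod (\<Sum>l\<in>L. W j l * c1 l))\<^sup>2) + t * (\<Sum>j\<in>J. \<beta> j * (cmod (\<Sum>l\<in>L. W j l * c2 l))\<^sup>2)"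
        by (simp add: sum.distrib sum_distrib_left mult.assoc)
      also have "\<dots> \<le> (\<Sum>l\<in>L. \<alpha>' l * (cmod (c1 l))\<^sup>2) + t * (\<Sum>l\<in>L. \<beta>' l * (cmod (c2 l))\<^sup>2)"
        using t by (intro add_mono mult_left_mono A B) auto
      also have "\<dots> = (\<Sum>l\<in>L. (\<alpha>' l * (r l)\<^sup>2 + t * \<beta>' l * (s l)\<^sup>2) * (cmod (c l))\<^sup>2)"
        by (simp add: c1_def c2_def norm_mult power_mult_distrib sum.distrib sum_distrib_left algebra_simps)
      also have "\<dots> = (\<Sum>l\<in>L. par (\<alpha>' l) (t * \<beta>' l) * (cmod (c l))\<^sup>2)"
        by (rule sum.cong) (use rs in auto)
      finally show ?thesis .
    qed
    have "(\<integral>\<^sup>+t. ennreal (k t * (\<Sum>j\<in>J. par (\<alpha> j) (t * \<beta> j) * w j)) \<partial>lborel)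
        \<le> (\<integral>\<^sup>+t. ennreal (k t * (\<Sum>l\<in>L. par (\<alpha>' l) (t * \<beta>' l) * (cmod (c l))\<^sup>2)) \<partial>lborel)"
    proof (intro nn_integral_mono ennreal_leI)
      fix t
      show "k t * (\<Sum>j\<in>J. par (\<alpha> j) (t * \<beta> j) * w j) \<le> k t * (\<Sum>l\<in>L. par (\<alpha>' l) (t * \<beta>' l) * (cmod (c l))\<^sup>2)"
        by (cases "t > 0") (auto simp: k_def intro!: mult_left_mono ptw)
    qed
    also have "(\<integral>\<^sup>+t. ennreal (k t * (\<Sum>j\<in>J. par (\<alpha> j) (t * \<beta> j) * w j)) \<partial>lborel)
        = ennreal (\<Sum>j\<in>J. \<alpha> j powr (1 - \<nu>) * \<beta> j powr \<nu> * w j) * C"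
      unfolding k_def par_def C_def
      by (rule nn_integral_parallel_sums[OF 3 J pos(1)]) (auto simp: w_def)
    also have "(\<integral>\<^sup>+t. ennreal (k t * (\<Sum>l\<in>L. par (\<alpha>' l) (t * \<beta>' l) * (cmod (c l))\<^sup>2)) \<partial>lborel)
        = ennreal (\<Sum>l\<in>L. \<alpha>' l powr (1 - \<nu>) * \<beta>' l powr \<nu> * (cmod (c l))\<^sup>2) * C"
      unfolding k_def par_def C_def
      by (rule nn_integral_parallel_sums[OF 3 L pos(2)]) auto
    \<comment> \<open>Cancels the kernel constant C.\<close>
    finally have "ennreal (\<Sum>j\<in>J. \<alpha> j powr (1 - \<nu>) * \<beta> j powr \<nu> * w j)
        \<le> ennreal (\<Sum>l\<in>L. \<alpha>' l powr (1 - \<nu>) * \<beta>' l powr \<nu> * (cmod (c l))\<^sup>2)"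
      using C ennreal_mult_le_mult_iff[of C] by (simp add: mult.commute[of _ C])
    then show ?thesis
      unfolding w_def by (subst (asm) ennreal_le_iff) (auto intro!: sum_nonneg)
  qed
qed

section \<open>Finite-rank projections and eigenbases\<close>

lemma cnj_cinner: "cnj (cinner x y) = cinner y (x::'a::complex_hilbert)"
  using cinner_commute[of y x] by simp

definition orthonormal :: "'a::complex_hilbert set \<Rightarrow> bool" where
  "orthonormal F \<longleftrightarrow> (\<forall>e\<in>F. \<forall>e'\<in>F. cinner e e' = (if e = e' then 1 else 0))"

definition proj :: "'a::complex_hilbert set \<Rightarrow> 'a \<Rightarrow>\<^sub>L 'a" where
  "proj F = Blinfun (\<lambda>x. \<Sum>f\<in>F. cinner f x *\<^sub>C f)"

lemma proj_apply: "proj F x = (\<Sum>f\<in>F. cinner f x *\<^sub>C f)"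
  unfolding proj_def
  by (intro bounded_linear_Blinfun_apply[THEN fun_cong] bounded_linear_sum
      bounded_linear_compose[OF scaleC.bounded_linear_left cinner.bounded_linear_right])

lemma orthonormal_subset: "orthonormal F \<Longrightarrow> G \<subseteq> F \<Longrightarrow> orthonormal G"
  unfolding orthonormal_def by blast

lemma is_onb_orthonormal: "is_onb B \<Longrightarrow> orthonormal B"
  by (simp add: is_onb_def orthonormal_def)

lemma herm_proj: "herm (proj F)"
  unfolding herm_def proj_apply
  by (simp add: cinner.sum_left cinner.sum_right cinner_scaleC_left cinner_scaleC_right
      cnj_cinner mult.commute)

lemma cinner_proj_expand:
  "cinner z (proj F x) = (\<Sum>f\<in>F. cinner f x * cinner z f)"
  by (simp add: proj_apply cinner.sum_right cinner_scaleC_right)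

lemma norm_orthonormal: "orthonormal F \<Longrightarrow> f \<in> F \<Longrightarrow> norm f = 1"
  unfolding orthonormal_def norm_eq_sqrt_cinner by auto

context
  fixes F :: "'a::complex_hilbert set"
  assumes F: "finite F" "orthonormal F"
begin

lemma cinner_proj: "f \<in> F \<Longrightarrow> cinner f (proj F x) = cinner f x"
proof -
  assume f: "f \<in> F"
  have "cinner f (proj F x) = (\<Sum>g\<in>F. if g = f then cinner f x else 0)"
    unfolding cinner_proj_expand
    by (rule sum.cong) (use F f in \<open>auto simp: orthonormal_def\<close>)
  then show ?thesis using F f by simp
qed

lemma proj_proj [simp]: "proj F (proj F x) = proj F x"
  by (subst proj_apply) (simp add: cinner_proj cong: sum.cong, simp add: proj_apply)

lemma cinner_proj_self: "cinner x (proj F x) = complex_of_real (\<Sum>f\<in>F. (cmod (cinner f x))\<^sup>2)"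
  unfolding cinner_proj_expand of_real_sum
  by (rule sum.cong) (simp_all add: cmod_sq_eq cnj_cinner)

lemma norm_proj_sq: "(norm (proj F x))\<^sup>2 = (\<Sum>f\<in>F. (cmod (cinner f x))\<^sup>2)"
proof -
  have "complex_of_real ((norm (proj F x))\<^sup>2) = cinner x (proj F x)"
    unfolding cinner_self[symmetric] hermD[OF herm_proj] by simp
  then show ?thesis
    unfolding cinner_proj_self using of_real_eq_iff by blast
qed

lemma norm_sq_split: "(norm x)\<^sup>2 = (norm (proj F x))\<^sup>2 + (norm (x - proj F x))\<^sup>2"
proof -
  have "cinner x (proj F x) = complex_of_real ((norm (proj F x))\<^sup>2)"
    unfolding norm_proj_sq by (rule cinner_proj_self)
  then show ?thesis
    unfolding norm_minus_sq by simp
qed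

lemma bessel: "(\<Sum>f\<in>F. (cmod (cinner f x))\<^sup>2) \<le> (norm x)\<^sup>2"
  unfolding norm_proj_sq[symmetric] using norm_sq_split[of x] by simp

lemma in_proj_range: "f \<in> F \<Longrightarrow> proj F f = f"
proof -
  assume f: "f \<in> F"
  have "proj F f = (\<Sum>g\<in>F. if g = f then f else 0)"
    unfolding proj_apply by (rule sum.cong) (use F f in \<open>auto simp: orthonormal_def scaleC.zero_left\<close>)
  then show ?thesis using F f by simp
qed

end

text \<open>Expand each f in E, exchange the sums and contract over F. Equality of the projections
  encodes that both families span the same subspace.\<close>

lemma trace_eigenbasis_eq:
  fixes S :: "'a::complex_hilbert \<Rightarrow>\<^sub>L 'a"
  assumes E: "finite E" "orthonormal E" and F: "finite F" "orthonormal F"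
    and EF: "proj E = proj F" and S: "complex_linear S"
  shows "(\<Sum>f\<in>F. cinner f (S f)) = (\<Sum>e\<in>E. cinner e (S e))"
proof -
  have "(\<Sum>f\<in>F. cinner f (S f)) = (\<Sum>f\<in>F. \<Sum>e\<in>E. cinner f e * cinner e (S f))"
  proof (rule sum.cong)
    fix f assume "f \<in> F"
    then have "f = proj E f" using in_proj_range[OF F] EF by simp
    then have "cinner f (S f) = cinner (proj E f) (S f)" by simp
    also have "\<dots> = (\<Sum>e\<in>E. cinner f e * cinner e (S f))"
      by (simp add: hermD[OF herm_proj] cinner_proj_expand mult.commute)
    finally show "cinner f (S f) = (\<Sum>e\<in>E. cinner f e * cinner e (S f))" .
  qed simp
  also have "\<dots> = (\<Sum>e\<in>E. \<Sum>f\<in>F. cinner f e * cinner e (S f))"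
    by (rule sum.swap)
  also have "\<dots> = (\<Sum>e\<in>E. cinner e (S e))"
  proof (rule sum.cong)
    fix e assume "e \<in> E"
    then have e: "e = proj F e" using in_proj_range[OF E] EF by metis
    have "S (proj F e) = (\<Sum>f\<in>F. cinner f e *\<^sub>C S f)"
      using S by (simp add: proj_apply blinfun.sum_right complex_linear_def)
    then have "cinner e (S (proj F e)) = (\<Sum>f\<in>F. cinner f e * cinner e (S f))"
      by (simp add: cinner.sum_right cinner_scaleC_right)
    then show "(\<Sum>f\<in>F. cinner f e * cinner e (S f)) = cinner e (S e)"
      using e by simp
  qed simp
  finally show ?thesis .
qed

text \<open>Strip factors off an annihilating polynomial until the vector becomes nonzero. A
  quadratic factor is injective by the completed square, so the factor that kills this vector is
  linear and its root is an eigenvalue.\<close>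

lemma op_poly_eigenvector:
  fixes T :: "'a::complex_hilbert \<Rightarrow>\<^sub>L 'a"
  assumes T: "herm T" and "w \<noteq> 0" and "p \<noteq> 0" "op_poly p T w = 0"
  shows "\<exists>q r. op_poly q T w \<noteq> 0 \<and> T (op_poly q T w) = r *\<^sub>R op_poly q T w"
  using assms(3,4)
proof (induction "degree p" arbitrary: p rule: less_induct)
  case less
  show ?case
  proof (cases "degree p = 0")
    case True
    then obtain c where "p = [:c:]" using degree_eq_zeroE by blast
    with less.prems \<open>w \<noteq> 0\<close> show ?thesis
      by (auto simp: op_poly_const blinfun.scaleR_left)
  next
    case False
    then have "degree p > 0" by simp
    then show ?thesis
    proof (cases rule: real_poly_factor)
      case (linear t q)
      have "q \<noteq> 0" using linear less.prems by auto
      then have q: "q \<noteq> 0" "degree q < degree p"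
        unfolding linear by (simp_all add: degree_mult_eq del: mult_pCons_left)
      show ?thesis
      proof (cases "op_poly q T w = 0")
        case True
        with less.hyps q show ?thesis by blast
      next
        case False
        have "op_poly [:-t, 1:] T (op_poly q T w) = 0"
          using less.prems(2) unfolding linear op_poly_mult by simp
        then have "T (op_poly q T w) = t *\<^sub>R op_poly q T w"
          by (simp add: op_poly_pCons blinfun.add_left blinfun.scaleR_left blinfun.minus_left
              blinfun.diff_left)
        with False show ?thesis by blast
      qed
    next
      case (quadratic a b q)
      have "q \<noteq> 0" using quadratic less.prems by auto
      then have q: "q \<noteq> 0" "degree q < degree p"
        unfolding quadratic by (simp_all add: degree_mult_eq del: mult_pCons_left)
      have "op_poly [:a\<^sup>2 + b\<^sup>2, - 2 * a, 1:] T (op_poly q T w) = 0"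
        using less.prems(2) unfolding quadratic op_poly_mult by simp
      then have "b\<^sup>2 * (norm (op_poly q T w))\<^sup>2 + (norm (T (op_poly q T w) - a *\<^sub>R op_poly q T w))\<^sup>2 = 0"
        using Re_cinner_op_quadratic[OF T, of "op_poly q T w" a b] by (simp add: cinner.zero_right)
      then have "b\<^sup>2 * (norm (op_poly q T w))\<^sup>2 = 0"
        by (smt (verit) mult_nonneg_nonneg zero_le_power2)
      then have "op_poly q T w = 0"
        using \<open>b \<noteq> 0\<close> by simp
      with less.hyps q show ?thesis by blast
    qed
  qed
qed

lemma op_poly_sum: "op_poly (\<Sum>i\<in>I. p i) T = (\<Sum>i\<in>I. op_poly (p i) T)"
  by (induction I rule: infinite_finite_induct) (simp_all add: op_poly_add)

lemma op_poly_monom: "op_poly (monom c k) T = c *\<^sub>R op_poly (monom 1 k) T"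
  using op_poly_smult[of c "monom 1 k" T] by (simp add: smult_monom)

text \<open>The vectors w, T w, T^2 w, ... stay in a finite-dimensional space, so a linear relation
  among them exists and its coefficients form the polynomial.\<close>

lemma annihilating_poly:
  fixes T :: "'a::complex_hilbert \<Rightarrow>\<^sub>L 'a"
  assumes F: "finite F" and inv: "\<And>q. proj F (op_poly q T w) = op_poly q T w"
  shows "\<exists>p. p \<noteq> 0 \<and> op_poly p T w = 0"
proof -
  \<comment> \<open>The relation must have real coefficients, so the complex span of F is viewed as
    the real span of F and i F.\<close>
  define S where "S = F \<union> (\<lambda>f. \<i> *\<^sub>C f) ` F"
  have S: "finite S" using F by (simp add: S_def)
  define u where "u k = op_poly (monom 1 k) T w" for k
  have u: "u k \<in> span S" for k
  proof -
    have "c *\<^sub>C f \<in> span S" if "f \<in> F" for c f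
    proof -
      have "c *\<^sub>C f = Re c *\<^sub>R f + Im c *\<^sub>R (\<i> *\<^sub>C f)"
        by (subst complex_eq[of c])
          (simp add: scaleC_add_left scaleC_complex_of_real mult.commute[of \<i>] flip: scaleC_scaleC scaleC_complex_of_real)
      also have "\<dots> \<in> span S"
        using that by (intro span_add span_scale span_base) (auto simp: S_def)
      finally show ?thesis .
    qed
    then have "proj F (u k) \<in> span S"
      unfolding proj_apply by (intro span_sum)
    then show ?thesis using inv by (simp add: u_def)
  qed
  define N where "N = Suc (card S)"
  show ?thesis
  proof (cases "inj_on u {..<N}")
    \<comment> \<open>Equal vectors merge in the image set and their relation would be lost, so they
      are handled by a difference of two monomials.\<close>
    case False
    then obtain i j where ij: "i \<noteq> j" "u i = u j" by (auto simp: inj_on_def)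
    have "coeff (monom 1 i - monom 1 j :: real poly) i \<noteq> 0"
      using ij by simp
    then have "monom 1 i - monom 1 j \<noteq> (0 :: real poly)" by force
    moreover have "op_poly (monom 1 i - monom 1 j) T w = 0"
      using ij by (simp add: op_poly_diff u_def blinfun.diff_left)
    ultimately show ?thesis by blast
  next
    case True
    have "dependent (u ` {..<N})"
    proof (rule ccontr)
      assume "\<not> dependent (u ` {..<N})"
      then have "card (u ` {..<N}) \<le> card S"
        using independent_span_bound[OF S] u by blast
      then show False using True by (simp add: card_image N_def)
    qed
    then obtain c where c: "\<exists>v\<in>u ` {..<N}. c v \<noteq> 0" "(\<Sum>v\<in>u ` {..<N}. c v *\<^sub>R v) = 0"
      by (auto simp: dependent_finite)
    define p where "p = (\<Sum>k<N. monom (c (u k)) k)"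
    obtain k where k: "k < N" "c (u k) \<noteq> 0" using c(1) by auto
    have "coeff p k = c (u k)"
      using k(1) by (simp add: p_def coeff_sum)
    then have "p \<noteq> 0" using k by force
    moreover have "op_poly p T w = 0"
    proof -
      have "op_poly p T w = (\<Sum>k<N. c (u k) *\<^sub>R u k)"
        unfolding p_def op_poly_sum op_poly_monom[of "c _"]
        by (simp add: blinfun.sum_left blinfun.scaleR_left u_def)
      also have "\<dots> = 0"
        using c(2) by (simp add: sum.reindex[OF True])
      finally show ?thesis .
    qed
    ultimately show ?thesis by blast
  qed
qed

text \<open>Count the sum of |<f, e>|^2 over all pairs: summed over F first each e contributes 1,
  summed over E first each f contributes at most 1 by Bessel. This bounds the size of families of
  eigenvectors.\<close>

lemma orthonormal_card_le:
  fixes E F :: "'a::complex_hilbert set"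
  assumes E: "finite E" "orthonormal E" and F: "finite F" "orthonormal F"
    and "\<And>e. e \<in> E \<Longrightarrow> proj F e = e"
  shows "card E \<le> card F"
proof -
  have "real (card E) = (\<Sum>e\<in>E. (norm (proj F e))\<^sup>2)"
    using assms norm_orthonormal[OF E(2)] by simp
  also have "\<dots> = (\<Sum>e\<in>E. \<Sum>f\<in>F. (cmod (cinner f e))\<^sup>2)"
    by (simp add: norm_proj_sq[OF F])
  also have "\<dots> = (\<Sum>f\<in>F. \<Sum>e\<in>E. (cmod (cinner f e))\<^sup>2)"
    by (rule sum.swap)
  also have "\<dots> = (\<Sum>f\<in>F. \<Sum>e\<in>E. (cmod (cinner e f))\<^sup>2)"
    by (intro sum.cong refl) (metis cnj_cinner complex_mod_cnj)
  also have "\<dots> \<le> (\<Sum>f\<in>F. (norm f)\<^sup>2)"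
    by (intro sum_mono bessel E)
  also have "\<dots> = real (card F)"
    using norm_orthonormal[OF F(2)] by simp
  finally show ?thesis by simp
qed

text \<open>Take an orthonormal family of eigenvectors in the range of \<open>proj F\<close> with
  the most elements. If it failed to span some x of the range, the residue w of x would generate,
  under polynomials in T, a further eigenvector orthogonal to the family.\<close>

lemma finite_eigenbasis:
  fixes T :: "'a::complex_hilbert \<Rightarrow>\<^sub>L 'a"
  assumes T: "herm T" and F: "finite F" "orthonormal F"
    and inv: "\<And>x. proj F (T (proj F x)) = T (proj F x)"
  shows "\<exists>E r. finite E \<and> orthonormal E \<and> proj E = proj F \<and> (\<forall>e\<in>E. T e = r e *\<^sub>R e)"
proof -
  define good where "good E \<longleftrightarrow> finite E \<and> orthonormal E \<and> (\<forall>e\<in>E. proj F e = e \<and> (\<exists>r. T e = r *\<^sub>R e))"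
    for E
  have "good {}" by (simp add: good_def orthonormal_def)
  moreover have "\<forall>E. good E \<longrightarrow> card E < Suc (card F)"
    using orthonormal_card_le F by (auto simp: good_def less_Suc_eq_le)
  ultimately have "\<exists>E. good E \<and> (\<forall>E'. good E' \<longrightarrow> card E' \<le> card E)"
    by (rule ex_has_greatest_nat)
  then obtain E where E: "good E" and max: "\<And>E'. good E' \<Longrightarrow> card E' \<le> card E"
    by auto
  from E have E': "finite E" "orthonormal E" and EF: "\<And>e. e \<in> E \<Longrightarrow> proj F e = e"
    and eig: "\<And>e. e \<in> E \<Longrightarrow> \<exists>r. T e = r *\<^sub>R e"
    by (auto simp: good_def)
  have full: "proj E x = x" if x: "proj F x = x" for x
  proof (rule ccontr)
    assume "proj E x \<noteq> x"
    define w where "w = x - proj E x"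
    have w0: "w \<noteq> 0" using \<open>proj E x \<noteq> x\<close> by (simp add: w_def)
    have "proj F (proj E x) = (\<Sum>e\<in>E. cinner e x *\<^sub>C proj F e)"
      by (simp add: proj_apply[of E] blinfun.sum_right herm_scaleC[OF herm_proj])
    also have "\<dots> = proj E x"
      by (simp add: proj_apply[of E] EF)
    finally have wF: "proj F w = w"
      by (simp add: w_def blinfun.diff_right x)
    have wE: "cinner e w = 0" if "e \<in> E" for e
      using that by (simp add: w_def cinner.diff_right cinner_proj[OF E'])
    \<comment> \<open>T preserves both the range of \<open>proj F\<close> and the complement of its
      eigenvectors, so nothing generated from w leaves either space.\<close>
    have pres: "proj F (op_poly q T w) = op_poly q T w \<and> (\<forall>e\<in>E. cinner e (op_poly q T w) = 0)" for q
    proof (induction q)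
      case 0
      show ?case by (simp add: cinner.zero_right)
    next
      case (pCons a q)
      have "cinner e (T (op_poly q T w)) = 0" if "e \<in> E" for e
      proof -
        obtain r where "T e = r *\<^sub>R e" using eig \<open>e \<in> E\<close> by blast
        then have "cinner (T e) (op_poly q T w) = r *\<^sub>R cinner e (op_poly q T w)"
          by (simp add: cinner_scaleR_left)
        with pCons that show ?thesis by (simp add: hermD[OF T])
      qed
      moreover have "proj F (T (op_poly q T w)) = T (op_poly q T w)"
        using inv[of "op_poly q T w"] pCons by simp
      ultimately show ?case
        using wF wE by (simp add: op_poly_pCons blinfun.add_left blinfun.scaleR_left blinfun.add_right
            blinfun.scaleR_right cinner.add_right cinner_scaleR_right)
    qed
    obtain p where "p \<noteq> 0" "op_poly p T w = 0"
      using annihilating_poly[OF F(1)] pres by blast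
    then obtain q r where qr: "op_poly q T w \<noteq> 0" "T (op_poly q T w) = r *\<^sub>R op_poly q T w"
      using op_poly_eigenvector[OF T w0] by blast
    define v where "v = (1 / norm (op_poly q T w)) *\<^sub>R op_poly q T w"
    have v: "proj F v = v" "\<And>e. e \<in> E \<Longrightarrow> cinner e v = 0" "T v = r *\<^sub>R v"
      using pres[of q] qr by (simp_all add: v_def blinfun.scaleR_right cinner_scaleR_right)
    have "norm v = 1" using qr by (simp add: v_def)
    then have vv: "cinner v v = 1" by (simp add: cinner_self)
    have vE: "cinner v e = 0" if "e \<in> E" for e
      using v(2)[OF that] cinner_commute[of v e] by simp
    have "v \<notin> E" using v(2)[of v] vv by auto
    have "good (insert v E)"
      unfolding good_def orthonormal_def
      using E v vv vE \<open>v \<notin> E\<close> by (auto simp: good_def orthonormal_def)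
    from max[OF this] \<open>v \<notin> E\<close> E'(1) show False by simp
  qed
  have "proj E = proj F"
  proof (rule blinfun_eqI)
    fix y
    have "cinner e (y - proj F y) = 0" if "e \<in> E" for e
    proof -
      have "cinner e (y - proj F y) = cinner (proj F e) (y - proj F y)"
        using EF[OF that] by simp
      also have "\<dots> = 0"
        by (simp add: hermD[OF herm_proj] blinfun.diff_right proj_proj[OF F] cinner.zero_right)
      finally show ?thesis .
    qed
    then have "proj E (y - proj F y) = 0"
      by (simp add: proj_apply[of E] scaleC.zero_left)
    then show "proj E y = proj F y"
      using full[of "proj F y"] proj_proj[OF F] by (simp add: blinfun.diff_right)
  qed
  moreover obtain r where "\<forall>e\<in>E. T e = r e *\<^sub>R e"
    using eig by metis
  ultimately show ?thesis using E' by blast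
qed

section \<open>Hilbert-Schmidt sums\<close>

text \<open>Finite partial sums have squared norm equal to the sum of the squared coefficients, so
  the convergence of Bessel's sum makes them a Cauchy net. The family may be uncountable, hence the
  filter of finite subsets.\<close>

lemma orthonormal_expansion_summable:
  fixes x :: "'a::complex_hilbert"
  assumes B: "orthonormal B"
  shows "(\<lambda>e. cinner e x *\<^sub>C e) summable_on B"
proof -
  define g where "g e = (cmod (cinner e x))\<^sup>2" for e
  define f where "f e = cinner e x *\<^sub>C e" for e
  have fin: "sum g F \<le> (norm x)\<^sup>2" if "finite F" "F \<subseteq> B" for F
    unfolding g_def using bessel[OF that(1) orthonormal_subset[OF B that(2)]] .
  have g: "g summable_on B"
    by (rule nonneg_bdd_above_summable_on) (use fin in \<open>auto simp: g_def intro!: bdd_aboveI[of _ "(norm x)\<^sup>2"]\<close>)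
  define L where "L = infsum g B"
  have sumf: "(norm (sum f F))\<^sup>2 = sum g F" if "finite F" "F \<subseteq> B" for F
    using norm_proj_sq[OF that(1) orthonormal_subset[OF B that(2)], of x]
    by (simp add: proj_apply f_def g_def)
  have "\<forall>e>0. \<exists>P. eventually P (finite_subsets_at_top B) \<and> (\<forall>F G. P F \<and> P G \<longrightarrow> dist (sum f F) (sum f G) < e)"
  proof (intro allI impI)
    fix e :: real assume e: "e > 0"
    define P where "P F \<longleftrightarrow> finite F \<and> F \<subseteq> B \<and> dist (sum g F) L < (e/3)\<^sup>2" for F
    have "eventually P (finite_subsets_at_top B)"
      unfolding P_def
      using tendstoD[OF infsum_tendsto[OF g], of "(e/3)\<^sup>2"] e
      by (auto simp: L_def eventually_conj_iff eventually_finite_subsets_at_top_weakI)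
    moreover have "dist (sum f F) (sum f G) < e" if FG: "P F" "P G" for F G
    proof -
      have FGB: "finite (F \<union> G)" "F \<union> G \<subseteq> B" using FG by (auto simp: P_def)
      \<comment> \<open>Two index sets are compared through their union, where the difference is
        again an orthonormal sum.\<close>
      have near: "norm (sum f (F \<union> G) - sum f H) < e/3" if H: "P H" "H \<subseteq> F \<union> G" for H
      proof -
        have "sum f (F \<union> G) - sum f H = sum f ((F \<union> G) - H)"
          using FGB H by (simp add: sum_diff)
        then have "(norm (sum f (F \<union> G) - sum f H))\<^sup>2 = sum g ((F \<union> G) - H)"
          using sumf[of "(F \<union> G) - H"] FGB by auto
        also have "\<dots> = sum g (F \<union> G) - sum g H"
          using FGB H by (simp add: sum_diff)
        also have "\<dots> \<le> L - sum g H"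
          unfolding L_def using FGB by (intro diff_right_mono finite_sum_le_infsum g) (auto simp: g_def)
        also have "\<dots> < (e/3)\<^sup>2"
          using H by (auto simp: P_def dist_real_def)
        finally show ?thesis
          using e by (meson divide_pos_pos less_imp_le power_less_imp_less_base zero_less_numeral)
      qed
      have "dist (sum f F) (sum f G) \<le> norm (sum f (F \<union> G) - sum f F) + norm (sum f (F \<union> G) - sum f G)"
        by (metis dist_norm dist_triangle3)
      then show ?thesis
        using near[of F] near[of G] FG e by fastforce
    qed
    ultimately show "\<exists>P. eventually P (finite_subsets_at_top B) \<and> (\<forall>F G. P F \<and> P G \<longrightarrow> dist (sum f F) (sum f G) < e)"
      by blast
  qed
  then have "cauchy_filter (filtermap (sum f) (finite_subsets_at_top B))"
    by (simp add: cauchy_filter_metric_filtermap)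
  moreover have "complete (UNIV::'a set)"
    by (meson Cauchy_convergent UNIV_I complete_def convergent_def)
  ultimately obtain s where "(sum f \<longlongrightarrow> s) (finite_subsets_at_top B)"
    using complete_uniform[where S=UNIV] by (force simp add: filterlim_def)
  then show ?thesis
    unfolding f_def using summable_on_def has_sum_def by blast
qed

text \<open>The limit of the expansion differs from x by a vector orthogonal to all of B, which is 0
  by the totality in \<open>is_onb\<close>.\<close>

lemma onb_has_sum:
  fixes x :: "'a::complex_hilbert"
  assumes B: "is_onb B"
  shows "((\<lambda>e. cinner e x *\<^sub>C e) has_sum x) B"
proof -
  note o = is_onb_orthonormal[OF B]
  from orthonormal_expansion_summable[OF o] obtain s where s: "((\<lambda>e. cinner e x *\<^sub>C e) has_sum s) B"
    unfolding summable_on_def by blast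
  have "cinner e (s - x) = 0" if e: "e \<in> B" for e
  proof -
    have "((\<lambda>e'. cinner e (cinner e' x *\<^sub>C e')) has_sum cinner e s) B"
      by (rule has_sum_bounded_linear[OF cinner.bounded_linear_right s])
    moreover have "((\<lambda>e'. cinner e (cinner e' x *\<^sub>C e')) has_sum cinner e x) B \<longleftrightarrow>
        ((\<lambda>e'. cinner e' x) has_sum cinner e x) {e}"
      by (rule has_sum_cong_neutral)
        (use o e in \<open>auto simp: orthonormal_def cinner_scaleC_right\<close>)
    moreover have "((\<lambda>e'. cinner e' x) has_sum cinner e x) {e}"
      using has_sum_finite[of "{e}" "\<lambda>e'. cinner e' x"] by simp
    ultimately show ?thesis
      using has_sum_unique by (fastforce simp: cinner.diff_right)
  qed
  then have "s = x"
    using B unfolding is_onb_def by (metis eq_iff_diff_eq_0)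
  with s show ?thesis by simp
qed

lemma proj_tendsto:
  assumes "is_onb B"
  shows "((\<lambda>F. proj F x) \<longlongrightarrow> x) (finite_subsets_at_top B)"
  using onb_has_sum[OF assms, of x] unfolding has_sum_def proj_apply .

lemma parseval:
  assumes "is_onb B"
  shows "((\<lambda>e. (cmod (cinner e x))\<^sup>2) has_sum (norm x)\<^sup>2) B"
proof -
  have "Re (cinner x (cinner e x *\<^sub>C e)) = (cmod (cinner e x))\<^sup>2" for e
    by (simp add: cinner_scaleC_right cnj_cinner[of e x, symmetric] flip: complex_norm_square)
  then show ?thesis
    using has_sum_bounded_linear[OF bounded_linear_compose[OF bounded_linear_Re cinner.bounded_linear_right] onb_has_sum[OF assms], of x x]
    by (simp add: norm_sq_eq_Re_cinner)
qed

lemma has_sum_sum: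
  fixes f :: "'i \<Rightarrow> 'e \<Rightarrow> 'b::topological_comm_monoid_add"
  assumes "\<And>i. i \<in> I \<Longrightarrow> (f i has_sum s i) A"
  shows "((\<lambda>e. \<Sum>i\<in>I. f i e) has_sum (\<Sum>i\<in>I. s i)) A"
  using assms by (induction I rule: infinite_finite_induct) (auto intro!: has_sum_add)

lemma has_sum_diff:
  fixes f g :: "'i \<Rightarrow> 'b::real_normed_vector"
  assumes "(f has_sum a) A" "(g has_sum b) A"
  shows "((\<lambda>x. f x - g x) has_sum (a - b)) A"
  using has_sum_add[OF assms(1) has_sum_bounded_linear[OF bounded_linear_minus[OF bounded_linear_ident] assms(2)]] by simp

text \<open>Parseval in B for each S' g, exchange of sums, and Bessel in G for each S e. Plain
  functions with an adjoint relation suffice, so composites can be inserted without forming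
  operators.\<close>

lemma hilbert_schmidt_finite_le:
  fixes S S' :: "'a::complex_hilbert \<Rightarrow> 'a"
  assumes adj: "\<And>x y. cinner (S x) y = cinner x (S' y)" and B: "is_onb B"
    and S: "(\<lambda>e. (norm (S e))\<^sup>2) summable_on B" and G: "finite G" "orthonormal G"
  shows "(\<Sum>g\<in>G. (norm (S' g))\<^sup>2) \<le> (\<Sum>\<^sub>\<infinity>e\<in>B. (norm (S e))\<^sup>2)"
proof -
  have "((\<lambda>e. \<Sum>g\<in>G. (cmod (cinner e (S' g)))\<^sup>2) has_sum (\<Sum>g\<in>G. (norm (S' g))\<^sup>2)) B"
    by (intro has_sum_sum parseval[OF B])
  then show ?thesis
  proof (rule has_sum_mono[OF _ has_sum_infsum[OF S]])
    fix e assume "e \<in> B"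
    have "(\<Sum>g\<in>G. (cmod (cinner e (S' g)))\<^sup>2) = (\<Sum>g\<in>G. (cmod (cinner g (S e)))\<^sup>2)"
      by (intro sum.cong refl) (metis adj cnj_cinner complex_mod_cnj)
    also have "\<dots> \<le> (norm (S e))\<^sup>2" by (rule bessel[OF G])
    finally show "(\<Sum>g\<in>G. (cmod (cinner e (S' g)))\<^sup>2) \<le> (norm (S e))\<^sup>2" .
  qed
qed

text \<open>The finite estimate in both directions. It is the vehicle for changing the basis and for
  cyclic permutations under the trace.\<close>

lemma hilbert_schmidt_adjoint:
  fixes S S' :: "'a::complex_hilbert \<Rightarrow> 'a"
  assumes adj: "\<And>x y. cinner (S x) y = cinner x (S' y)" and B: "is_onb B" and B': "is_onb B'"
    and S: "(\<lambda>e. (norm (S e))\<^sup>2) summable_on B"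
  shows "(\<lambda>e. (norm (S' e))\<^sup>2) summable_on B'"
    and "(\<Sum>\<^sub>\<infinity>e\<in>B'. (norm (S' e))\<^sup>2) = (\<Sum>\<^sub>\<infinity>e\<in>B. (norm (S e))\<^sup>2)"
proof -
  have fin: "(\<Sum>g\<in>G. (norm (S' g))\<^sup>2) \<le> (\<Sum>\<^sub>\<infinity>e\<in>B. (norm (S e))\<^sup>2)" if "finite G" "G \<subseteq> B'" for G
    using hilbert_schmidt_finite_le[OF adj B S that(1)] orthonormal_subset[OF is_onb_orthonormal[OF B'] that(2)] .
  show S': "(\<lambda>e. (norm (S' e))\<^sup>2) summable_on B'"
    by (rule nonneg_bdd_above_summable_on)
      (use fin in \<open>auto intro!: bdd_aboveI[of _ "\<Sum>\<^sub>\<infinity>e\<in>B. (norm (S e))\<^sup>2"]\<close>)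
  have adj': "cinner (S' x) y = cinner x (S y)" for x y
    by (metis adj cnj_cinner)
  have "(\<Sum>g\<in>G. (norm (S g))\<^sup>2) \<le> (\<Sum>\<^sub>\<infinity>e\<in>B'. (norm (S' e))\<^sup>2)" if "finite G" "G \<subseteq> B" for G
    using hilbert_schmidt_finite_le[OF adj' B' S' that(1)] orthonormal_subset[OF is_onb_orthonormal[OF B] that(2)] .
  with fin show "(\<Sum>\<^sub>\<infinity>e\<in>B'. (norm (S' e))\<^sup>2) = (\<Sum>\<^sub>\<infinity>e\<in>B. (norm (S e))\<^sup>2)"
    by (intro antisym infsum_le_finite_sums S S') auto
qed

text \<open>In trace notation Tr S' T = Tr T S'. By polarisation each side is a combination of four
  squared Hilbert-Schmidt norms, and each norm agrees with that of the adjoint.\<close>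

lemma hilbert_schmidt_pairing:
  fixes S S' T T' :: "'a::complex_hilbert \<Rightarrow> 'a"
  assumes S: "\<And>x y. cinner (S x) y = cinner x (S' y)" and T: "\<And>x y. cinner (T x) y = cinner x (T' y)"
    and B: "is_onb B"
    and sS: "(\<lambda>e. (norm (S e))\<^sup>2) summable_on B" and sT: "(\<lambda>e. (norm (T e))\<^sup>2) summable_on B"
  shows "\<exists>s. ((\<lambda>e. cinner (S e) (T e)) has_sum s) B \<and> ((\<lambda>e. cinner (T' e) (S' e)) has_sum s) B"
proof -
  have *: "\<exists>r. ((\<lambda>e. (norm (c *\<^sub>C S e + d *\<^sub>C T e))\<^sup>2) has_sum r) B \<and>
      ((\<lambda>e. (norm (cnj c *\<^sub>C S' e + cnj d *\<^sub>C T' e))\<^sup>2) has_sum r) B" for c d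
  proof -
    define R where "R x = c *\<^sub>C S x + d *\<^sub>C T x" for x
    define R' where "R' x = cnj c *\<^sub>C S' x + cnj d *\<^sub>C T' x" for x
    have adj: "cinner (R x) y = cinner x (R' y)" for x y
      by (simp add: R_def R'_def cinner.add_left cinner.add_right cinner_scaleC_left cinner_scaleC_right S T)
    have sm: "(\<lambda>e. (norm (R e))\<^sup>2) summable_on B"
    proof (rule summable_on_comparison_test)
      show "(\<lambda>e. 2 * (cmod c)\<^sup>2 * (norm (S e))\<^sup>2 + 2 * (cmod d)\<^sup>2 * (norm (T e))\<^sup>2) summable_on B"
        by (intro summable_on_add summable_on_cmult_right sS sT)
      fix e
      have "(norm (R e))\<^sup>2 \<le> 2 * (norm (c *\<^sub>C S e))\<^sup>2 + 2 * (norm (d *\<^sub>C T e))\<^sup>2"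
        unfolding R_def using norm_plus_sq[of "c *\<^sub>C S e" "d *\<^sub>C T e"] norm_minus_sq[of "c *\<^sub>C S e" "d *\<^sub>C T e"]
          zero_le_power2[of "norm (c *\<^sub>C S e - d *\<^sub>C T e)"] by linarith
      then show "(norm (R e))\<^sup>2 \<le> 2 * (cmod c)\<^sup>2 * (norm (S e))\<^sup>2 + 2 * (cmod d)\<^sup>2 * (norm (T e))\<^sup>2"
        by (simp add: norm_scaleC power_mult_distrib mult.assoc)
    qed simp
    have "(\<lambda>e. (norm (R' e))\<^sup>2) summable_on B" "(\<Sum>\<^sub>\<infinity>e\<in>B. (norm (R' e))\<^sup>2) = (\<Sum>\<^sub>\<infinity>e\<in>B. (norm (R e))\<^sup>2)"
      using hilbert_schmidt_adjoint[OF adj B B sm] by auto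
    from has_sum_infsum[OF this(1)] this(2) has_sum_infsum[OF sm]
    show ?thesis
      unfolding R_def R'_def by (intro exI conjI) auto
  qed
  obtain r1 where r1: "((\<lambda>e. (norm (S e + T e))\<^sup>2) has_sum r1) B" "((\<lambda>e. (norm (T' e + S' e))\<^sup>2) has_sum r1) B"
    using *[of 1 1] by (auto simp: add.commute)
  obtain r2 where r2: "((\<lambda>e. (norm (S e - T e))\<^sup>2) has_sum r2) B" "((\<lambda>e. (norm (T' e - S' e))\<^sup>2) has_sum r2) B"
    using *[of 1 "-1"] by (auto simp: scaleC.minus_left norm_minus_commute)
  \<comment> \<open>The adjoint of i S + T is -i S' + T'; multiplying by the unimodular i brings it
    to the form that polarisation of the pair T', S' requires.\<close>
  have i: "norm (- \<i> *\<^sub>C u + c *\<^sub>C v) = norm (\<i> *\<^sub>C c *\<^sub>C v + u)" for c and u v :: 'a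
  proof -
    have "\<i> *\<^sub>C (- \<i> *\<^sub>C u + c *\<^sub>C v) = \<i> *\<^sub>C c *\<^sub>C v + u"
      by (simp add: scaleC_add_right scaleC_scaleC add.commute)
    then show ?thesis by (metis mult_1 norm_ii norm_scaleC)
  qed
  obtain r3 where r3: "((\<lambda>e. (norm (\<i> *\<^sub>C S e + T e))\<^sup>2) has_sum r3) B" "((\<lambda>e. (norm (\<i> *\<^sub>C T' e + S' e))\<^sup>2) has_sum r3) B"
    using *[of \<i> 1] i[of _ 1] by auto
  obtain r4 where r4: "((\<lambda>e. (norm (\<i> *\<^sub>C S e - T e))\<^sup>2) has_sum r4) B" "((\<lambda>e. (norm (\<i> *\<^sub>C T' e - S' e))\<^sup>2) has_sum r4) B"
  proof -
    have "norm (- \<i> *\<^sub>C u - v) = norm (\<i> *\<^sub>C v - u)" for u v :: 'a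
      using i[of u "-1" v] norm_minus_cancel[of "\<i> *\<^sub>C v - u"] by (simp add: scaleC.minus_left scaleC.minus_right)
    then show thesis using *[of \<i> "-1"] that by (auto simp: scaleC.minus_left)
  qed
  define s where "s = (complex_of_real (r1 - r2) + \<i> * complex_of_real (r3 - r4)) / 4"
  have "((\<lambda>e. cinner (S e) (T e)) has_sum s) B"
  proof -
    have "((\<lambda>e. (complex_of_real ((norm (S e + T e))\<^sup>2 - (norm (S e - T e))\<^sup>2) + \<i> * complex_of_real ((norm (\<i> *\<^sub>C S e + T e))\<^sup>2 - (norm (\<i> *\<^sub>C S e - T e))\<^sup>2)) / 4) has_sum s) B"
      unfolding s_def divide_inverse
      by (intro has_sum_cmult_left has_sum_add has_sum_cmult_right has_sum_of_real has_sum_diff r1 r2 r3 r4)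
    then show ?thesis unfolding polarization[symmetric] by simp
  qed
  moreover have "((\<lambda>e. cinner (T' e) (S' e)) has_sum s) B"
  proof -
    have "((\<lambda>e. (complex_of_real ((norm (T' e + S' e))\<^sup>2 - (norm (T' e - S' e))\<^sup>2) + \<i> * complex_of_real ((norm (\<i> *\<^sub>C T' e + S' e))\<^sup>2 - (norm (\<i> *\<^sub>C T' e - S' e))\<^sup>2)) / 4) has_sum s) B"
      unfolding s_def divide_inverse
      by (intro has_sum_cmult_left has_sum_add has_sum_cmult_right has_sum_of_real has_sum_diff r1 r2 r3 r4)
    then show ?thesis unfolding polarization[symmetric] by simp
  qed
  ultimately show ?thesis by blast
qed

section \<open>The inequality on a finite-dimensional subspace\<close>

lemma continuous_on_powr_ge_1: "continuous_on {1..M} (\<lambda>t::real. t powr a)"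
  by (intro continuous_intros) auto

lemma continuous_on_sqrt_powr: "continuous_on {1..M} (\<lambda>t::real. sqrt (t powr a - 1))"
  by (intro continuous_intros continuous_on_powr_ge_1) auto

lemma op_fun_powr_powr:
  assumes T: "op_between 1 M T"
  shows "op_fun (\<lambda>t. t powr a) T (op_fun (\<lambda>t. t powr b) T v) = op_fun (\<lambda>t. t powr (a + b)) T v"
  using op_fun_mult[OF T continuous_on_powr_ge_1 continuous_on_powr_ge_1, of a b]
  by (simp flip: powr_add)

lemma op_fun_powr_one: "op_between 1 M T \<Longrightarrow> op_fun (\<lambda>t. t powr 1) T = T"
  by (subst op_fun_cong[where g="\<lambda>t. t"]) (auto simp: op_fun_ident)

lemma op_fun_powr_zero: "op_between 1 M T \<Longrightarrow> op_fun (\<lambda>t. t powr 0) T = id_blinfun"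
  by (subst op_fun_cong[where g="\<lambda>t. 1"]) (auto simp: op_fun_const)

lemma op_fun_sqrt_minus_one:
  assumes Z: "op_between 1 M Z"
  shows "herm (op_fun (\<lambda>t. sqrt (t - 1)) Z)"
    and "op_fun (\<lambda>t. sqrt (t - 1)) Z (op_fun (\<lambda>t. sqrt (t - 1)) Z v) = Z v - v"
proof -
  have c: "continuous_on {1..M} (\<lambda>t. sqrt (t - 1))" by (intro continuous_intros)
  show "herm (op_fun (\<lambda>t. sqrt (t - 1)) Z)" by (rule herm_op_fun[OF Z c])
  have "op_fun (\<lambda>t. sqrt (t - 1)) Z o\<^sub>L op_fun (\<lambda>t. sqrt (t - 1)) Z = op_fun (\<lambda>t. t - 1) Z"
    unfolding op_fun_mult[OF Z c c, symmetric] by (rule op_fun_cong[OF Z]) simp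
  also have "\<dots> = Z - id_blinfun"
    using op_fun_diff[OF Z continuous_on_id continuous_on_const[of _ "1::real"]]
    by (simp add: op_fun_ident[OF Z] op_fun_const[OF Z])
  finally show "op_fun (\<lambda>t. sqrt (t - 1)) Z (op_fun (\<lambda>t. sqrt (t - 1)) Z v) = Z v - v"
    by (metis blinfun_apply_blinfun_compose blinfun.diff_left blinfun_apply_id_blinfun)
qed

definition eigenbasis :: "'a::complex_hilbert set \<Rightarrow> ('a \<Rightarrow>\<^sub>L 'a) \<Rightarrow> 'a set \<Rightarrow> ('a \<Rightarrow> real) \<Rightarrow> bool" where
  "eigenbasis F T E r \<longleftrightarrow> finite E \<and> orthonormal E \<and> proj E = proj F \<and> (\<forall>e\<in>E. T e = r e *\<^sub>R e)"

lemma eigenbasisD: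
  assumes "eigenbasis F T E r"
  shows "finite E" "orthonormal E" "proj E = proj F" "e \<in> E \<Longrightarrow> blinfun_apply T e = r e *\<^sub>R e"
    "e \<in> E \<Longrightarrow> e \<noteq> 0" "e \<in> E \<Longrightarrow> proj F e = e" "e \<in> E \<Longrightarrow> cinner e e = 1"
  using assms norm_orthonormal[of E e] in_proj_range[of E e]
  by (auto simp: eigenbasis_def orthonormal_def cinner_self)

lemma eigenvalue_between:
  assumes "eigenbasis F T E r" "op_between m M T" "e \<in> E"
  shows "m \<le> r e" "r e \<le> M"
  using op_betweenD(2,3)[OF assms(2), of e] eigenbasisD(4,7)[OF assms(1,3)]
    norm_orthonormal[OF eigenbasisD(2)[OF assms(1)] assms(3)]
  by (simp_all add: cinner_scaleR_right)

lemma op_fun_eigenbasis: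
  assumes E: "eigenbasis F T E r" and T: "op_between m M T" and f: "continuous_on {m..M} f" and e: "e \<in> E"
  shows "op_fun f T e = f (r e) *\<^sub>R e"
  using op_fun_eigenvector[OF T f] eigenbasisD(4,5)[OF E e] by blast

lemma quadratic_form_eigenbasis:
  assumes E: "eigenbasis F T E r" and T: "op_between m M T" and f: "continuous_on {m..M} f"
    and v: "proj F v = v"
  shows "Re (cinner v (op_fun f T v)) = (\<Sum>e\<in>E. f (r e) * (cmod (cinner e v))\<^sup>2)"
proof -
  have "op_fun f T v = op_fun f T (proj E v)"
    using v eigenbasisD(3)[OF E] by simp
  also have "\<dots> = (\<Sum>e\<in>E. cinner e v *\<^sub>C f (r e) *\<^sub>R e)"
    by (simp add: proj_apply blinfun.sum_right herm_scaleC[OF herm_op_fun[OF T f]]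
        op_fun_eigenbasis[OF E T f] cong: sum.cong)
  finally have "Re (cinner v (op_fun f T v)) = (\<Sum>e\<in>E. Re (cinner e v * (f (r e) *\<^sub>R cinner v e)))"
    by (simp add: cinner.sum_right cinner_scaleC_right cinner_scaleR_right)
  also have "\<dots> = (\<Sum>e\<in>E. f (r e) * (cmod (cinner e v))\<^sup>2)"
  proof (rule sum.cong)
    fix e assume "e \<in> E"
    have "cinner e v * (f (r e) *\<^sub>R cinner v e) = complex_of_real (f (r e)) * (cinner e v * cnj (cinner e v))"
      by (simp add: cnj_cinner scaleR_conv_of_real mult_ac)
    also have "\<dots> = complex_of_real (f (r e) * (cmod (cinner e v))\<^sup>2)"
      by (simp only: complex_norm_square[symmetric] of_real_mult)
    finally show "Re (cinner e v * (f (r e) *\<^sub>R cinner v e)) = f (r e) * (cmod (cinner e v))\<^sup>2"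
      by (simp only: Re_complex_of_real)
  qed simp
  finally show ?thesis .
qed

lemma orthonormal_combination:
  fixes c :: "'a::complex_hilbert \<Rightarrow> complex"
  assumes E: "finite E" "orthonormal E"
  defines "w \<equiv> \<Sum>e\<in>E. c e *\<^sub>C e"
  shows "e \<in> E \<Longrightarrow> cinner e w = c e" "proj E w = w" "(norm w)\<^sup>2 = (\<Sum>e\<in>E. (cmod (c e))\<^sup>2)"
proof -
  show *: "cinner e w = c e" if "e \<in> E" for e
  proof -
    have "cinner e w = (\<Sum>e'\<in>E. if e' = e then c e else 0)"
      unfolding w_def cinner.sum_right
      by (rule sum.cong) (use E that in \<open>auto simp: orthonormal_def cinner_scaleC_right\<close>)
    then show ?thesis using E that by simp
  qed
  show "proj E w = w"
  proof -
    have "(\<Sum>e\<in>E. cinner e w *\<^sub>C e) = (\<Sum>e\<in>E. c e *\<^sub>C e)"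
      by (rule sum.cong) (simp_all add: *)
    then show ?thesis by (simp only: proj_apply w_def)
  qed
  then show "(norm w)\<^sup>2 = (\<Sum>e\<in>E. (cmod (c e))\<^sup>2)"
    using norm_proj_sq[OF E, of w] by (simp add: * cong: sum.cong)
qed

lemma norm_sq_eigenbasis:
  assumes "eigenbasis F T E r" "proj F v = v"
  shows "(\<Sum>e\<in>E. (cmod (cinner e v))\<^sup>2) = (norm v)\<^sup>2"
  using norm_proj_sq[OF eigenbasisD(1,2)[OF assms(1)], of v] eigenbasisD(3)[OF assms(1)] assms(2) by simp

lemma quadratic_form_eigenbasis_id:
  assumes E: "eigenbasis F T E r" and T: "op_between m M T" and v: "proj F v = v"
  shows "Re (cinner v (T v)) = (\<Sum>e\<in>E. r e * (cmod (cinner e v))\<^sup>2)"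
  using quadratic_form_eigenbasis[OF E T continuous_on_id v] op_fun_ident[OF T] by simp

text \<open>Interpolation for the change of coordinates from E1 to E2: with exponent 0 it is
  isometric, with exponent 1 the estimate is the hypothesis Y \<le> X, both tested on arbitrary
  vectors w.\<close>

lemma loewner_heinz_finite:
  fixes X Y :: "'a::complex_hilbert \<Rightarrow>\<^sub>L 'a"
  assumes E1: "eigenbasis F X E1 x" and E2: "eigenbasis F Y E2 y"
    and X: "op_between 1 M X" and Y: "op_between 1 M Y"
    and le: "\<And>v. Re (cinner v (Y v)) \<le> Re (cinner v (X v))"
    and s: "0 \<le> s" "s \<le> 1" and v: "proj F v = v"
  shows "Re (cinner v (op_fun (\<lambda>t. t powr s) Y v)) \<le> Re (cinner v (op_fun (\<lambda>t. t powr s) X v))"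
proof -
  have x: "x e \<ge> 1" if "e \<in> E1" for e using eigenvalue_between[OF E1 X that] by simp
  have y: "y e \<ge> 1" if "e \<in> E2" for e using eigenvalue_between[OF E2 Y that] by simp
  have pX: "proj E1 = proj F" using eigenbasisD(3)[OF E1] .
  have comb: "(\<Sum>e\<in>E1. cinner g e * c e) = cinner g (\<Sum>e\<in>E1. c e *\<^sub>C e)" for g c
    by (simp add: cinner.sum_right cinner_scaleC_right mult.commute)
  have "(\<Sum>g\<in>E2. 1 powr (1 - s) * y g powr s * (cmod (\<Sum>e\<in>E1. cinner g e * cinner e v))\<^sup>2)
      \<le> (\<Sum>e\<in>E1. 1 powr (1 - s) * x e powr s * (cmod (cinner e v))\<^sup>2)"
  proof (rule weighted_l2_interpolation[OF eigenbasisD(1)[OF E2] eigenbasisD(1)[OF E1]])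
    fix c :: "'a \<Rightarrow> complex"
    define w where "w = (\<Sum>e\<in>E1. c e *\<^sub>C e)"
    note w = orthonormal_combination[OF eigenbasisD(1,2)[OF E1], where c=c, folded w_def]
    have w': "proj F w = w" using w(2) pX by simp
    show "(\<Sum>j\<in>E2. 1 * (cmod (\<Sum>l\<in>E1. cinner j l * c l))\<^sup>2) \<le> (\<Sum>l\<in>E1. 1 * (cmod (c l))\<^sup>2)"
      unfolding comb w_def[symmetric] mult_1 norm_sq_eigenbasis[OF E2 w'] w(3) by simp
    show "(\<Sum>j\<in>E2. y j * (cmod (\<Sum>l\<in>E1. cinner j l * c l))\<^sup>2) \<le> (\<Sum>l\<in>E1. x l * (cmod (c l))\<^sup>2)"
      unfolding comb w_def[symmetric] quadratic_form_eigenbasis_id[OF E2 Y w', symmetric]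
      using le[of w] quadratic_form_eigenbasis_id[OF E1 X w'] by (simp add: w(1) cong: sum.cong)
  qed (use x y s in \<open>auto intro: less_le_trans[of 0 1]\<close>)
  moreover have "(\<Sum>e\<in>E1. cinner g e * cinner e v) = cinner g v" for g
    using v pX by (simp add: comb flip: proj_apply)
  ultimately show ?thesis
    by (simp add: quadratic_form_eigenbasis[OF E1 X continuous_on_powr_ge_1 v]
        quadratic_form_eigenbasis[OF E2 Y continuous_on_powr_ge_1 v])
qed

text \<open>The inner sum over l is the matrix coefficient <i, c(Y) j>. Both sides equal Tr h(X)
  |c(Y)|^2: the sum over E3 disappears by Parseval.\<close>

lemma sum_weighted_left:
  fixes h :: "'a::complex_hilbert \<Rightarrow> real"
  assumes E1: "eigenbasis F X E1 x" and E2: "eigenbasis F Y E2 y" and E3: "eigenbasis F Z E3 z"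
  shows "(\<Sum>i\<in>E1. \<Sum>j\<in>E3. h i * (cmod (\<Sum>l\<in>E2. cinner i l * cinner l j * c l))\<^sup>2)
    = (\<Sum>l\<in>E2. (cmod (c l))\<^sup>2 * (\<Sum>i\<in>E1. h i * (cmod (cinner i l))\<^sup>2))"
proof -
  have 1: "(\<Sum>j\<in>E3. (cmod (\<Sum>l\<in>E2. cinner i l * cinner l j * c l))\<^sup>2) = (\<Sum>l\<in>E2. (cmod (c l))\<^sup>2 * (cmod (cinner i l))\<^sup>2)" for i
  proof -
    \<comment> \<open>q is the adjoint of c(Y) applied to i.\<close>
    define q where "q = (\<Sum>l\<in>E2. cnj (cinner i l * c l) *\<^sub>C l)"
    note q = orthonormal_combination[OF eigenbasisD(1,2)[OF E2], where c="\<lambda>l. cnj (cinner i l * c l)", folded q_def]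
    have "proj F q = q" using q(2) eigenbasisD(3)[OF E2] by simp
    have "(\<Sum>l\<in>E2. cinner i l * cinner l j * c l) = cinner q j" for j
      by (simp add: q_def cinner.sum_left cinner_scaleC_left mult_ac)
    then have "(\<Sum>j\<in>E3. (cmod (\<Sum>l\<in>E2. cinner i l * cinner l j * c l))\<^sup>2) = (\<Sum>j\<in>E3. (cmod (cinner j q))\<^sup>2)"
      by (metis cnj_cinner complex_mod_cnj)
    also have "\<dots> = (norm q)\<^sup>2"
      by (rule norm_sq_eigenbasis[OF E3 \<open>proj F q = q\<close>])
    also have "\<dots> = (\<Sum>l\<in>E2. (cmod (c l))\<^sup>2 * (cmod (cinner i l))\<^sup>2)"
      unfolding q(3) by (simp add: norm_mult power_mult_distrib mult.commute)
    finally show ?thesis .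
  qed
  have "(\<Sum>i\<in>E1. \<Sum>j\<in>E3. h i * (cmod (\<Sum>l\<in>E2. cinner i l * cinner l j * c l))\<^sup>2)
      = (\<Sum>i\<in>E1. \<Sum>l\<in>E2. (cmod (c l))\<^sup>2 * (h i * (cmod (cinner i l))\<^sup>2))"
    unfolding sum_distrib_left[symmetric] 1 by (simp add: sum_distrib_left mult_ac)
  also have "\<dots> = (\<Sum>l\<in>E2. (cmod (c l))\<^sup>2 * (\<Sum>i\<in>E1. h i * (cmod (cinner i l))\<^sup>2))"
    by (subst sum.swap) (simp add: sum_distrib_left)
  finally show ?thesis .
qed

text \<open>Conjugating the matrix coefficients interchanges E1 and E3, which reduces this to
  \<open>sum_weighted_left\<close>.\<close>

lemma sum_weighted_right:
  fixes h :: "'a::complex_hilbert \<Rightarrow> real"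
  assumes E1: "eigenbasis F X E1 x" and E2: "eigenbasis F Y E2 y" and E3: "eigenbasis F Z E3 z"
  shows "(\<Sum>i\<in>E1. \<Sum>j\<in>E3. h j * (cmod (\<Sum>l\<in>E2. cinner i l * cinner l j * c l))\<^sup>2)
    = (\<Sum>l\<in>E2. (cmod (c l))\<^sup>2 * (\<Sum>j\<in>E3. h j * (cmod (cinner j l))\<^sup>2))"
proof -
  have "(\<Sum>i\<in>E1. \<Sum>j\<in>E3. h j * (cmod (\<Sum>l\<in>E2. cinner i l * cinner l j * c l))\<^sup>2)
      = (\<Sum>j\<in>E3. \<Sum>i\<in>E1. h j * (cmod (\<Sum>l\<in>E2. cinner j l * cinner l i * cnj (c l)))\<^sup>2)"
  proof (subst sum.swap, intro sum.cong refl)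
    fix i j
    have "(\<Sum>l\<in>E2. cinner i l * cinner l j * c l) = cnj (\<Sum>l\<in>E2. cinner j l * cinner l i * cnj (c l))"
      by (simp add: cnj_cinner mult_ac)
    then show "h j * (cmod (\<Sum>l\<in>E2. cinner i l * cinner l j * c l))\<^sup>2 = h j * (cmod (\<Sum>l\<in>E2. cinner j l * cinner l i * cnj (c l)))\<^sup>2"
      by (simp only: complex_mod_cnj)
  qed
  also have "\<dots> = (\<Sum>l\<in>E2. (cmod (c l))\<^sup>2 * (\<Sum>j\<in>E3. h j * (cmod (cinner j l))\<^sup>2))"
    using sum_weighted_left[OF E3 E2 E1, of h "\<lambda>l. cnj (c l)"] by simp
  finally show ?thesis .
qed

text \<open>In trace notation: \<open>Tr X\<^sup>1\<^sup>-\<^sup>\<nu> c(Y) Z\<^sup>\<nu> c(Y)\<^sup>* \<le> Tr X |c(Y)|\<^sup>2 Y\<^sup>-\<^sup>\<nu>\<close>.\<close>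

lemma trace_interpolation:
  fixes X Y Z :: "'a::complex_hilbert \<Rightarrow>\<^sub>L 'a"
  assumes E1: "eigenbasis F X E1 x" and E2: "eigenbasis F Y E2 y" and E3: "eigenbasis F Z E3 z"
    and X: "op_between 1 M X" and Y: "op_between 1 M Y" and Z: "op_between 1 M Z"
    and YZ: "\<And>l. l \<in> E2 \<Longrightarrow> y l * Re (cinner l (Z l)) = Re (cinner l (X l))"
    and \<nu>: "0 \<le> \<nu>" "\<nu> \<le> 1"
  shows "(\<Sum>i\<in>E1. \<Sum>j\<in>E3. x i powr (1 - \<nu>) * z j powr \<nu> * (cmod (\<Sum>l\<in>E2. cinner i l * cinner l j * c l))\<^sup>2)
    \<le> (\<Sum>l\<in>E2. Re (cinner l (X l)) * y l powr - \<nu> * (cmod (c l))\<^sup>2)"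
proof -
  define \<alpha>' where "\<alpha>' l = Re (cinner l (X l))" for l
  define \<beta>' where "\<beta>' l = Re (cinner l (Z l))" for l
  have x: "x e > 0" if "e \<in> E1" for e using eigenvalue_between[OF E1 X that] by simp
  have y: "y e > 0" if "e \<in> E2" for e using eigenvalue_between[OF E2 Y that] by simp
  have z: "z e > 0" if "e \<in> E3" for e using eigenvalue_between[OF E3 Z that] by simp
  have \<alpha>\<beta>: "\<alpha>' l > 0" "\<beta>' l > 0" if "l \<in> E2" for l
    using op_betweenD(2)[OF X, of l] op_betweenD(2)[OF Z, of l]
      norm_orthonormal[OF eigenbasisD(2)[OF E2] that] by (auto simp: \<alpha>'_def \<beta>'_def)
  have fin: "finite E1" "finite E2" "finite E3"
    using eigenbasisD(1) E1 E2 E3 by blast+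
  have \<alpha>'_eq: "\<alpha>' l = (\<Sum>i\<in>E1. x i * (cmod (cinner i l))\<^sup>2)" if "l \<in> E2" for l
    unfolding \<alpha>'_def by (rule quadratic_form_eigenbasis_id[OF E1 X eigenbasisD(6)[OF E2 that]])
  have \<beta>'_eq: "\<beta>' l = (\<Sum>j\<in>E3. z j * (cmod (cinner j l))\<^sup>2)" if "l \<in> E2" for l
    unfolding \<beta>'_def by (rule quadratic_form_eigenbasis_id[OF E3 Z eigenbasisD(6)[OF E2 that]])
  \<comment> \<open>The linear map sends c to all coefficients <i, c(Y) j>. At the endpoints the
    weights are x alone or z alone, one basis is summed out, and the diagonals of X and Z in the
    basis E2 appear with equality.\<close>
  have "(\<Sum>p\<in>E1 \<times> E3. x (fst p) powr (1 - \<nu>) * z (snd p) powr \<nu> * (cmod (\<Sum>l\<in>E2. cinner (fst p) l * cinner l (snd p) * c l))\<^sup>2)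
      \<le> (\<Sum>l\<in>E2. \<alpha>' l powr (1 - \<nu>) * \<beta>' l powr \<nu> * (cmod (c l))\<^sup>2)"
  proof (rule weighted_l2_interpolation)
    fix c :: "'a \<Rightarrow> complex"
    show "(\<Sum>p\<in>E1 \<times> E3. x (fst p) * (cmod (\<Sum>l\<in>E2. cinner (fst p) l * cinner l (snd p) * c l))\<^sup>2) \<le> (\<Sum>l\<in>E2. \<alpha>' l * (cmod (c l))\<^sup>2)"
      using sum_weighted_left[OF E1 E2 E3, of x c] fin
      by (simp add: sum.cartesian_product' \<alpha>'_eq mult.commute cong: sum.cong)
    show "(\<Sum>p\<in>E1 \<times> E3. z (snd p) * (cmod (\<Sum>l\<in>E2. cinner (fst p) l * cinner l (snd p) * c l))\<^sup>2) \<le> (\<Sum>l\<in>E2. \<beta>' l * (cmod (c l))\<^sup>2)"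
      using sum_weighted_right[OF E1 E2 E3, of z c] fin
      by (simp add: sum.cartesian_product' \<beta>'_eq mult.commute cong: sum.cong)
  qed (use x z \<alpha>\<beta> fin \<nu> in auto)
  also have "(\<Sum>l\<in>E2. \<alpha>' l powr (1 - \<nu>) * \<beta>' l powr \<nu> * (cmod (c l))\<^sup>2) = (\<Sum>l\<in>E2. Re (cinner l (X l)) * y l powr - \<nu> * (cmod (c l))\<^sup>2)"
  proof (rule sum.cong)
    fix l assume l: "l \<in> E2"
    \<comment> \<open>Proportionality of the two diagonals collapses their weighted geometric mean
      to the diagonal of X times y^(-\<nu>).\<close>
    have "\<alpha>' l = y l * \<beta>' l" using YZ[OF l] by (simp add: \<alpha>'_def \<beta>'_def)
    then have b: "\<beta>' l = \<alpha>' l / y l" using y[OF l] by (simp add: field_simps)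
    have "\<alpha>' l powr (1 - \<nu>) * \<beta>' l powr \<nu> = \<alpha>' l powr (1 - \<nu>) * \<alpha>' l powr \<nu> * y l powr - \<nu>"
      unfolding b using y[OF l] \<alpha>\<beta>[OF l] by (simp add: powr_divide powr_minus_divide)
    also have "\<dots> = \<alpha>' l * y l powr - \<nu>"
      using \<alpha>\<beta>[OF l] by (simp flip: powr_add)
    finally show "\<alpha>' l powr (1 - \<nu>) * \<beta>' l powr \<nu> * (cmod (c l))\<^sup>2 = Re (cinner l (X l)) * y l powr - \<nu> * (cmod (c l))\<^sup>2"
      by (simp add: \<alpha>'_def)
  qed simp
  finally show ?thesis
    using fin by (simp add: sum.cartesian_product')
qed

lemma trace_eigenbasis:
  assumes F: "finite F" "orthonormal F" and E: "eigenbasis F T E r" and S: "herm S"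
  shows "(\<Sum>f\<in>F. Re (cinner f (blinfun_apply S f))) = (\<Sum>e\<in>E. Re (cinner e (S e)))"
  using arg_cong[OF trace_eigenbasis_eq[OF eigenbasisD(1,2)[OF E] F eigenbasisD(3)[OF E] herm_complex_linear[OF S]], of Re]
  by simp

text \<open>Since R A' R = Y, this says Tr X^(1-\<nu>) (Z^\<nu> + Y^\<nu> - I) \<le> Tr X with Tr Y
  subtracted on both sides, the form in which the limit can be taken.\<close>

lemma finite_trace_inequality:
  fixes X Y Z :: "'a::complex_hilbert \<Rightarrow>\<^sub>L 'a"
  assumes F: "finite F" "orthonormal F"
    and X: "op_between 1 M X" and Y: "op_between 1 M Y" and Z: "op_between 1 M Z"
    and inv: "\<And>v. proj F (X (proj F v)) = X (proj F v)" "\<And>v. proj F (Y (proj F v)) = Y (proj F v)"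
      "\<And>v. proj F (Z (proj F v)) = Z (proj F v)"
    and XYZ: "X = op_fun (\<lambda>t. t powr (1/2)) Y o\<^sub>L Z o\<^sub>L op_fun (\<lambda>t. t powr (1/2)) Y"
    and \<nu>: "0 < \<nu>" "\<nu> \<le> 1"
  defines "A \<equiv> op_fun (\<lambda>t. t powr (1 - \<nu>)) X" and "A' \<equiv> op_fun (\<lambda>t. t powr (1 - \<nu>)) Y"
    and "R \<equiv> op_fun (\<lambda>t. t powr (\<nu>/2)) Y" and "S \<equiv> op_fun (\<lambda>t. sqrt (t powr \<nu> - 1)) Z"
  shows "(\<Sum>f\<in>F. Re (cinner (R f) (A (R f))) - Re (cinner (R f) (A' (R f))) + Re (cinner (S f) (A (S f))))
      \<le> (\<Sum>f\<in>F. Re (cinner f (X f)) - Re (cinner f (Y f)))"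
proof -
  have hX: "herm X" "herm Y" "herm Z" using X Y Z by (auto simp: op_between_def)
  obtain E1 x where E1: "eigenbasis F X E1 x"
    using finite_eigenbasis[OF hX(1) F inv(1)] by (auto simp: eigenbasis_def)
  obtain E2 y where E2: "eigenbasis F Y E2 y"
    using finite_eigenbasis[OF hX(2) F inv(2)] by (auto simp: eigenbasis_def)
  obtain E3 z where E3: "eigenbasis F Z E3 z"
    using finite_eigenbasis[OF hX(3) F inv(3)] by (auto simp: eigenbasis_def)
  define H where "H = op_fun (\<lambda>t. t powr (1/2)) Y"
  have hH: "herm H" unfolding H_def by (rule herm_op_fun[OF Y continuous_on_powr_ge_1])
  have hA: "herm A" unfolding A_def by (rule herm_op_fun[OF X continuous_on_powr_ge_1])
  have hR: "herm R" unfolding R_def by (rule herm_op_fun[OF Y continuous_on_powr_ge_1])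
  have hS: "herm S" unfolding S_def by (rule herm_op_fun[OF Z continuous_on_sqrt_powr])
  have Xv: "Re (cinner v (X v)) = Re (cinner (H v) (Z (H v)))" for v
    unfolding XYZ H_def[symmetric] using hermD[OF hH, of v] by simp
  have y: "y e \<ge> 1" if "e \<in> E2" for e using eigenvalue_between[OF E2 Y that] by simp
  have z: "z e \<ge> 1" if "e \<in> E3" for e using eigenvalue_between[OF E3 Z that] by simp
  have Ydiag: "y l * Re (cinner l (Z l)) = Re (cinner l (X l))" if l: "l \<in> E2" for l
  proof -
    have "H l = y l powr (1/2) *\<^sub>R l"
      unfolding H_def by (rule op_fun_eigenbasis[OF E2 Y continuous_on_powr_ge_1 l])
    then have "Re (cinner l (X l)) = y l powr (1/2) * (y l powr (1/2) * Re (cinner l (Z l)))"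
      unfolding Xv by (simp add: blinfun.scaleR_right cinner_scaleR_left cinner_scaleR_right)
    also have "\<dots> = y l * Re (cinner l (Z l))"
      using y[OF l] by (simp add: mult.assoc[symmetric] powr_add[symmetric])
    finally show ?thesis by simp
  qed
  define a where "a v = (\<Sum>i\<in>E1. x i powr (1 - \<nu>) * (cmod (cinner i v))\<^sup>2)" for v
  have a: "Re (cinner v (A v)) = a v" if "proj F v = v" for v
    unfolding A_def a_def by (rule quadratic_form_eigenbasis[OF E1 X continuous_on_powr_ge_1 that])
  have trA: "(\<Sum>f\<in>F. Re (cinner (R f) (A (R f)))) = (\<Sum>l\<in>E2. y l powr \<nu> * a l)"
  proof -
    have "(\<Sum>f\<in>F. Re (cinner (R f) (A (R f)))) = (\<Sum>l\<in>E2. Re (cinner (R l) (A (R l))))"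
      using trace_eigenbasis[OF F E2 herm_sandwich[OF hR hA]] by (simp add: hermD[OF hR])
    also have "\<dots> = (\<Sum>l\<in>E2. y l powr \<nu> * a l)"
    proof (rule sum.cong)
      fix l assume l: "l \<in> E2"
      have "R l = y l powr (\<nu>/2) *\<^sub>R l"
        unfolding R_def by (rule op_fun_eigenbasis[OF E2 Y continuous_on_powr_ge_1 l])
      then have "Re (cinner (R l) (A (R l))) = y l powr (\<nu>/2) * (y l powr (\<nu>/2) * Re (cinner l (A l)))"
        by (simp add: blinfun.scaleR_right cinner_scaleR_left cinner_scaleR_right)
      also have "\<dots> = y l powr \<nu> * a l"
        using a[OF eigenbasisD(6)[OF E2 l]] by (simp add: mult.assoc[symmetric] powr_add[symmetric])
      finally show "Re (cinner (R l) (A (R l))) = y l powr \<nu> * a l" .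
    qed simp
    finally show ?thesis .
  qed
  have trA': "(\<Sum>f\<in>F. Re (cinner (R f) (A' (R f)))) = (\<Sum>f\<in>F. Re (cinner f (Y f)))"
  proof -
    \<comment> \<open>The exponents add up to \<nu>/2 + (1 - \<nu>) + \<nu>/2 = 1.\<close>
    have "R (A' (R f)) = op_fun (\<lambda>t. t powr 1) Y f" for f
      unfolding R_def A'_def by (simp add: op_fun_powr_powr[OF Y])
    then have "R (A' (R f)) = Y f" for f
      unfolding op_fun_powr_one[OF Y] .
    then show ?thesis by (simp add: hermD[OF hR])
  qed
  have trX: "(\<Sum>f\<in>F. Re (cinner f (X f))) = (\<Sum>l\<in>E2. Re (cinner l (X l)))"
    by (rule trace_eigenbasis[OF F E2 hX(1)])
  have trS: "(\<Sum>f\<in>F. Re (cinner (S f) (A (S f)))) = (\<Sum>j\<in>E3. (z j powr \<nu> - 1) * a j)"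
  proof -
    have "(\<Sum>f\<in>F. Re (cinner (S f) (A (S f)))) = (\<Sum>j\<in>E3. Re (cinner (S j) (A (S j))))"
      using trace_eigenbasis[OF F E3 herm_sandwich[OF hS hA]] by (simp add: hermD[OF hS])
    also have "\<dots> = (\<Sum>j\<in>E3. (z j powr \<nu> - 1) * a j)"
    proof (rule sum.cong)
      fix j assume j: "j \<in> E3"
      have "S j = sqrt (z j powr \<nu> - 1) *\<^sub>R j"
        unfolding S_def by (rule op_fun_eigenbasis[OF E3 Z continuous_on_sqrt_powr j])
      then have "Re (cinner (S j) (A (S j))) = sqrt (z j powr \<nu> - 1) * (sqrt (z j powr \<nu> - 1) * Re (cinner j (A j)))"
        by (simp add: blinfun.scaleR_right cinner_scaleR_left cinner_scaleR_right)
      also have "\<dots> = (z j powr \<nu> - 1) * a j"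
        using z[OF j] \<nu> a[OF eigenbasisD(6)[OF E3 j]] by (simp add: mult.assoc[symmetric] ge_one_powr_ge_zero)
      finally show "Re (cinner (S j) (A (S j))) = (z j powr \<nu> - 1) * a j" .
    qed simp
    finally show ?thesis .
  qed
  have trip: "(\<Sum>l\<in>E2. cinner i l * cinner l j * 1) = cinner i j" if "j \<in> E3" for i j
  proof -
    have "cinner i (proj E2 j) = cinner i j"
      using eigenbasisD(6)[OF E3 that] eigenbasisD(3)[OF E2] by simp
    then show ?thesis unfolding cinner_proj_expand by (simp add: mult.commute)
  qed
  note interp = trace_interpolation[OF E1 E2 E3 X Y Z Ydiag less_imp_le[OF \<nu>(1)] \<nu>(2)]
  define T1 where "T1 = (\<Sum>i\<in>E1. \<Sum>j\<in>E3. x i powr (1 - \<nu>) * z j powr \<nu> * (cmod (cinner i j))\<^sup>2)"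
  \<comment> \<open>The second weight: b(Y) is the square root of Y^\<nu> - I.\<close>
  define b where "b l = complex_of_real (sqrt (y l powr \<nu> - 1))" for l
  define w where "w i j = (cmod (\<Sum>l\<in>E2. cinner i l * cinner l j * b l))\<^sup>2" for i j
  have b: "(cmod (b l))\<^sup>2 = y l powr \<nu> - 1" if "l \<in> E2" for l
    using y[OF that] \<nu> by (simp add: b_def ge_one_powr_ge_zero)
  \<comment> \<open>First use of the interpolation, with weight 1; \<open>trip\<close> resolves the
    identity over E2.\<close>
  have 1: "T1 \<le> (\<Sum>l\<in>E2. Re (cinner l (X l)) * y l powr - \<nu>)"
    using interp[of "\<lambda>_. 1"] by (simp only: trip T1_def cong: sum.cong) simp
  have "(\<Sum>l\<in>E2. (y l powr \<nu> - 1) * a l) = (\<Sum>l\<in>E2. (cmod (b l))\<^sup>2 * a l)"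
    by (simp add: b cong: sum.cong)
  also have "\<dots> = (\<Sum>i\<in>E1. \<Sum>j\<in>E3. x i powr (1 - \<nu>) * w i j)"
    unfolding a_def w_def by (rule sum_weighted_left[OF E1 E2 E3, symmetric])
  \<comment> \<open>Inserts the missing factor Z^\<nu> \<ge> I so that the interpolation applies a
    second time.\<close>
  also have "\<dots> \<le> (\<Sum>i\<in>E1. \<Sum>j\<in>E3. x i powr (1 - \<nu>) * z j powr \<nu> * w i j)"
  proof (intro sum_mono)
    fix i j assume "i \<in> E1" "j \<in> E3"
    have "1 \<le> z j powr \<nu>" using z[OF \<open>j \<in> E3\<close>] \<nu> by (simp add: ge_one_powr_ge_zero)
    then have "x i powr (1 - \<nu>) * 1 * w i j \<le> x i powr (1 - \<nu>) * z j powr \<nu> * w i j"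
      by (intro mult_right_mono mult_left_mono) (auto simp: w_def)
    then show "x i powr (1 - \<nu>) * w i j \<le> x i powr (1 - \<nu>) * z j powr \<nu> * w i j" by simp
  qed
  also have "\<dots> \<le> (\<Sum>l\<in>E2. Re (cinner l (X l)) * y l powr - \<nu> * (cmod (b l))\<^sup>2)"
    unfolding w_def by (rule interp)
  also have "\<dots> = (\<Sum>l\<in>E2. Re (cinner l (X l)) - Re (cinner l (X l)) * y l powr - \<nu>)"
  proof (rule sum.cong)
    fix l assume l: "l \<in> E2"
    \<comment> \<open>Produces -Tr X Y^(-\<nu>), which cancels the bound on
      \<open>T1\<close>.\<close>
    have "y l powr - \<nu> * (y l powr \<nu> - 1) = 1 - y l powr - \<nu>"
      using y[OF l] by (simp add: right_diff_distrib powr_add[symmetric])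
    then show "Re (cinner l (X l)) * y l powr - \<nu> * (cmod (b l))\<^sup>2 = Re (cinner l (X l)) - Re (cinner l (X l)) * y l powr - \<nu>"
      by (simp add: b[OF l] mult.assoc right_diff_distrib)
  qed simp
  finally have 2: "(\<Sum>l\<in>E2. y l powr \<nu> * a l) - (\<Sum>l\<in>E2. a l)
      \<le> (\<Sum>l\<in>E2. Re (cinner l (X l))) - (\<Sum>l\<in>E2. Re (cinner l (X l)) * y l powr - \<nu>)"
    by (simp add: left_diff_distrib sum_subtractf)
  have "(\<Sum>l\<in>E2. a l) = (\<Sum>i\<in>E1. \<Sum>j\<in>E3. x i powr (1 - \<nu>) * (cmod (cinner i j))\<^sup>2)"
    using sum_weighted_left[OF E1 E2 E3, of "\<lambda>i. x i powr (1 - \<nu>)" "\<lambda>_. 1"]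
    by (simp only: trip a_def cong: sum.cong) simp
  then have 3: "(\<Sum>j\<in>E3. (z j powr \<nu> - 1) * a j) = T1 - (\<Sum>l\<in>E2. a l)"
  proof -
    have "(\<Sum>j\<in>E3. (z j powr \<nu> - 1) * a j) = (\<Sum>j\<in>E3. \<Sum>i\<in>E1. x i powr (1 - \<nu>) * z j powr \<nu> * (cmod (cinner i j))\<^sup>2 - x i powr (1 - \<nu>) * (cmod (cinner i j))\<^sup>2)"
      unfolding a_def sum_distrib_left by (intro sum.cong refl) (simp add: algebra_simps)
    also have "\<dots> = T1 - (\<Sum>i\<in>E1. \<Sum>j\<in>E3. x i powr (1 - \<nu>) * (cmod (cinner i j))\<^sup>2)"
      unfolding T1_def by (subst sum.swap) (simp add: sum_subtractf)
    also have "(\<Sum>i\<in>E1. \<Sum>j\<in>E3. x i powr (1 - \<nu>) * (cmod (cinner i j))\<^sup>2) = (\<Sum>l\<in>E2. a l)"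
      using \<open>(\<Sum>l\<in>E2. a l) = _\<close> by simp
    finally show ?thesis .
  qed
  have "(\<Sum>f\<in>F. Re (cinner (R f) (A (R f))) - Re (cinner (R f) (A' (R f))) + Re (cinner (S f) (A (S f))))
    = (\<Sum>l\<in>E2. y l powr \<nu> * a l) - (\<Sum>f\<in>F. Re (cinner f (Y f))) + (T1 - (\<Sum>l\<in>E2. a l))"
    by (simp only: sum.distrib sum_subtractf trA trA' trS 3)
  also have "\<dots> \<le> (\<Sum>l\<in>E2. Re (cinner l (X l))) - (\<Sum>f\<in>F. Re (cinner f (Y f)))"
    using 1 2 by linarith
  finally show "(\<Sum>f\<in>F. Re (cinner (R f) (A (R f))) - Re (cinner (R f) (A' (R f))) + Re (cinner (S f) (A (S f))))
      \<le> (\<Sum>f\<in>F. Re (cinner f (X f)) - Re (cinner f (Y f)))"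
    by (simp add: sum_subtractf trX)
qed

section \<open>Passage to the limit along finite-rank compressions\<close>

text \<open>Bounds on compressions hold only once F is a finite subset of the basis; elsewhere the
  operator is replaced by its limit T.\<close>

lemma op_fun_strong_tendsto_eventually:
  fixes T :: "'a::complex_hilbert \<Rightarrow>\<^sub>L 'a" and S :: "'i \<Rightarrow> 'a \<Rightarrow>\<^sub>L 'a"
  assumes S: "\<forall>\<^sub>F i in F. op_between m M (S i)" and T: "op_between m M T"
    and lim: "\<And>x. ((\<lambda>i. S i x) \<longlongrightarrow> T x) F" and f: "continuous_on {m..M} f"
  shows "((\<lambda>i. op_fun f (S i) x) \<longlongrightarrow> op_fun f T x) F"
proof -
  define S' where "S' i = (if op_between m M (S i) then S i else T)" for i
  have eq: "\<forall>\<^sub>F i in F. S' i = S i"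
    using S by eventually_elim (simp add: S'_def)
  have "((\<lambda>i. S' i x) \<longlongrightarrow> T x) F" for x
    using lim[of x] by (rule Lim_transform_eventually) (use eq in eventually_elim, simp)
  then have "((\<lambda>i. op_fun f (S' i) x) \<longlongrightarrow> op_fun f T x) F"
    by (intro op_fun_strong_tendsto[OF _ T _ f]) (simp_all add: S'_def T)
  then show ?thesis
    by (rule Lim_transform_eventually) (use eq in eventually_elim, simp)
qed

lemma strong_tendsto_apply:
  fixes T :: "'a::complex_hilbert \<Rightarrow>\<^sub>L 'a" and S :: "'i \<Rightarrow> 'a \<Rightarrow>\<^sub>L 'a"
  assumes S: "\<forall>\<^sub>F i in F. norm (S i) \<le> K" and lim: "\<And>x. ((\<lambda>i. S i x) \<longlongrightarrow> T x) F"
    and u: "(u \<longlongrightarrow> v) F"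
  shows "((\<lambda>i. S i (u i)) \<longlongrightarrow> T v) F"
proof -
  have "((\<lambda>i. S i (u i - v)) \<longlongrightarrow> 0) F"
  proof (rule Lim_null_comparison)
    show "\<forall>\<^sub>F i in F. norm (S i (u i - v)) \<le> K * norm (u i - v)"
      using S by eventually_elim (rule order_trans[OF norm_blinfun mult_right_mono], auto)
    show "((\<lambda>i. K * norm (u i - v)) \<longlongrightarrow> 0) F"
      using u by (intro tendsto_mult_right_zero tendsto_norm_zero) (simp add: LIM_zero_iff)
  qed
  from tendsto_add[OF this lim[of v]] show ?thesis
    by (simp add: blinfun.diff_right)
qed

section \<open>Compressions to finite-dimensional subspaces\<close>

lemma op_between_weaken:
  fixes T :: "'a::complex_hilbert \<Rightarrow>\<^sub>L 'a"
  assumes "op_between m M T" "m' \<le> m" "M \<le> M'" shows "op_between m' M' T"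
  unfolding op_between_def
proof (intro conjI allI)
  fix x :: 'a
  have "m' * (norm x)\<^sup>2 \<le> m * (norm x)\<^sup>2" "M * (norm x)\<^sup>2 \<le> M' * (norm x)\<^sup>2"
    using assms by (auto intro: mult_right_mono)
  then show "m' * (norm x)\<^sup>2 \<le> Re (cinner x (T x))" "Re (cinner x (T x)) \<le> M' * (norm x)\<^sup>2"
    using op_betweenD(2,3)[OF assms(1), of x] by linarith+
qed (rule op_betweenD[OF assms(1)])

text \<open>The identity on the complement keeps the operator between 1 and M, where all powers are
  continuous. A plain compression would vanish there.\<close>

definition compress :: "'a::complex_hilbert set \<Rightarrow> ('a \<Rightarrow>\<^sub>L 'a) \<Rightarrow> ('a \<Rightarrow>\<^sub>L 'a)" where
  "compress F T = (proj F o\<^sub>L T o\<^sub>L proj F) + (id_blinfun - proj F)"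

lemma compress_apply: "compress F T x = proj F (T (proj F x)) + (x - proj F x)"
  by (simp add: compress_def blinfun.add_left blinfun.diff_left)

lemma norm_proj_le:
  assumes "finite F" "orthonormal F" shows "norm (proj F) \<le> 1"
proof (rule norm_blinfun_bound)
  fix x
  have "(norm (proj F x))\<^sup>2 \<le> (norm x)\<^sup>2"
    using norm_sq_split[OF assms, of x] by simp
  then show "norm (proj F x) \<le> 1 * norm x"
    by (simp add: power2_le_iff_abs_le)
qed simp

lemma compress_between:
  fixes T :: "'a::complex_hilbert \<Rightarrow>\<^sub>L 'a"
  assumes F: "finite F" "orthonormal F" and T: "op_between 1 M T" and "M \<ge> 1"
  shows "op_between 1 M (compress F T)"
  unfolding op_between_def
proof (intro conjI allI)
  show "herm (compress F T)"
    unfolding compress_def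
    by (intro herm_add herm_diff herm_sandwich herm_proj herm_id op_betweenD(1)[OF T])
  fix x
  have "Re (cinner x (x - proj F x)) = (norm (x - proj F x))\<^sup>2"
    using norm_sq_split[OF F, of x] cinner_proj_self[OF F, of x] norm_proj_sq[OF F, of x]
    by (simp add: cinner.diff_right cinner_self)
  then have *: "Re (cinner x (compress F T x)) = Re (cinner (proj F x) (T (proj F x))) + (norm (x - proj F x))\<^sup>2"
    by (simp add: compress_apply cinner.add_right hermD[OF herm_proj])
  note b = op_betweenD(2,3)[OF T, of "proj F x"]
  show "1 * (norm x)\<^sup>2 \<le> Re (cinner x (compress F T x))"
    unfolding * using b norm_sq_split[OF F, of x] by simp
  have "(norm (x - proj F x))\<^sup>2 \<le> M * (norm (x - proj F x))\<^sup>2"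
    using \<open>M \<ge> 1\<close> by (simp add: mult_le_cancel_right1)
  then show "Re (cinner x (compress F T x)) \<le> M * (norm x)\<^sup>2"
    unfolding * using b norm_sq_split[OF F, of x] by (simp add: distrib_left)
qed

lemma compress_invariant:
  assumes "finite F" "orthonormal F"
  shows "proj F (compress F T (proj F v)) = compress F T (proj F v)"
  by (simp add: compress_apply proj_proj[OF assms])

lemma eventually_orthonormal:
  assumes "is_onb B"
  shows "\<forall>\<^sub>F F in finite_subsets_at_top B. finite F \<and> orthonormal F \<and> F \<subseteq> B"
  by (rule eventually_finite_subsets_at_top_weakI)
    (use orthonormal_subset[OF is_onb_orthonormal[OF assms]] in auto)

lemma compress_tendsto:
  fixes T :: "'a::complex_hilbert \<Rightarrow>\<^sub>L 'a"
  assumes B: "is_onb B"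
  shows "((\<lambda>F. compress F T x) \<longlongrightarrow> T x) (finite_subsets_at_top B)"
proof -
  have n: "\<forall>\<^sub>F F in finite_subsets_at_top B. norm (proj F) \<le> 1"
    using eventually_orthonormal[OF B] by eventually_elim (auto intro: norm_proj_le)
  have p: "((\<lambda>F. proj F x) \<longlongrightarrow> id_blinfun x) (finite_subsets_at_top B)" for x :: 'a
    using proj_tendsto[OF B, of x] by simp
  have "((\<lambda>F. proj F (T (proj F x)) + (x - proj F x)) \<longlongrightarrow> id_blinfun (T x) + (x - x)) (finite_subsets_at_top B)"
    by (intro tendsto_add tendsto_diff tendsto_const strong_tendsto_apply[OF n p] blinfun.tendsto proj_tendsto[OF B])
  then show ?thesis by (simp add: compress_apply)
qed

text \<open>Compression preserves Y \<le> X, and the strong limit of the finite-dimensional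
  inequalities is taken. The test vector is projected along, since the finite version needs it in
  the range.\<close>

lemma loewner_heinz:
  fixes X Y :: "'a::complex_hilbert \<Rightarrow>\<^sub>L 'a"
  assumes B: "is_onb (B :: 'a set)" and X: "op_between 1 M X" and Y: "op_between 1 M Y" and M: "M \<ge> 1"
    and le: "\<And>v. Re (cinner v (Y v)) \<le> Re (cinner v (X v))"
    and s: "0 \<le> s" "s \<le> 1"
  shows "Re (cinner v (op_fun (\<lambda>t. t powr s) Y v)) \<le> Re (cinner v (op_fun (\<lambda>t. t powr s) X v))"
proof -
  define FF where "FF = finite_subsets_at_top B"
  have ev: "\<forall>\<^sub>F F in FF. finite F \<and> orthonormal F \<and> F \<subseteq> B"
    unfolding FF_def by (rule eventually_orthonormal[OF B])
  have lim: "((\<lambda>F. Re (cinner (proj F v) (op_fun (\<lambda>t. t powr s) (compress F T) (proj F v)))) \<longlongrightarrow>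
      Re (cinner v (op_fun (\<lambda>t. t powr s) T v))) FF" if T: "op_between 1 M T" for T
  proof -
    have b: "\<forall>\<^sub>F F in FF. op_between 1 M (compress F T)"
      using ev by eventually_elim (auto intro: compress_between T M)
    have f: "t powr s \<le> M powr s" if "t \<in> {1..M}" for t
      using that s by (intro powr_mono2) auto
    have n: "\<forall>\<^sub>F F in FF. norm (op_fun (\<lambda>t. t powr s) (compress F T)) \<le> M powr s"
      using b by eventually_elim (rule norm_op_fun_le[OF _ continuous_on_powr_ge_1], use f in auto)
    have c: "((\<lambda>F. op_fun (\<lambda>t. t powr s) (compress F T) x) \<longlongrightarrow> op_fun (\<lambda>t. t powr s) T x) FF" for x
      by (rule op_fun_strong_tendsto_eventually[OF b T _ continuous_on_powr_ge_1])
        (unfold FF_def, rule compress_tendsto[OF B])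
    show ?thesis
      by (intro tendsto_Re cinner.tendsto strong_tendsto_apply[OF n c]) (simp_all add: FF_def proj_tendsto[OF B])
  qed
  show ?thesis
  proof (rule tendsto_le[OF _ lim[OF X] lim[OF Y]])
    show "\<forall>\<^sub>F F in FF. Re (cinner (proj F v) (op_fun (\<lambda>t. t powr s) (compress F Y) (proj F v)))
        \<le> Re (cinner (proj F v) (op_fun (\<lambda>t. t powr s) (compress F X) (proj F v)))"
      using ev
    proof eventually_elim
      case (elim F)
      then have F: "finite F" "orthonormal F" by auto
      note XF = compress_between[OF F X M] and YF = compress_between[OF F Y M]
      obtain E1 x where E1: "eigenbasis F (compress F X) E1 x"
        using finite_eigenbasis[OF op_betweenD(1)[OF XF] F compress_invariant[OF F]] by (auto simp: eigenbasis_def)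
      obtain E2 y where E2: "eigenbasis F (compress F Y) E2 y"
        using finite_eigenbasis[OF op_betweenD(1)[OF YF] F compress_invariant[OF F]] by (auto simp: eigenbasis_def)
      show ?case
      proof (rule loewner_heinz_finite[OF E1 E2 XF YF _ s proj_proj[OF F]])
        fix u
        show "Re (cinner u (compress F Y u)) \<le> Re (cinner u (compress F X u))"
          using le[of "proj F u"] by (simp add: compress_apply cinner.add_right flip: hermD[OF herm_proj])
      qed
    qed
  qed (simp add: FF_def)
qed

text \<open>With P the projection, pass from (I - P) C to its adjoint C (I - P). On basis vectors
  the latter is 0 inside F and C e outside, so the tail of the sum is left.\<close>

lemma hilbert_schmidt_tail:
  fixes C :: "'a::complex_hilbert \<Rightarrow>\<^sub>L 'a"
  assumes B: "is_onb B" and C: "herm C" and sC: "(\<lambda>e. (norm (C e))\<^sup>2) summable_on B"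
    and F: "finite F" "F \<subseteq> B"
  shows "((\<lambda>e. (norm (C e - proj F (C e)))\<^sup>2) has_sum (\<Sum>\<^sub>\<infinity>e\<in>B. (norm (C e))\<^sup>2) - (\<Sum>e\<in>F. (norm (C e))\<^sup>2)) B"
proof -
  note oF = orthonormal_subset[OF is_onb_orthonormal[OF B] F(2)]
  define S where "S e = C (e - proj F e)" for e
  define h where "h e = (norm (C e))\<^sup>2" for e
  have pe: "proj F e = 0" if "e \<in> B" "e \<notin> F" for e
    unfolding proj_apply
    by (rule sum.neutral) (use is_onb_orthonormal[OF B] that F(2) in \<open>auto simp: orthonormal_def scaleC.zero_left subset_iff\<close>)
  have "(norm (S e))\<^sup>2 = h e - (if e \<in> F then h e else 0)" if "e \<in> B" for e
    using in_proj_range[OF F(1) oF, of e] pe[OF that] by (auto simp: S_def h_def blinfun.zero_right)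
  moreover have "((\<lambda>e. if e \<in> F then h e else 0) has_sum sum h F) B"
  proof -
    have "((\<lambda>e. if e \<in> F then h e else 0) has_sum sum h F) B \<longleftrightarrow> (h has_sum sum h F) F"
      by (rule has_sum_cong_neutral) (use F in auto)
    then show ?thesis using has_sum_finite[OF F(1)] by blast
  qed
  ultimately have S: "((\<lambda>e. (norm (S e))\<^sup>2) has_sum infsum h B - sum h F) B"
    using has_sum_diff[OF has_sum_infsum[OF sC[folded h_def]], of "\<lambda>e. if e \<in> F then h e else 0" "sum h F"]
    by (subst has_sum_cong) auto
  have adj: "cinner (S x) y = cinner x (C y - proj F (C y))" for x y
    by (simp add: S_def hermD[OF C] blinfun.diff_right cinner.diff_left cinner.diff_right hermD[OF herm_proj])
  have "(\<lambda>e. (norm (C e - proj F (C e)))\<^sup>2) summable_on B"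
    "(\<Sum>\<^sub>\<infinity>e\<in>B. (norm (C e - proj F (C e)))\<^sup>2) = infsum h B - sum h F"
    using hilbert_schmidt_adjoint[OF adj B B has_sum_imp_summable[OF S]] infsumI[OF S] by auto
  from has_sum_infsum[OF this(1)] this(2) show ?thesis
    unfolding h_def[abs_def] by simp
qed

text \<open>Young's inequality from |s x - y / s|^2 \<ge> 0 with s^2 = \<epsilon>. It puts a factor
  close to 1 on the main term and the large one on a tail that tends to 0.\<close>

lemma norm_add_sq_le:
  fixes x y :: "'a::complex_hilbert" and \<epsilon> :: real
  assumes "\<epsilon> > 0"
  shows "(norm (x + y))\<^sup>2 \<le> (1 + \<epsilon>) * (norm x)\<^sup>2 + (1 + 1 / \<epsilon>) * (norm y)\<^sup>2"
proof -
  define s where "s = sqrt \<epsilon>"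
  have s: "s > 0" "s\<^sup>2 = \<epsilon>" using assms by (simp_all add: s_def)
  have "0 \<le> (norm (s *\<^sub>R x - (1 / s) *\<^sub>R y))\<^sup>2" by simp
  also have "\<dots> = \<epsilon> * (norm x)\<^sup>2 - 2 * Re (cinner x y) + (norm y)\<^sup>2 / \<epsilon>"
    unfolding norm_minus_sq using s
    by (simp add: cinner_scaleR_left cinner_scaleR_right power_mult_distrib power_divide)
  finally show ?thesis
    unfolding norm_plus_sq by (simp add: algebra_simps)
qed

text \<open>Fatou's argument: the terms of the compressed inequality are nonnegative, so those in a
  fixed finite G are bounded by its right-hand side while F grows. Y and Z are compressed and X is
  rebuilt from them, because compressing X as well would destroy X = H Z H. The bound is the squared
  Hilbert-Schmidt norm of H C, where C^2 = Z - I.\<close>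

lemma trace_inequality_partial:
  fixes Y Z :: "'a::complex_hilbert \<Rightarrow>\<^sub>L 'a"
  assumes B: "is_onb B" and Y: "op_between 1 M Y" and Z: "op_between 1 M Z" and M: "M \<ge> 1"
    and \<nu>: "0 < \<nu>" "\<nu> \<le> 1"
  defines "H \<equiv> op_fun (\<lambda>t. t powr (1/2)) Y" and "C \<equiv> op_fun (\<lambda>t. sqrt (t - 1)) Z"
  defines "X \<equiv> H o\<^sub>L Z o\<^sub>L H"
  defines "A \<equiv> op_fun (\<lambda>t. t powr (1 - \<nu>)) X" and "A' \<equiv> op_fun (\<lambda>t. t powr (1 - \<nu>)) Y"
    and "R \<equiv> op_fun (\<lambda>t. t powr (\<nu>/2)) Y" and "S \<equiv> op_fun (\<lambda>t. sqrt (t powr \<nu> - 1)) Z"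
  assumes sC: "(\<lambda>e. (norm (C e))\<^sup>2) summable_on B"
    and G: "finite G" "G \<subseteq> B"
  shows "(\<Sum>e\<in>G. Re (cinner (R e) (A (R e))) - Re (cinner (R e) (A' (R e))) + Re (cinner (S e) (A (S e))))
    \<le> (\<Sum>\<^sub>\<infinity>e\<in>B. (norm (H (C e)))\<^sup>2)"
proof -
  \<comment> \<open>H^2 = Y \<le> M and Z \<le> M give H Z H \<le> M^2; N bounds all operators in
    play.\<close>
  define N where "N = M * M"
  have N: "N \<ge> M" "N \<ge> 1" using M by (auto simp: N_def mult_le_cancel_right1 intro: order_trans)
  define FF where "FF = finite_subsets_at_top B"
  have FFbot: "FF \<noteq> bot" by (simp add: FF_def)
  define sq where "sq V = op_fun (\<lambda>t. t powr (1/2)) V" for V :: "'a \<Rightarrow>\<^sub>L 'a"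
  have sqsq: "sq V (sq V v) = V v" "herm (sq V)" if V: "op_between 1 M V" for V v
  proof -
    show "sq V (sq V v) = V v"
      using op_fun_powr_powr[OF V, of "1/2" "1/2" v] op_fun_powr_one[OF V] by (simp add: sq_def)
    show "herm (sq V)" unfolding sq_def by (rule herm_op_fun[OF V continuous_on_powr_ge_1])
  qed
  have sqn: "(norm (sq V v))\<^sup>2 = Re (cinner v (V v))" if V: "op_between 1 M V" for V v
    unfolding norm_sq_eq_Re_cinner hermD[OF sqsq(2)[OF V]] sqsq(1)[OF V] by simp
  have sand: "op_between 1 N (sq V o\<^sub>L W o\<^sub>L sq V)" if V: "op_between 1 M V" and W: "op_between 1 M W" for V W
    unfolding op_between_def
  proof (intro conjI allI)
    show "herm (sq V o\<^sub>L W o\<^sub>L sq V)"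
      by (intro herm_sandwich sqsq(2)[OF V] op_betweenD(1)[OF W])
    fix x
    have e: "Re (cinner x ((sq V o\<^sub>L W o\<^sub>L sq V) x)) = Re (cinner (sq V x) (W (sq V x)))"
      by (simp add: hermD[OF sqsq(2)[OF V]])
    show "1 * (norm x)\<^sup>2 \<le> Re (cinner x ((sq V o\<^sub>L W o\<^sub>L sq V) x))"
      unfolding e using op_betweenD(2)[OF W, of "sq V x"] op_betweenD(2)[OF V, of x] by (simp add: sqn[OF V])
    have "M * Re (cinner x (V x)) \<le> M * (M * (norm x)\<^sup>2)"
      using M op_betweenD(3)[OF V, of x] by (intro mult_left_mono) auto
    then show "Re (cinner x ((sq V o\<^sub>L W o\<^sub>L sq V) x)) \<le> N * (norm x)\<^sup>2"
      unfolding e using op_betweenD(3)[OF W, of "sq V x"] by (simp add: sqn[OF V] N_def mult.assoc)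
  qed
  have X: "op_between 1 N X" unfolding X_def H_def sq_def[symmetric] by (rule sand[OF Y Z])
  have YN: "op_between 1 N Y" and ZN: "op_between 1 N Z"
    using op_between_weaken[OF Y _ N(1)] op_between_weaken[OF Z _ N(1)] by auto
  define Yf where "Yf F = compress F Y" for F
  define Zf where "Zf F = compress F Z" for F
  define Xf where "Xf F = sq (Yf F) o\<^sub>L Zf F o\<^sub>L sq (Yf F)" for F
  have ev: "\<forall>\<^sub>F F in FF. finite F \<and> orthonormal F \<and> F \<subseteq> B"
    unfolding FF_def by (rule eventually_orthonormal[OF B])
  have evY: "\<forall>\<^sub>F F in FF. op_between 1 M (Yf F)" and evZ: "\<forall>\<^sub>F F in FF. op_between 1 M (Zf F)"
    using ev by (eventually_elim, auto simp: Yf_def Zf_def intro: compress_between Y Z M)+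
  have evX: "\<forall>\<^sub>F F in FF. op_between 1 N (Xf F)"
    using evY evZ by eventually_elim (simp add: Xf_def sand)
  have evYN: "\<forall>\<^sub>F F in FF. op_between 1 N (Yf F)" and evZN: "\<forall>\<^sub>F F in FF. op_between 1 N (Zf F)"
    using evY evZ by (eventually_elim, auto intro: op_between_weaken N)+
  have limY: "((\<lambda>F. Yf F x) \<longlongrightarrow> Y x) FF" and limZ: "((\<lambda>F. Zf F x) \<longlongrightarrow> Z x) FF" for x
    unfolding Yf_def Zf_def FF_def by (rule compress_tendsto[OF B])+
  have limH: "((\<lambda>F. sq (Yf F) x) \<longlongrightarrow> H x) FF" for x
    unfolding sq_def H_def
    by (rule op_fun_strong_tendsto_eventually[OF evY Y limY continuous_on_powr_ge_1])
  have bound: "\<exists>K. \<forall>\<^sub>F F in FF. norm (op_fun f (V F)) \<le> K"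
    if V: "\<forall>\<^sub>F F in FF. op_between 1 N (V F)" and f: "continuous_on {1..N} f" for V f
  proof -
    have "bounded (f ` {1..N})"
      using f by (auto intro!: compact_imp_bounded compact_continuous_image)
    then obtain K where "\<forall>y\<in>f ` {1..N}. \<bar>y\<bar> \<le> K" by (auto simp: bounded_iff)
    then have K: "\<bar>f t\<bar> \<le> K" if "t \<in> {1..N}" for t using that by blast
    have "0 \<le> K" using K[of 1] N by auto
    have "\<forall>\<^sub>F F in FF. norm (op_fun f (V F)) \<le> K"
      using V by eventually_elim (rule norm_op_fun_le[OF _ f K \<open>0 \<le> K\<close>])
    then show ?thesis by blast
  qed
  have bid: "\<forall>\<^sub>F F in FF. norm (V F) \<le> N" if "\<forall>\<^sub>F F in FF. op_between 1 N (V F)" for V :: "'a set \<Rightarrow> 'a \<Rightarrow>\<^sub>L 'a"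
    using that by eventually_elim (use norm_le_of_op_between N in fastforce)
  have limX: "((\<lambda>F. Xf F x) \<longlongrightarrow> X x) FF" for x
  proof -
    obtain K where K: "\<forall>\<^sub>F F in FF. norm (sq (Yf F)) \<le> K"
      using bound[OF evYN continuous_on_powr_ge_1] unfolding sq_def by blast
    show ?thesis
      unfolding Xf_def X_def
      by (simp, intro strong_tendsto_apply[OF K limH] strong_tendsto_apply[OF bid[OF evZN] limZ] limH)
  qed
  define Af where "Af F = op_fun (\<lambda>t. t powr (1 - \<nu>)) (Xf F)" for F
  define Af' where "Af' F = op_fun (\<lambda>t. t powr (1 - \<nu>)) (Yf F)" for F
  define Rf where "Rf F = op_fun (\<lambda>t. t powr (\<nu>/2)) (Yf F)" for F
  define Sf where "Sf F = op_fun (\<lambda>t. sqrt (t powr \<nu> - 1)) (Zf F)" for F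
  have limA: "((\<lambda>F. Af F x) \<longlongrightarrow> A x) FF" for x
    unfolding Af_def A_def
    by (rule op_fun_strong_tendsto_eventually[OF evX X limX continuous_on_powr_ge_1])
  have limA': "((\<lambda>F. Af' F x) \<longlongrightarrow> A' x) FF" for x
    unfolding Af'_def A'_def
    by (rule op_fun_strong_tendsto_eventually[OF evYN YN limY continuous_on_powr_ge_1])
  have limR: "((\<lambda>F. Rf F x) \<longlongrightarrow> R x) FF" for x
    unfolding Rf_def R_def
    by (rule op_fun_strong_tendsto_eventually[OF evYN YN limY continuous_on_powr_ge_1])
  have limS: "((\<lambda>F. Sf F x) \<longlongrightarrow> S x) FF" for x
    unfolding Sf_def S_def
    by (rule op_fun_strong_tendsto_eventually[OF evZN ZN limZ continuous_on_sqrt_powr])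
  obtain KA where KA: "\<forall>\<^sub>F F in FF. norm (Af F) \<le> KA"
    using bound[OF evX continuous_on_powr_ge_1] unfolding Af_def by blast
  obtain KA' where KA': "\<forall>\<^sub>F F in FF. norm (Af' F) \<le> KA'"
    using bound[OF evYN continuous_on_powr_ge_1] unfolding Af'_def by blast
  define \<phi> where "\<phi> e = Re (cinner (R e) (A (R e))) - Re (cinner (R e) (A' (R e))) + Re (cinner (S e) (A (S e)))" for e
  define \<phi>f where "\<phi>f F e = Re (cinner (Rf F e) (Af F (Rf F e))) - Re (cinner (Rf F e) (Af' F (Rf F e))) + Re (cinner (Sf F e) (Af F (Sf F e)))" for F e
  have lim\<phi>: "((\<lambda>F. sum (\<phi>f F) G) \<longlongrightarrow> sum \<phi> G) FF"
    unfolding \<phi>_def \<phi>f_def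
    by (intro tendsto_sum tendsto_add tendsto_diff tendsto_Re cinner.tendsto limR limS
        strong_tendsto_apply[OF KA limA] strong_tendsto_apply[OF KA' limA'])
  define h where "h e = (norm (C e))\<^sup>2" for e
  have hC: "herm C" and CC: "C (C v) = Z v - v" for v
    unfolding C_def using op_fun_sqrt_minus_one[OF Z] by simp_all
  have nH: "(norm (H v))\<^sup>2 \<le> M * (norm v)\<^sup>2" for v
    using sqn[OF Y, of v] op_betweenD(3)[OF Y, of v] by (simp add: H_def sq_def)
  have sHC: "(\<lambda>e. (norm (H (C e)))\<^sup>2) summable_on B"
    by (rule summable_on_comparison_test[OF summable_on_cmult_right[OF sC, of M]]) (use nH in auto)
  define Q where "Q = (\<Sum>\<^sub>\<infinity>e\<in>B. (norm (H (C e)))\<^sup>2)"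
  have key: "sum (\<phi>f F) G \<le> (1 + \<epsilon>) * Q + (1 + 1 / \<epsilon>) * (M * (infsum h B - sum h F))"
    if "\<epsilon> > 0" and F: "finite F" "orthonormal F" "F \<subseteq> B" "G \<subseteq> F" for \<epsilon> F
  proof -
    have YF: "op_between 1 M (Yf F)" and ZF: "op_between 1 M (Zf F)"
      using F by (auto simp: Yf_def Zf_def intro: compress_between Y Z M)
    note XF = sand[OF YF ZF, folded Xf_def]
    have YFN: "op_between 1 N (Yf F)" and ZFN: "op_between 1 N (Zf F)"
      using op_between_weaken[OF YF _ N(1)] op_between_weaken[OF ZF _ N(1)] by auto
    \<comment> \<open>The range has a basis of eigenvectors of \<open>Yf F\<close>, so the square
      root preserves it too.\<close>
    have inv: "proj F (sq (Yf F) (proj F v)) = sq (Yf F) (proj F v)" for v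
    proof -
      obtain E r where E: "eigenbasis F (Yf F) E r"
        using finite_eigenbasis[OF op_betweenD(1)[OF YF] F(1,2)] compress_invariant[OF F(1,2)]
        unfolding eigenbasis_def Yf_def by blast
      have "sq (Yf F) (proj F v) = (\<Sum>e\<in>E. cinner e v *\<^sub>C (r e powr (1/2)) *\<^sub>R e)"
        unfolding eigenbasisD(3)[OF E, symmetric] proj_apply blinfun.sum_right herm_scaleC[OF sqsq(2)[OF YF]]
        by (simp add: sq_def op_fun_eigenbasis[OF E YF continuous_on_powr_ge_1] cong: sum.cong)
      then show ?thesis
        by (simp add: blinfun.sum_right herm_scaleC[OF herm_proj] blinfun.scaleR_right eigenbasisD(6)[OF E] cong: sum.cong)
    qed
    have invZ: "proj F (Zf F (proj F v)) = Zf F (proj F v)" and invY: "proj F (Yf F (proj F v)) = Yf F (proj F v)" for v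
      unfolding Zf_def Yf_def by (rule compress_invariant[OF F(1,2)])+
    have invX: "proj F (Xf F (proj F v)) = Xf F (proj F v)" for v
      unfolding Xf_def using inv invZ by (simp, metis)
    note fti = finite_trace_inequality[OF F(1,2) XF YFN ZFN invX invY invZ Xf_def[of F, unfolded sq_def] \<nu>,
        folded Af_def Af'_def Rf_def Sf_def]
    \<comment> \<open>Positivity by Loewner-Heinz; it allows enlarging G to F.\<close>
    have pos: "0 \<le> \<phi>f F e" for e
    proof -
      have "0 \<le> Re (cinner (Sf F e) (Af F (Sf F e)))"
        unfolding Af_def by (rule op_fun_nonneg[OF XF continuous_on_powr_ge_1]) simp
      moreover have "Re (cinner u (Yf F u)) \<le> Re (cinner u (Xf F u))" for u
        unfolding sqn[OF YF, symmetric] Xf_def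
        using op_betweenD(2)[OF ZF, of "sq (Yf F) u"] by (simp add: hermD[OF sqsq(2)[OF YF]])
      ultimately show ?thesis
        using loewner_heinz[OF B XF YFN N(2), of "1 - \<nu>" "Rf F e"] \<nu> by (simp add: \<phi>f_def Af_def Af'_def)
    qed
    have "sum (\<phi>f F) G \<le> sum (\<phi>f F) F"
      using F pos by (intro sum_mono2) auto
    also have "\<dots> \<le> (\<Sum>f\<in>F. Re (cinner f (Xf F f)) - Re (cinner f (Yf F f)))"
      using fti by (simp add: \<phi>f_def)
    \<comment> \<open>The difference of the compressed operators is H_F P (Z - I) P H_F, with P the
      projection and H_F the square root of \<open>Yf F\<close>; its trace is the squared
      Hilbert-Schmidt norm of C P H_F on F.\<close>
    also have "\<dots> = (\<Sum>f\<in>F. (norm (C (proj F (sq (Yf F) f))))\<^sup>2)"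
    proof (rule sum.cong)
      fix f assume "f \<in> F"
      define u where "u = sq (Yf F) f"
      have "Re (cinner f (Xf F f)) - Re (cinner f (Yf F f)) = Re (cinner u (Zf F u - u))"
        unfolding u_def Xf_def cinner.diff_right using sqn[OF YF, of f]
        by (simp add: hermD[OF sqsq(2)[OF YF]] norm_sq_eq_Re_cinner sqsq(1)[OF YF])
      also have "Zf F u - u = proj F (Z (proj F u) - proj F u)"
        by (simp add: Zf_def compress_apply blinfun.diff_right proj_proj[OF F(1,2)])
      also have "Re (cinner u (proj F (Z (proj F u) - proj F u))) = (norm (C (proj F u)))\<^sup>2"
        unfolding CC[symmetric] norm_sq_eq_Re_cinner by (simp add: hermD[OF hC] hermD[OF herm_proj])
      finally show "Re (cinner f (Xf F f)) - Re (cinner f (Yf F f)) = (norm (C (proj F (sq (Yf F) f))))\<^sup>2"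
        by (simp add: u_def)
    qed simp
    \<comment> \<open>Passing to the adjoint H_F P C moves the sum from F to the fixed basis
      B.\<close>
    also have "\<dots> \<le> (\<Sum>\<^sub>\<infinity>e\<in>B. (norm (sq (Yf F) (proj F (C e))))\<^sup>2)"
    proof (rule hilbert_schmidt_finite_le[OF _ B _ F(1,2)])
      show "cinner (sq (Yf F) (proj F (C x))) y = cinner x (C (proj F (sq (Yf F) y)))" for x y
        by (simp add: hermD[OF hC] hermD[OF herm_proj] hermD[OF sqsq(2)[OF YF]])
      show "(\<lambda>e. (norm (sq (Yf F) (proj F (C e))))\<^sup>2) summable_on B"
      proof (rule summable_on_comparison_test[OF summable_on_cmult_right[OF sC, of M]])
        fix e
        have "(norm (sq (Yf F) (proj F (C e))))\<^sup>2 \<le> M * (norm (proj F (C e)))\<^sup>2"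
          unfolding sqn[OF YF] by (rule op_betweenD(3)[OF YF])
        also have "\<dots> \<le> M * (norm (C e))\<^sup>2"
          using M norm_sq_split[OF F(1,2), of "C e"] by (intro mult_left_mono) auto
        finally show "(norm (sq (Yf F) (proj F (C e))))\<^sup>2 \<le> M * (norm (C e))\<^sup>2" .
      qed simp
    qed
    \<comment> \<open>On the range of P the compressed Y and Y itself have the same quadratic form,
      so the square root that varies with F is replaced by the fixed H.\<close>
    also have "\<dots> = (\<Sum>\<^sub>\<infinity>e\<in>B. (norm (H (proj F (C e))))\<^sup>2)"
    proof (rule infsum_cong)
      fix e
      have "Re (cinner (proj F (C e)) (Yf F (proj F (C e)))) = Re (cinner (proj F (C e)) (Y (proj F (C e))))"
        by (simp add: Yf_def compress_apply proj_proj[OF F(1,2)] flip: hermD[OF herm_proj])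
      then show "(norm (sq (Yf F) (proj F (C e))))\<^sup>2 = (norm (H (proj F (C e))))\<^sup>2"
        unfolding sqn[OF YF] H_def sq_def[symmetric] sqn[OF Y] .
    qed
    \<comment> \<open>H P C differs from H C by H (C - P C), whose norm is controlled by M and the
      tail of the sum for C.\<close>
    also have "\<dots> \<le> (1 + \<epsilon>) * Q + (1 + 1 / \<epsilon>) * (M * (infsum h B - sum h F))"
    proof -
      have tail: "((\<lambda>e. (norm (C e - proj F (C e)))\<^sup>2) has_sum infsum h B - sum h F) B"
        unfolding h_def by (rule hilbert_schmidt_tail[OF B hC sC F(1,3)])
      have le: "(norm (H (proj F (C e))))\<^sup>2 \<le> (1 + \<epsilon>) * (norm (H (C e)))\<^sup>2 + (1 + 1 / \<epsilon>) * (M * (norm (C e - proj F (C e)))\<^sup>2)" for e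
      proof -
        have "H (proj F (C e)) = H (C e) + - H (C e - proj F (C e))"
          by (simp add: blinfun.diff_right)
        then have "(norm (H (proj F (C e))))\<^sup>2 \<le> (1 + \<epsilon>) * (norm (H (C e)))\<^sup>2 + (1 + 1 / \<epsilon>) * (norm (H (C e - proj F (C e))))\<^sup>2"
          using norm_add_sq_le[OF \<open>\<epsilon> > 0\<close>, of "H (C e)" "- H (C e - proj F (C e))"] by simp
        also have "(1 + 1 / \<epsilon>) * (norm (H (C e - proj F (C e))))\<^sup>2 \<le> (1 + 1 / \<epsilon>) * (M * (norm (C e - proj F (C e)))\<^sup>2)"
          using \<open>\<epsilon> > 0\<close> by (intro mult_left_mono nH) auto
        finally show ?thesis by simp
      qed
      have hs: "((\<lambda>e. (1 + \<epsilon>) * (norm (H (C e)))\<^sup>2 + (1 + 1 / \<epsilon>) * (M * (norm (C e - proj F (C e)))\<^sup>2)) has_sum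
          (1 + \<epsilon>) * Q + (1 + 1 / \<epsilon>) * (M * (infsum h B - sum h F))) B"
        unfolding Q_def by (intro has_sum_add has_sum_cmult_right tail has_sum_infsum sHC)
      have "(\<lambda>e. (norm (H (proj F (C e))))\<^sup>2) summable_on B"
        by (rule summable_on_comparison_test[OF has_sum_imp_summable[OF hs]]) (use le in auto)
      then show ?thesis
        by (rule has_sum_mono[OF has_sum_infsum hs]) (rule le)
    qed
    finally show ?thesis .
  qed
  \<comment> \<open>For fixed \<epsilon> the tail tends to 0 along F; only afterwards does
    \<epsilon> tend to 0.\<close>
  have bnd: "sum \<phi> G \<le> (1 + \<epsilon>) * Q" if "\<epsilon> > 0" for \<epsilon>
  proof (rule tendsto_le[OF FFbot _ lim\<phi>])
    have "((\<lambda>F. sum h F) \<longlongrightarrow> infsum h B) FF"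
      unfolding FF_def by (rule infsum_tendsto) (use sC in \<open>simp add: h_def[abs_def]\<close>)
    then have "((\<lambda>F. (1 + \<epsilon>) * Q + (1 + 1 / \<epsilon>) * (M * (infsum h B - sum h F))) \<longlongrightarrow>
        (1 + \<epsilon>) * Q + (1 + 1 / \<epsilon>) * (M * (infsum h B - infsum h B))) FF"
      by (intro tendsto_intros)
    then show "((\<lambda>F. (1 + \<epsilon>) * Q + (1 + 1 / \<epsilon>) * (M * (infsum h B - sum h F))) \<longlongrightarrow> (1 + \<epsilon>) * Q) FF"
      by simp
    have "\<forall>\<^sub>F F in FF. G \<subseteq> F"
      unfolding FF_def eventually_finite_subsets_at_top using G by blast
    with ev show "\<forall>\<^sub>F F in FF. sum (\<phi>f F) G \<le> (1 + \<epsilon>) * Q + (1 + 1 / \<epsilon>) * (M * (infsum h B - sum h F))"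
      by eventually_elim (use key[OF that] in auto)
  qed
  have "((\<lambda>\<epsilon>. (1 + \<epsilon>) * Q) \<longlongrightarrow> (1 + 0) * Q) (at_right 0)"
    by (intro tendsto_intros)
  then have "sum \<phi> G \<le> (1 + 0) * Q"
    by (rule tendsto_lowerbound) (auto simp: eventually_at_right_less bnd intro: eventually_at_rightI[of 0 1])
  then show ?thesis by (simp add: \<phi>_def Q_def)
qed

section \<open>Trace class operators and the theorem\<close>

lemma op_adjoint_eqI:
  assumes "\<And>x y. cinner (blinfun_apply S x) y = cinner x (blinfun_apply T y)"
  shows "op_adjoint T = S"
  unfolding op_adjoint_def
proof (rule the_equality)
  show "\<forall>x y. cinner (S x) y = cinner x (T y)" using assms by blast
  fix S' assume S': "\<forall>x y. cinner (blinfun_apply S' x) y = cinner x (T y)"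
  show "S' = S"
  proof (rule blinfun_eqI, rule cinner_ext)
    fix x z
    have "cnj (cinner (S' x) z) = cnj (cinner (S x) z)"
      using S' assms by simp
    then show "cinner z (S' x) = cinner z (S x)"
      by (simp only: cnj_cinner)
  qed
qed

text \<open>The spectrum lies in [0, c] with c = norm T, so c - T has norm at most c.\<close>

lemma nonneg_if_spectrum_nonneg:
  fixes T :: "'a::complex_hilbert \<Rightarrow>\<^sub>L 'a"
  assumes T: "herm T" and "\<And>s. s > 0 \<Longrightarrow> op_invertible (T + s *\<^sub>R id_blinfun)"
  shows "0 \<le> Re (cinner x (T x))"
proof -
  define c where "c = norm T"
  have spec: "0 \<le> t \<and> t \<le> c" if t: "t \<in> real_spectrum T" for t
  proof
    have "t \<in> {- norm T..norm T}"
      using t real_spectrum_between[OF op_between_norm[OF T]] by blast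
    then show "t \<le> c" by (simp add: c_def)
    show "0 \<le> t"
    proof (rule ccontr)
      assume "\<not> 0 \<le> t"
      then have "op_invertible (T + (- t) *\<^sub>R id_blinfun)" using assms(2)[of "- t"] by simp
      with t show False by (simp add: real_spectrum_iff)
    qed
  qed
  have "norm (op_poly [:c, -1:] T) \<le> c"
    using spec by (intro norm_op_poly_le[OF T]) (auto simp: c_def)
  then have "Re (cinner x (op_poly [:c, -1:] T x)) \<le> c * (norm x)\<^sup>2"
    using Re_cinner_le[of x "op_poly [:c, -1:] T"]
      mult_right_mono[of "norm (op_poly [:c, -1:] T)" c "(norm x)\<^sup>2"] by simp
  moreover have "op_poly [:c, -1:] T x = c *\<^sub>R x - T x"
    by (simp add: op_poly_pCons blinfun.add_left blinfun.scaleR_left blinfun.minus_left blinfun.minus_right)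
  ultimately show ?thesis
    by (simp add: cinner.diff_right cinner_scaleR_right norm_sq_eq_Re_cinner)
qed

lemma op_invertible_square:
  assumes "op_invertible (S o\<^sub>L S)" shows "op_invertible S"
proof -
  obtain Q where Q: "Q o\<^sub>L (S o\<^sub>L S) = id_blinfun" "(S o\<^sub>L S) o\<^sub>L Q = id_blinfun"
    using assms unfolding op_invertible_def by blast
  have Q1: "Q (S (S x)) = x" and Q2: "S (S (Q x)) = x" for x
    using Q by (simp_all add: blinfun_eq_iff)
  have "S (Q x) = Q (S x)" for x
    using Q1[of "S (Q x)"] Q2[of x] by simp
  then show ?thesis
    unfolding op_invertible_def using Q2
    by (intro exI[of _ "S o\<^sub>L Q"]) (simp add: blinfun_eq_iff)
qed

text \<open>Monotonicity of the square root, in the form: L^2 \<le> D^2 and D \<ge> 0 imply L \<le>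
  D. Invertibility of D - L + s for all s > 0 leaves no negative spectrum.\<close>

lemma op_le_if_norm_le:
  fixes D L :: "'a::complex_hilbert \<Rightarrow>\<^sub>L 'a"
  assumes D: "herm D" and L: "herm L" and pos: "\<And>x. 0 \<le> Re (cinner x (D x))"
    and le: "\<And>x. norm (L x) \<le> norm (D x)"
  shows "Re (cinner x (L x)) \<le> Re (cinner x (D x))"
proof -
  have "0 \<le> Re (cinner x ((D - L) x))"
  proof (rule nonneg_if_spectrum_nonneg[OF herm_diff[OF D L]])
    fix s :: real assume s: "s > 0"
    define S where "S = (D - L) + s *\<^sub>R id_blinfun"
    have hS: "herm S"
      unfolding S_def by (intro herm_add herm_diff herm_scaleR herm_id D L)
    define k where "k = 2 * norm D + norm S + 1"
    have k: "k > 0" by (simp add: k_def add_nonneg_pos)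
    have below: "s\<^sup>2 / k * norm x \<le> norm (S x)" for x
    proof (cases "x = 0")
      case False
      define y where "y = S x"
      have "L x = (D x + s *\<^sub>R x) - y"
        by (simp add: y_def S_def blinfun.add_left blinfun.diff_left blinfun.scaleR_left)
      \<comment> \<open>If S x is small, |D x + s x| is close to |L x| \<le> |D x|, whereas
        positivity of D makes its square exceed |D x|^2 by at least s^2 |x|^2.\<close>
      then have "norm (D x + s *\<^sub>R x) \<le> norm (D x) + norm y"
        using le[of x] norm_triangle_sub[of "D x + s *\<^sub>R x" y] by (simp add: add.commute)
      then have "(norm (D x + s *\<^sub>R x))\<^sup>2 \<le> (norm (D x) + norm y)\<^sup>2"
        by (intro power_mono) auto
      moreover have "(norm (D x))\<^sup>2 + s\<^sup>2 * (norm x)\<^sup>2 \<le> (norm (D x + s *\<^sub>R x))\<^sup>2"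
        unfolding norm_plus_sq using s pos[of x]
        by (simp add: cinner_scaleR_right power_mult_distrib hermD[OF D])
      ultimately have "s\<^sup>2 * (norm x)\<^sup>2 \<le> norm y * (2 * norm (D x) + norm y)"
        by (simp add: power2_eq_square algebra_simps)
      also have "\<dots> \<le> norm y * (2 * (norm D * norm x) + norm S * norm x)"
        unfolding y_def by (intro mult_left_mono add_mono norm_blinfun order_refl) auto
      also have "\<dots> \<le> norm y * (k * norm x)"
        by (intro mult_left_mono) (auto simp: k_def algebra_simps)
      finally have "s\<^sup>2 * norm x \<le> norm y * k"
        using False by (simp add: power2_eq_square)
      then show ?thesis
        using k by (simp add: y_def field_simps)
    qed simp
    \<comment> \<open>S is bounded below in norm but not yet known to be positive, so its square is
      inverted first.\<close>
    have "op_invertible (S o\<^sub>L S)"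
    proof (rule bounded_below_invertible)
      show "herm (S o\<^sub>L S)" by (simp add: herm_def hermD[OF hS])
      show "0 < (s\<^sup>2 / k)\<^sup>2" using s k by simp
      fix x
      have "(s\<^sup>2 / k * norm x)\<^sup>2 \<le> (norm (S x))\<^sup>2"
        by (intro power_mono below) (use k in simp)
      then show "(s\<^sup>2 / k)\<^sup>2 * (norm x)\<^sup>2 \<le> Re (cinner x ((S o\<^sub>L S) x))"
        by (simp only: power_mult_distrib norm_sq_eq_Re_cinner[of "S x"] hermD[OF hS] blinfun_apply_blinfun_compose)
    qed
    then show "op_invertible ((D - L) + s *\<^sub>R id_blinfun)"
      unfolding S_def[symmetric] by (rule op_invertible_square)
  qed
  then show ?thesis by (simp add: blinfun.diff_left cinner.diff_right)
qed

lemma hilbert_schmidt_left: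
  assumes "(\<lambda>e. (norm (T e))\<^sup>2) summable_on B"
  shows "(\<lambda>e. (norm (blinfun_apply U (T e)))\<^sup>2) summable_on B"
proof (rule summable_on_comparison_test[OF summable_on_cmult_right[OF assms, of "(norm U)\<^sup>2"]])
  fix e
  show "(norm (U (T e)))\<^sup>2 \<le> (norm U)\<^sup>2 * (norm (T e))\<^sup>2"
    unfolding power_mult_distrib[symmetric] by (intro power_mono norm_blinfun) simp
qed simp

text \<open>Both U K and its adjoint K U are Hilbert-Schmidt, so the pairing of K U with K may be
  evaluated on either side. The second sum has real terms, so the value is real.\<close>

lemma trace_cyclic:
  fixes U K :: "'a::complex_hilbert \<Rightarrow>\<^sub>L 'a"
  assumes B: "is_onb B" and U: "herm U" and K: "herm K"
    and sK: "(\<lambda>e. (norm (K e))\<^sup>2) summable_on B"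
  shows "\<exists>s. ((\<lambda>e. cinner e (U (K (K e)))) has_sum complex_of_real s) B \<and>
    ((\<lambda>e. Re (cinner (K e) (U (K e)))) has_sum s) B"
proof -
  have adj: "cinner (U (K x)) y = cinner x (K (U y))" "cinner (K (U x)) y = cinner x (U (K y))" for x y
    by (simp_all add: hermD[OF U] hermD[OF K])
  have "(\<lambda>e. (norm (K (U e)))\<^sup>2) summable_on B"
    by (rule hilbert_schmidt_adjoint(1)[OF adj(1) B B hilbert_schmidt_left[OF sK]])
  from hilbert_schmidt_pairing[OF adj(2) hermD[OF K] B this sK]
  obtain s where s: "((\<lambda>e. cinner (K (U e)) (K e)) has_sum s) B" "((\<lambda>e. cinner (K e) (U (K e))) has_sum s) B"
    by blast
  from has_sum_Re[OF s(2)] have r: "((\<lambda>e. Re (cinner (K e) (U (K e)))) has_sum Re s) B" .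
  have "((\<lambda>e. cinner (K e) (U (K e))) has_sum complex_of_real (Re s)) B"
    using has_sum_of_real[OF r, where 'a=complex] by (simp flip: herm_cinner_real[OF U])
  then have "s = complex_of_real (Re s)"
    using has_sum_unique s(2) by blast
  with s(1) r show ?thesis
    by (intro exI[of _ "Re s"]) (simp add: hermD[OF U] hermD[OF K])
qed

text \<open>From ln t \<ge> 1 - 1/t and t^\<nu> - 1 \<ge> \<nu> ln t. It carries summability from
  ln_\<nu> Z over to Z - I.\<close>

lemma gen_ln_lower:
  fixes t M \<nu> :: real
  assumes "1 \<le> t" "t \<le> M" "0 < \<nu>"
  shows "t - 1 \<le> M / \<nu> * (t powr \<nu> - 1)"
proof -
  have "1 - 1 / t \<le> ln t"
    using ln_le_minus_one[of "1 / t"] assms by (simp add: ln_div)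
  then have "\<nu> * (1 - 1 / t) \<le> \<nu> * ln t" using assms by simp
  also have "\<dots> \<le> t powr \<nu> - 1"
  proof -
    have "t powr \<nu> = exp (\<nu> * ln t)" using assms by (simp add: powr_def)
    then show ?thesis using exp_ge_add_one_self[of "\<nu> * ln t"] by linarith
  qed
  finally have *: "\<nu> * (1 - 1 / t) \<le> t powr \<nu> - 1" .
  have "t - 1 = t * (1 - 1 / t)" using assms by (simp add: field_simps)
  also have "\<dots> \<le> M * (1 - 1 / t)" using assms by (intro mult_right_mono) auto
  also have "\<dots> = M / \<nu> * (\<nu> * (1 - 1 / t))" using assms by simp
  also have "\<dots> \<le> M / \<nu> * (t powr \<nu> - 1)" using * assms by (intro mult_left_mono) auto
  finally show ?thesis .
qed

lemma op_powr_eq: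
  assumes "op_between 1 M T" shows "op_powr T a = op_fun (\<lambda>t. t powr a) T"
  unfolding op_powr_def by (rule op_fun_cong[OF assms]) auto

lemma positive_op_Re: "positive_op T \<Longrightarrow> 0 \<le> Re (cinner x (blinfun_apply T x))"
  by (simp add: positive_op_def less_eq_complex_def)

text \<open>A \<ge> I gives L^2 \<le> L A^2 L = |A L|^2, hence L \<le> |A L| by monotonicity of the
  square root, and the diagonal of |A L| is summable in the basis that \<open>trace_class\<close>
  provides.\<close>

lemma trace_class_summable:
  fixes A L S :: "'a::complex_hilbert \<Rightarrow>\<^sub>L 'a"
  assumes A: "op_between 1 N A" and L: "herm L" and tc: "trace_class (A o\<^sub>L L)"
  shows "\<exists>B. is_onb B \<and> (\<exists>g. g summable_on B \<and> (\<forall>e. Re (cinner e (L e)) \<le> g e))"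
proof -
  have hA: "herm A" by (rule op_betweenD[OF A])
  define W where "W = op_adjoint (A o\<^sub>L L) o\<^sub>L (A o\<^sub>L L)"
  have "op_adjoint (A o\<^sub>L L) = L o\<^sub>L A"
    by (rule op_adjoint_eqI) (simp add: hermD[OF hA] hermD[OF L])
  then have W: "W x = L (A (A (L x)))" for x by (simp add: W_def)
  have "herm W" by (simp add: herm_def W hermD[OF hA] hermD[OF L])
  moreover have "0 \<le> Re (cinner x (W x))" for x
  proof -
    have "Re (cinner x (W x)) = Re (cinner (A (L x)) (A (L x)))"
      unfolding W by (simp add: hermD[OF hA] hermD[OF L])
    then show ?thesis by (simp add: cinner_self)
  qed
  ultimately have Wb: "op_between 0 (norm W) W"
    using Re_cinner_le[of _ W] by (simp add: op_between_def)
  define D where "D = op_fun sqrt W"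
  have c: "continuous_on {0..norm W} sqrt" by (intro continuous_intros)
  have hD: "herm D" unfolding D_def by (rule herm_op_fun[OF Wb c])
  have "D o\<^sub>L D = op_fun (\<lambda>t. t) W"
    unfolding D_def op_fun_mult[OF Wb c c, symmetric] by (rule op_fun_cong[OF Wb]) simp
  then have DD: "D (D x) = W x" for x
    unfolding op_fun_ident[OF Wb] by (metis blinfun_apply_blinfun_compose)
  have LD: "norm (L x) \<le> norm (D x)" for x
  proof -
    have Ay: "norm y \<le> norm (A y)" for y
    proof (cases "y = 0")
      case False
      have "1 * (norm y)\<^sup>2 \<le> Re (cinner y (A y))" by (rule op_betweenD(2)[OF A])
      also have "\<dots> \<le> norm y * norm (A y)"
        using cauchy_schwarz complex_Re_le_cmod order_trans by blast
      finally show ?thesis using False by (simp add: power2_eq_square)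
    qed simp
    have "(norm (D x))\<^sup>2 = (norm (A (L x)))\<^sup>2"
      unfolding norm_sq_eq_Re_cinner hermD[OF hD] DD W hermD[OF hA] hermD[OF L] by simp
    then have "norm (D x) = norm (A (L x))" by simp
    then show ?thesis using Ay[of "L x"] by simp
  qed
  have le: "Re (cinner x (L x)) \<le> Re (cinner x (D x))" for x
    by (rule op_le_if_norm_le[OF hD L op_fun_nonneg[OF Wb c, folded D_def] LD]) simp
  obtain B where B: "is_onb B" "(\<lambda>e. cinner e (D e)) summable_on B"
    using tc by (auto simp: trace_class_def op_abs_def W_def[symmetric] D_def[symmetric])
  from summable_on_Re[OF B(2)] B(1) le show ?thesis by blast
qed

theorem theorem3p2:
  fixes X Y :: "'a::complex_hilbert \<Rightarrow>\<^sub>L 'a" and \<nu> :: real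
  assumes "positive_op X" and "positive_op Y"
    and "0 < \<nu>" and "\<nu> \<le> 1"
    and "id_blinfun \<le>\<^sub>L Y" and "Y \<le>\<^sub>L X"
    and "trace_class (X - (op_powr X (1 - \<nu>) o\<^sub>L op_powr Y \<nu>))"
    and "trace_class (op_powr X (1 - \<nu>) o\<^sub>L
           op_fun (gen_ln \<nu>) (op_powr Y (- 1/2) o\<^sub>L X o\<^sub>L op_powr Y (- 1/2)))"
  shows "tsallis_rel_entropy \<nu> X Y \<ge>
    op_trace (op_powr X (1 - \<nu>) o\<^sub>L
      op_fun (gen_ln \<nu>) (op_powr Y (- 1/2) o\<^sub>L X o\<^sub>L op_powr Y (- 1/2)))"
proof -
  note \<nu> = assms(3,4)
  have hX: "herm X" and hY: "herm Y" using assms positive_op_herm by auto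
  have idY: "(norm v)\<^sup>2 \<le> Re (cinner v (Y v))" for v
    using positive_op_Re[OF assms(5)[unfolded loewner_le_def], of v]
    by (simp add: blinfun.diff_left cinner.diff_right norm_sq_eq_Re_cinner)
  have YX: "Re (cinner v (Y v)) \<le> Re (cinner v (X v))" for v
    using positive_op_Re[OF assms(6)[unfolded loewner_le_def], of v]
    by (simp add: blinfun.diff_left cinner.diff_right)
  \<comment> \<open>One bound for all three operators: Y \<le> X \<le> M, and Z \<le> M because Y
    \<ge> I makes Y^(-1/2) a contraction.\<close>
  define M where "M = max 1 (norm X)"
  have M: "M \<ge> 1" by (simp add: M_def)
  have XM: "Re (cinner v (X v)) \<le> M * (norm v)\<^sup>2" for v
  proof -
    have "norm X * (norm v)\<^sup>2 \<le> M * (norm v)\<^sup>2"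
      by (intro mult_right_mono) (simp_all add: M_def)
    with Re_cinner_le[of v X] show ?thesis by linarith
  qed
  have X: "op_between 1 M X" and Y: "op_between 1 M Y"
    unfolding op_between_def using hX hY idY YX XM by (auto intro: order_trans)
  define I where "I = op_fun (\<lambda>t. t powr (- 1/2)) Y"
  define H where "H = op_fun (\<lambda>t. t powr (1/2)) Y"
  have hI: "herm I" and hH: "herm H"
    unfolding I_def H_def by (rule herm_op_fun[OF Y continuous_on_powr_ge_1])+
  have HI: "H (I v) = v" and IH: "I (H v) = v" for v
    unfolding H_def I_def op_fun_powr_powr[OF Y] by (simp_all add: op_fun_powr_zero[OF Y] del: powr_zero_eq_one)
  have HH: "H (H v) = Y v" for v
    unfolding H_def op_fun_powr_powr[OF Y] using op_fun_powr_one[OF Y] by simp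
  define Z where "Z = I o\<^sub>L X o\<^sub>L I"
  have IYI: "Re (cinner (I v) (Y (I v))) = (norm v)\<^sup>2" for v
  proof -
    have "Re (cinner (I v) (Y (I v))) = Re (cinner (H (I v)) (H (I v)))"
      unfolding HH[symmetric] by (simp only: hermD[OF hH])
    then show ?thesis by (simp add: HI norm_sq_eq_Re_cinner)
  qed
  have Z: "op_between 1 M Z"
    unfolding op_between_def
  proof (intro conjI allI)
    show "herm Z" unfolding Z_def by (rule herm_sandwich[OF hI hX])
    fix v
    have e: "Re (cinner v (Z v)) = Re (cinner (I v) (X (I v)))"
      by (simp add: Z_def hermD[OF hI])
    show "1 * (norm v)\<^sup>2 \<le> Re (cinner v (Z v))"
      unfolding e using YX[of "I v"] IYI[of v] by simp
    have "M * (norm (I v))\<^sup>2 \<le> M * (norm v)\<^sup>2"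
      using idY[of "I v"] IYI[of v] M by (intro mult_left_mono) auto
    with XM[of "I v"] show "Re (cinner v (Z v)) \<le> M * (norm v)\<^sup>2"
      unfolding e by linarith
  qed
  have XHZH: "H o\<^sub>L Z o\<^sub>L H = X"
    by (rule blinfun_eqI) (simp add: Z_def HI IH)
  define A where "A = op_fun (\<lambda>t. t powr (1 - \<nu>)) X"
  define A' where "A' = op_fun (\<lambda>t. t powr (1 - \<nu>)) Y"
  define R where "R = op_fun (\<lambda>t. t powr (\<nu>/2)) Y"
  define Ri where "Ri = op_fun (\<lambda>t. t powr (- \<nu>/2)) Y"
  define P where "P = op_fun (\<lambda>t. t powr \<nu>) Y"
  define S where "S = op_fun (\<lambda>t. sqrt (t powr \<nu> - 1)) Z"
  define C where "C = op_fun (\<lambda>t. sqrt (t - 1)) Z"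
  define L where "L = op_fun (gen_ln \<nu>) Z"
  have cL: "continuous_on {1..M} (gen_ln \<nu>)"
    unfolding gen_ln_def[abs_def] using \<nu> by (intro continuous_intros continuous_on_powr_ge_1) auto
  have hA: "herm A" and hA': "herm A'" and hR: "herm R" and hS: "herm S" and hC: "herm C" and hL: "herm L" and hP: "herm P"
    unfolding A_def A'_def R_def S_def C_def L_def P_def
    by (rule herm_op_fun[OF X continuous_on_powr_ge_1] herm_op_fun[OF Y continuous_on_powr_ge_1]
        herm_op_fun[OF Z continuous_on_sqrt_powr] op_fun_sqrt_minus_one(1)[OF Z] herm_op_fun[OF Z cL])+
  \<comment> \<open>S is the square root of \<nu> ln_\<nu> Z, so the diagonal of ln_\<nu> Z becomes
    a Hilbert-Schmidt sum.\<close>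
  have SS: "S (S v) = \<nu> *\<^sub>R L v" for v
  proof -
    have "S o\<^sub>L S = op_fun (\<lambda>t. \<nu> * gen_ln \<nu> t) Z"
      unfolding S_def op_fun_mult[OF Z continuous_on_sqrt_powr continuous_on_sqrt_powr, symmetric]
      by (rule op_fun_cong[OF Z]) (use \<nu> in \<open>simp add: gen_ln_def ge_one_powr_ge_zero\<close>)
    then show ?thesis
      unfolding op_fun_cmult[OF Z cL] L_def[symmetric]
      by (metis blinfun_apply_blinfun_compose scaleR_blinfun.rep_eq)
  qed
  have CC: "C (C v) = Z v - v" for v
    unfolding C_def by (rule op_fun_sqrt_minus_one(2)[OF Z])
  have pX: "op_powr X (1 - \<nu>) = A" and pY: "op_powr Y \<nu> = P" and pI: "op_powr Y (- 1/2) = I"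
    unfolding A_def P_def I_def using X Y by (auto intro: op_powr_eq)
  have tc: "trace_class (A o\<^sub>L L)"
    using assms(8) unfolding pX pI Z_def[symmetric] L_def[symmetric] .
  have Ab: "op_between 1 (M powr (1 - \<nu>)) A"
    unfolding A_def using \<nu>
    by (intro op_between_op_fun[OF X continuous_on_powr_ge_1])
      (auto simp: ge_one_powr_ge_zero intro!: powr_mono2)
  \<comment> \<open>The basis chosen inside \<open>op_trace\<close>. The trace-class hypothesis
    supplies summability in a possibly different basis \<open>B'\<close>.\<close>
  define B where "B = (SOME B :: 'a set. is_onb B)"
  from trace_class_summable[OF Ab hL tc] obtain B' g where B': "is_onb B'" "g summable_on B'"
    "\<And>e. Re (cinner e (L e)) \<le> g e" by blast
  have B: "is_onb B" unfolding B_def by (rule someI[of is_onb, OF B'(1)])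
  have nS: "(norm (S e))\<^sup>2 = \<nu> * Re (cinner e (L e))" for e
    unfolding norm_sq_eq_Re_cinner hermD[OF hS] SS by (simp add: cinner_scaleR_right)
  have "(\<lambda>e. (norm (S e))\<^sup>2) summable_on B'"
  proof (rule summable_on_comparison_test[OF summable_on_cmult_right[OF B'(2), of \<nu>]])
    show "(norm (S e))\<^sup>2 \<le> \<nu> * g e" for e
      unfolding nS using B'(3) \<nu> by (intro mult_left_mono) auto
  qed simp
  then have sS: "(\<lambda>e. (norm (S e))\<^sup>2) summable_on B"
    by (rule hilbert_schmidt_adjoint(1)[OF hermD[OF hS] B'(1) B])
  have nC: "(norm (C e))\<^sup>2 \<le> M / \<nu> * (norm (S e))\<^sup>2" for e
  proof -
    have "(norm (C e))\<^sup>2 = Re (cinner e (op_fun (\<lambda>t. t - 1) Z e))"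
      unfolding norm_sq_eq_Re_cinner hermD[OF hC] CC
      using op_fun_diff[OF Z continuous_on_id continuous_on_const[of _ "1::real"]]
      by (simp add: op_fun_ident[OF Z] op_fun_const[OF Z] blinfun.diff_left)
    also have "\<dots> \<le> Re (cinner e (op_fun (\<lambda>t. M * gen_ln \<nu> t) Z e))"
    proof (rule op_fun_mono[OF Z])
      show "t - 1 \<le> M * gen_ln \<nu> t" if "t \<in> {1..M}" for t
        using gen_ln_lower[of t M \<nu>] that \<nu> by (simp add: gen_ln_def)
    qed (intro continuous_intros cL)+
    also have "\<dots> = M / \<nu> * (norm (S e))\<^sup>2"
      unfolding op_fun_cmult[OF Z cL] L_def[symmetric] nS using \<nu>
      by (simp add: blinfun.scaleR_left cinner_scaleR_right)
    finally show ?thesis .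
  qed
  have sC: "(\<lambda>e. (norm (C e))\<^sup>2) summable_on B"
    by (rule summable_on_comparison_test[OF summable_on_cmult_right[OF sS, of "M / \<nu>"]]) (use nC in auto)
  define a where "a e = Re (cinner (R e) (A (R e))) - Re (cinner (R e) (A' (R e)))" for e
  define b where "b e = Re (cinner (S e) (A (S e)))" for e
  define Q where "Q = (\<Sum>\<^sub>\<infinity>e\<in>B. (norm (H (C e)))\<^sup>2)"
  have part: "sum a G + sum b G \<le> Q" if "finite G" "G \<subseteq> B" for G
    using trace_inequality_partial[OF B Y Z M \<nu>, folded H_def C_def, unfolded XHZH, folded A_def A'_def R_def S_def, OF sC that]
    by (simp add: a_def b_def Q_def sum.distrib)
  define E where "E = A - A'"
  have hE: "herm E" unfolding E_def by (rule herm_diff[OF hA hA'])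
  have E0: "0 \<le> Re (cinner v (E v))" for v
    using loewner_heinz[OF B X Y M YX, of "1 - \<nu>" v] \<nu>
    by (simp add: E_def A_def A'_def blinfun.diff_left cinner.diff_right)
  have aE: "a e = Re (cinner (R e) (E (R e)))" for e
    by (simp add: a_def E_def blinfun.diff_left cinner.diff_right)
  have a0: "0 \<le> a e" for e unfolding aE by (rule E0)
  have b0: "0 \<le> b e" for e
    unfolding b_def by (rule order_trans[OF _ op_betweenD(2)[OF Ab]]) simp
  \<comment> \<open>Both families are nonnegative, so the bound on finite sums already yields
    convergence.\<close>
  have sa: "a summable_on B"
  proof (rule nonneg_bdd_above_summable_on)
    have "sum a F \<le> Q" if "F \<subseteq> B" "finite F" for F
      using part[OF that(2,1)] sum_nonneg[of F b] b0 by simp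
    then show "bdd_above (sum a ` {F. F \<subseteq> B \<and> finite F})"
      by (auto intro!: bdd_aboveI[of _ Q])
  qed (rule a0)
  have Eb: "op_between 0 (norm E) E"
    using E0 hE Re_cinner_le[of _ E] by (simp add: op_between_def)
  define K where "K = op_fun sqrt E"
  have cK: "continuous_on {0..norm E} sqrt" by (intro continuous_intros)
  have hK: "herm K" unfolding K_def by (rule herm_op_fun[OF Eb cK])
  have "K o\<^sub>L K = op_fun (\<lambda>t. t) E"
    unfolding K_def op_fun_mult[OF Eb cK cK, symmetric] by (rule op_fun_cong[OF Eb]) simp
  then have KK: "K (K v) = E v" for v
    unfolding op_fun_ident[OF Eb] by (metis blinfun_apply_blinfun_compose)
  have aKR: "a e = (norm (K (R e)))\<^sup>2" for e
    unfolding aE norm_sq_eq_Re_cinner hermD[OF hK] KK ..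
  have adjKR: "cinner (K (R x)) y = cinner x (R (K y))" for x y
    by (simp add: hermD[OF hK] hermD[OF hR])
  have sKR: "(\<lambda>e. (norm (K (R e)))\<^sup>2) summable_on B"
    using sa by (simp add: aKR[abs_def])
  note RK = hilbert_schmidt_adjoint[OF adjKR B B sKR]
  \<comment> \<open>R is invertible, so K inherits the Hilbert-Schmidt property from R K.\<close>
  have RiR: "Ri (R v) = v" for v
    unfolding Ri_def R_def op_fun_powr_powr[OF Y] by (simp add: op_fun_powr_zero[OF Y] del: powr_zero_eq_one)
  have sK: "(\<lambda>e. (norm (K e))\<^sup>2) summable_on B"
    using hilbert_schmidt_left[OF RK(1), of Ri] by (simp add: RiR)
  have RR: "R (R v) = P v" for v
    unfolding R_def P_def op_fun_powr_powr[OF Y] by simp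
  have A'P: "A' (P v) = Y v" for v
    unfolding A'_def P_def op_fun_powr_powr[OF Y] using op_fun_powr_one[OF Y] by simp
  have trEP: "((\<lambda>e. cinner e (E (P e))) has_sum complex_of_real (infsum a B)) B"
  proof -
    from trace_cyclic[OF B hP hK sK] obtain s where
      s: "((\<lambda>e. cinner e (P (K (K e)))) has_sum complex_of_real s) B" "((\<lambda>e. Re (cinner (K e) (P (K e)))) has_sum s) B"
      by blast
    have "Re (cinner (K e) (P (K e))) = (norm (R (K e)))\<^sup>2" for e
      unfolding norm_sq_eq_Re_cinner hermD[OF hR] RR ..
    with s(2) RK(2) have "s = infsum a B"
      using infsumI[OF s(2)] by (simp add: aKR[abs_def])
    \<comment> \<open>\<open>trace_cyclic\<close> yields the trace of P E; conjugation turns it into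
      that of E P, with the same real value.\<close>
    moreover have "((\<lambda>e. cnj (cinner e (P (K (K e))))) has_sum cnj (complex_of_real s)) B"
      by (rule has_sum_bounded_linear[OF bounded_linear_cnj s(1)])
    moreover have "cnj (cinner e (P (K (K e)))) = cinner e (E (P e))" for e
      unfolding KK cnj_cinner by (simp add: hermD[OF hP] hermD[OF hE])
    ultimately show ?thesis by simp
  qed
  have trQ: "((\<lambda>e. cinner e (X e - Y e)) has_sum complex_of_real Q) B"
  proof -
    have adj: "cinner (H (C x)) y = cinner x (C (H y))" for x y
      by (simp add: hermD[OF hH] hermD[OF hC])
    note CH = hilbert_schmidt_adjoint[OF adj B B hilbert_schmidt_left[OF sC, of H]]
    have "((\<lambda>e. (norm (C (H e)))\<^sup>2) has_sum Q) B"
      using has_sum_infsum[OF CH(1)] CH(2) by (simp add: Q_def)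
    from has_sum_of_real[OF this, where 'a=complex]
    have "((\<lambda>e. cinner (C (H e)) (C (H e))) has_sum complex_of_real Q) B"
      unfolding cinner_self .
    \<comment> \<open>X - Y = H (Z - I) H is the adjoint of C H times C H.\<close>
    moreover have "cinner (C (H e)) (C (H e)) = cinner e (X e - Y e)" for e
      unfolding hermD[OF hC] CC hermD[OF hH] HH[symmetric] XHZH[symmetric] by (simp add: blinfun.diff_right)
    ultimately show ?thesis by simp
  qed
  \<comment> \<open>As A' P = Y, the operator X - A P is (X - Y) - E P, a difference of two
    operators whose diagonal sums are known.\<close>
  have "cinner e ((X - (A o\<^sub>L P)) e) = cinner e (X e - Y e) - cinner e (E (P e))" for e
    by (simp add: E_def blinfun.diff_left A'P flip: cinner.diff_right)
  then have "((\<lambda>e. cinner e ((X - (A o\<^sub>L P)) e)) has_sum complex_of_real Q - complex_of_real (infsum a B)) B"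
    using has_sum_diff[OF trQ trEP] by simp
  then have 1: "op_trace (X - (A o\<^sub>L P)) = complex_of_real (Q - infsum a B)"
    unfolding op_trace_def B_def[symmetric] by (simp add: infsumI)
  from trace_cyclic[OF B hA hS sS] obtain s where
    s: "((\<lambda>e. cinner e (A (S (S e)))) has_sum complex_of_real s) B" "(b has_sum s) B"
    unfolding b_def[abs_def] by blast
  have "((\<lambda>e. inverse (complex_of_real \<nu>) * cinner e (A (S (S e)))) has_sum inverse (complex_of_real \<nu>) * complex_of_real s) B"
    by (rule has_sum_cmult_right[OF s(1)])
  moreover have "inverse (complex_of_real \<nu>) * cinner e (A (S (S e))) = cinner e ((A o\<^sub>L L) e)" for e
    using \<nu> by (simp add: SS blinfun.scaleR_right cinner_scaleR_right scaleR_conv_of_real)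
  ultimately have 2: "op_trace (A o\<^sub>L L) = complex_of_real (s / \<nu>)"
    unfolding op_trace_def B_def[symmetric] by (simp add: infsumI divide_inverse mult.commute)
  \<comment> \<open>The bound for all finite G passes to the full sums.\<close>
  have "infsum a B + s \<le> Q"
    by (rule has_sum_le_finite_sums[OF has_sum_add[OF has_sum_infsum[OF sa] s(2)]])
      (use part in \<open>simp add: sum.distrib\<close>)
  then have "s / \<nu> \<le> (Q - infsum a B) / \<nu>"
    using \<nu> by (simp add: divide_right_mono)
  then have "complex_of_real (s / \<nu>) \<le> complex_of_real ((Q - infsum a B) / \<nu>)"
    by (simp add: less_eq_complex_def)
  then show ?thesis
    unfolding tsallis_rel_entropy_def pX pY pI Z_def[symmetric] L_def[symmetric] 1 2 by simp
qed

end
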